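(* Let $(M,g,J)$ be a compact Kähler manifold of complex dimension $m\ge 2$ with constant positive complex scalar curvature $R$ (equal to half of the Riemannian scalar curvature). Let $E$ be its traceless Ricci tensor and $B$ its Bochner tensor. If $$\sqrt{2}\,|E|+|B|\le\frac{2}{m+1}\sqrt{\frac{2(m+1)(m+2)}{2m^2+4m+3}}\;R$$ at every point of $M$, then $(M,g,J)$ is Kähler-Einstein.
   Context: Manifolds are connected. Let $(M,g,J)$ be a Kähler manifold of complex dimension $m$. In local complex coordinates $(z_\alpha)$, $g_{\alpha\bar\beta}$, $R_{\alpha\bar\beta}$, $R_{\alpha\bar\beta\gamma\bar\delta}$ are the components of the metric, the Ricci tensor (usual sign, positive on complex projective space) and the curvature tensor, the curvature sign convention being such that $R_{\alpha\bar\beta}=-g^{\gamma\bar\delta}R_{\alpha\bar\beta\gamma\bar\delta}$ (summation convention). The complex scalar curvature is $R=g^{\alpha\bar\beta}R_{\alpha\bar\beta}$, so the Riemannian scalar curvature is $S_g=2R$. The traceless Ricci tensor is $E=E_{\alpha\bar\beta}\,dz^\alpha\otimes dz^{\bar\beta}+E_{\bar\alpha\beta}\,dz^{\bar\alpha}\otimes dz^\beta$ with $E_{\alpha\bar\beta}=R_{\alpha\bar\beta}-\frac{R}{m}g_{\alpha\bar\beta}$ and $E_{\bar\alpha\beta}=\overline{E_{\alpha\bar\beta}}$; Kähler-Einstein means $E=0$. The Bochner tensor $B$ has components $$B_{\alpha\bar\beta\gamma\bar\delta}=R_{\alpha\bar\beta\gamma\bar\delta}+\tfrac{1}{m+2}\left(R_{\alpha\bar\beta}g_{\gamma\bar\delta}+R_{\gamma\bar\beta}g_{\alpha\bar\delta}+g_{\alpha\bar\beta}R_{\gamma\bar\delta}+g_{\gamma\bar\beta}R_{\alpha\bar\delta}\right)-\tfrac{R}{(m+1)(m+2)}\left(g_{\alpha\bar\beta}g_{\gamma\bar\delta}+g_{\gamma\bar\beta}g_{\alpha\bar\delta}\right).$$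 Norms: at a point, in a frame with $g_{\alpha\bar\beta}=\delta_{\alpha\beta}$, $|E|^2=2\sum_{\alpha,\beta}|E_{\alpha\bar\beta}|^2$ and $|B|^2=4\sum_{\alpha,\beta,\gamma,\delta}|B_{\alpha\bar\beta\gamma\bar\delta}|^2$ (the norms of $E$, $B$ as real tensors). *)

theory Defs
  imports "HOL-Analysis.Analysis"
begin

text \<open>
  A manifold of complex dimension \<open>m\<close> is modelled on \<open>complex ^ 'm\<close> with \<open>m = CARD('m)\<close>.
  The complex structure \<open>J\<close> is given by a holomorphic atlas (in every chart, \<open>J\<close> is multiplication
  by \<open>\<i>\<close>), and a Hermitian metric by its component matrix in every chart of the atlas.
\<close>

section \<open>Smooth and holomorphic maps on open sets\<close>

primrec Ck_on :: "nat \<Rightarrow> 'a::real_normed_vector set \<Rightarrow> ('a \<Rightarrow> 'b::real_normed_vector) \<Rightarrow> bool" where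
  "Ck_on 0 S f \<longleftrightarrow> continuous_on S f"
| "Ck_on (Suc k) S f \<longleftrightarrow> (\<forall>x\<in>S. f differentiable (at x)) \<and>
     (\<forall>v. Ck_on k S (\<lambda>x. frechet_derivative f (at x) v))"

definition smooth_on :: "'a::real_normed_vector set \<Rightarrow> ('a \<Rightarrow> 'b::real_normed_vector) \<Rightarrow> bool" where
  "smooth_on S f \<longleftrightarrow> (\<forall>k. Ck_on k S f)"

definition holomorphic_map_on :: "(complex ^ 'm::finite) set \<Rightarrow> (complex ^ 'm \<Rightarrow> complex ^ 'n::finite) \<Rightarrow> bool" where
  "holomorphic_map_on S f \<longleftrightarrow>
     (\<forall>z\<in>S. \<exists>f'. (f has_derivative f') (at z) \<and> (\<forall>c v. f' (c *s v) = c *s f' v))"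

text \<open>
  The complexified coordinate frame is indexed by \<open>'m + 'm\<close>: \<open>Inl \<alpha>\<close> stands for the index \<open>\<alpha>\<close>
  and \<open>Inr \<alpha>\<close> for the barred index. The following are the Wirtinger derivatives
  \<open>(\<partial>/\<partial>x \<mp> \<i> \<partial>/\<partial>y) / 2\<close>.
\<close>

fun pd :: "'m::finite + 'm \<Rightarrow> (complex ^ 'm \<Rightarrow> complex) \<Rightarrow> complex ^ 'm \<Rightarrow> complex" where
  "pd (Inl \<alpha>) f z =
     (frechet_derivative f (at z) (axis \<alpha> 1) - \<i> * frechet_derivative f (at z) (axis \<alpha> \<i>)) / 2"
| "pd (Inr \<alpha>) f z =
     (frechet_derivative f (at z) (axis \<alpha> 1) + \<i> * frechet_derivative f (at z) (axis \<alpha> \<i>)) / 2"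

section \<open>Complex manifolds\<close>

type_synonym ('a, 'm) chart = "'a set \<times> ('a \<Rightarrow> complex ^ 'm)"

definition chart_image :: "('a, 'm::finite) chart \<Rightarrow> (complex ^ 'm) set" where
  "chart_image c = snd c ` fst c"

definition is_chart :: "'a topology \<Rightarrow> ('a, 'm::finite) chart \<Rightarrow> bool" where
  "is_chart X c \<longleftrightarrow> openin X (fst c) \<and> open (chart_image c) \<and>
     homeomorphic_map (subtopology X (fst c)) (top_of_set (chart_image c)) (snd c)"

definition overlap :: "('a, 'm::finite) chart \<Rightarrow> ('a, 'm) chart \<Rightarrow> (complex ^ 'm) set" where
  "overlap c d = snd c ` (fst c \<inter> fst d)"

definition transition :: "('a, 'm::finite) chart \<Rightarrow> ('a, 'm) chart \<Rightarrow> complex ^ 'm \<Rightarrow> complex ^ 'm" where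
  "transition c d = snd d \<circ> inv_into (fst c) (snd c)"

definition complex_manifold :: "'a topology \<Rightarrow> ('a, 'm::finite) chart set \<Rightarrow> bool" where
  "complex_manifold X A \<longleftrightarrow>
     Hausdorff_space X \<and> second_countable X \<and> connected_space X \<and>
     (\<forall>c\<in>A. is_chart X c) \<and> (\<Union>c\<in>A. fst c) = topspace X \<and>
     (\<forall>c\<in>A. \<forall>d\<in>A. holomorphic_map_on (overlap c d) (transition c d))"

section \<open>Hermitian and Kaehler metrics\<close>

text \<open>
  \<open>h z $ \<alpha> $ \<beta>\<close> is the component of the metric with first index \<open>\<alpha>\<close> and second index \<open>\<beta>\<close> barred.
\<close>

type_synonym 'm metric_comp = "complex ^ 'm \<Rightarrow> complex ^ 'm ^ 'm"

definition hermitian_pos_def :: "complex ^ 'm::finite ^ 'm \<Rightarrow> bool" where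
  "hermitian_pos_def G \<longleftrightarrow>
     (\<forall>\<alpha> \<beta>. G $ \<beta> $ \<alpha> = cnj (G $ \<alpha> $ \<beta>)) \<and>
     (\<forall>v. v \<noteq> 0 \<longrightarrow> Re (\<Sum>\<alpha>\<in>UNIV. \<Sum>\<beta>\<in>UNIV. G $ \<alpha> $ \<beta> * v $ \<alpha> * cnj (v $ \<beta>)) > 0)"

definition hermitian_metric ::
    "('a, 'm::finite) chart set \<Rightarrow> (('a, 'm) chart \<Rightarrow> 'm metric_comp) \<Rightarrow> bool" where
  "hermitian_metric A g \<longleftrightarrow>
     (\<forall>c\<in>A. (\<forall>z\<in>chart_image c. hermitian_pos_def (g c z)) \<and>
             (\<forall>\<alpha> \<beta>. smooth_on (chart_image c) (\<lambda>z. g c z $ \<alpha> $ \<beta>))) \<and>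
     (\<forall>c\<in>A. \<forall>d\<in>A. \<forall>z\<in>overlap c d. \<forall>\<alpha> \<beta>.
        g c z $ \<alpha> $ \<beta> =
          (\<Sum>\<gamma>\<in>UNIV. \<Sum>\<delta>\<in>UNIV.
             pd (Inl \<alpha>) (\<lambda>w. transition c d w $ \<gamma>) z *
             cnj (pd (Inl \<beta>) (\<lambda>w. transition c d w $ \<delta>) z) *
             g d (transition c d z) $ \<gamma> $ \<delta>))"

text \<open>
  The last condition below is \<open>d\<omega> = 0\<close> for the fundamental form
  \<open>\<omega> = \<i> \<Sum> g $ \<alpha> $ \<beta> dz\<^sup>\<alpha> \<and> cnj dz\<^sup>\<beta>\<close>: it says that the (2,1)-part of \<open>d\<omega>\<close> vanishes,
  and the (1,2)-part is its conjugate.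
\<close>

definition kaehler_manifold ::
    "'a topology \<Rightarrow> ('a, 'm::finite) chart set \<Rightarrow> (('a, 'm) chart \<Rightarrow> 'm metric_comp) \<Rightarrow> bool" where
  "kaehler_manifold X A g \<longleftrightarrow> complex_manifold X A \<and> hermitian_metric A g \<and>
     (\<forall>c\<in>A. \<forall>z\<in>chart_image c. \<forall>\<alpha> \<beta> \<gamma>.
        pd (Inl \<gamma>) (\<lambda>w. g c w $ \<alpha> $ \<beta>) z = pd (Inl \<alpha>) (\<lambda>w. g c w $ \<gamma> $ \<beta>) z)"

section \<open>Curvature\<close>

text \<open>
  All quantities below are the components, in one chart with metric components \<open>h\<close>, of the
  complex multilinear extensions of the Riemannian ones, with respect to the frame of the
  \<open>\<partial>/\<partial>z\<^sup>\<alpha>\<close> and their conjugates. Hermitian symmetry of the Riemannian metric says that its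
  components with two unbarred or two barred indices vanish.
\<close>

definition cmetric :: "'m metric_comp \<Rightarrow> complex ^ 'm \<Rightarrow> complex ^ ('m::finite + 'm) ^ ('m + 'm)" where
  "cmetric h z = (\<chi> a b. case (a, b) of
       (Inl \<alpha>, Inr \<beta>) \<Rightarrow> h z $ \<alpha> $ \<beta>
     | (Inr \<alpha>, Inl \<beta>) \<Rightarrow> h z $ \<beta> $ \<alpha>
     | _ \<Rightarrow> 0)"

definition inv_cmetric :: "'m metric_comp \<Rightarrow> complex ^ 'm \<Rightarrow> complex ^ ('m::finite + 'm) ^ ('m + 'm)" where
  "inv_cmetric h z = matrix_inv (cmetric h z)"

text \<open>\<open>ginv h z \<alpha> \<beta>\<close> has its second index barred, so \<open>\<Sum>\<beta>. ginv h z \<alpha> \<beta> * h z $ \<gamma> $ \<beta>\<close> is \<open>1\<close> if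
  \<open>\<alpha> = \<gamma>\<close> and \<open>0\<close> otherwise.\<close>

definition ginv :: "'m metric_comp \<Rightarrow> complex ^ 'm \<Rightarrow> 'm::finite \<Rightarrow> 'm \<Rightarrow> complex" where
  "ginv h z \<alpha> \<beta> = inv_cmetric h z $ Inl \<alpha> $ Inr \<beta>"

text \<open>Levi-Civita connection: \<open>\<nabla>\<^sub>a \<partial>\<^sub>b = \<Sum>e. christoffel h e a b z \<partial>\<^sub>e\<close>.\<close>

definition christoffel ::
    "'m metric_comp \<Rightarrow> 'm::finite + 'm \<Rightarrow> 'm + 'm \<Rightarrow> 'm + 'm \<Rightarrow> complex ^ 'm \<Rightarrow> complex" where
  "christoffel h e a b z =
     (\<Sum>f\<in>UNIV. inv_cmetric h z $ e $ f *
        (pd a (\<lambda>w. cmetric h w $ b $ f) z + pd b (\<lambda>w. cmetric h w $ a $ f) z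
         - pd f (\<lambda>w. cmetric h w $ a $ b) z)) / 2"

text \<open>\<open>R(\<partial>\<^sub>a, \<partial>\<^sub>b) \<partial>\<^sub>c = \<Sum>e. riemann h e c a b z \<partial>\<^sub>e\<close>, with
  \<open>R(u, v) = [\<nabla>\<^sub>u, \<nabla>\<^sub>v] - \<nabla>\<^sub>[\<^sub>u\<^sub>,\<^sub>v\<^sub>]\<close>.\<close>

definition riemann ::
    "'m metric_comp \<Rightarrow> 'm::finite + 'm \<Rightarrow> 'm + 'm \<Rightarrow> 'm + 'm \<Rightarrow> 'm + 'm \<Rightarrow> complex ^ 'm \<Rightarrow> complex" where
  "riemann h e c a b z =
     pd a (christoffel h e b c) z - pd b (christoffel h e a c) z +
     (\<Sum>f\<in>UNIV. christoffel h e a f z * christoffel h f b c z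
               - christoffel h e b f z * christoffel h f a c z)"

text \<open>
  In \<open>curv h z \<alpha> \<beta> \<gamma> \<delta>\<close> the second and fourth index are barred; the value is
  \<open>- \<langle>R(\<partial>\<^sub>\<alpha>, cnj \<partial>\<^sub>\<beta>) \<partial>\<^sub>\<gamma>, cnj \<partial>\<^sub>\<delta>\<rangle>\<close>. For a Kaehler metric this is
  \<open>\<partial>\<^sub>\<gamma> (cnj \<partial>\<^sub>\<delta>) h $ \<alpha> $ \<beta>\<close> plus terms quadratic in first derivatives of \<open>h\<close>, and the
  sign is the one that makes \<open>ricci\<close> below positive on complex projective space.
\<close>

definition curv :: "'m metric_comp \<Rightarrow> complex ^ 'm \<Rightarrow> 'm::finite \<Rightarrow> 'm \<Rightarrow> 'm \<Rightarrow> 'm \<Rightarrow> complex" where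
  "curv h z \<alpha> \<beta> \<gamma> \<delta> =
     - (\<Sum>e\<in>UNIV. riemann h e (Inl \<gamma>) (Inl \<alpha>) (Inr \<beta>) z * cmetric h z $ e $ Inr \<delta>)"

definition ricci :: "'m metric_comp \<Rightarrow> complex ^ 'm \<Rightarrow> 'm::finite \<Rightarrow> 'm \<Rightarrow> complex" where
  "ricci h z \<alpha> \<beta> = - (\<Sum>\<gamma>\<in>UNIV. \<Sum>\<delta>\<in>UNIV. ginv h z \<gamma> \<delta> * curv h z \<alpha> \<beta> \<gamma> \<delta>)"

definition scalar_curv :: "'m::finite metric_comp \<Rightarrow> complex ^ 'm \<Rightarrow> complex" where
  "scalar_curv h z = (\<Sum>\<alpha>\<in>UNIV. \<Sum>\<beta>\<in>UNIV. ginv h z \<alpha> \<beta> * ricci h z \<alpha> \<beta>)"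

definition traceless_ricci :: "'m metric_comp \<Rightarrow> complex ^ 'm \<Rightarrow> 'm::finite \<Rightarrow> 'm \<Rightarrow> complex" where
  "traceless_ricci h z \<alpha> \<beta> =
     ricci h z \<alpha> \<beta> - scalar_curv h z / of_nat CARD('m) * h z $ \<alpha> $ \<beta>"

definition bochner :: "'m metric_comp \<Rightarrow> complex ^ 'm \<Rightarrow> 'm::finite \<Rightarrow> 'm \<Rightarrow> 'm \<Rightarrow> 'm \<Rightarrow> complex" where
  "bochner h z \<alpha> \<beta> \<gamma> \<delta> =
     (let m = of_nat CARD('m); g = (\<lambda>\<alpha> \<beta>. h z $ \<alpha> $ \<beta>); r = ricci h z in
        curv h z \<alpha> \<beta> \<gamma> \<delta>
        + 1 / (m + 2) * (r \<alpha> \<beta> * g \<gamma> \<delta> + r \<gamma> \<beta> * g \<alpha> \<delta> + g \<alpha> \<beta> * r \<gamma> \<delta> + g \<gamma> \<beta> * r \<alpha> \<delta>)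
        - scalar_curv h z / ((m + 1) * (m + 2)) * (g \<alpha> \<beta> * g \<gamma> \<delta> + g \<gamma> \<beta> * g \<alpha> \<delta>))"

text \<open>
  Pointwise norms of real tensors with the given components, by full contraction with the metric.
  In a frame in which the metric has components \<open>\<delta>\<^sub>\<alpha>\<^sub>\<beta>\<close> they are \<open>(2 \<Sum>|T\<^sub>\<alpha>\<^sub>\<beta>|\<^sup>2)\<^sup>1\<^sup>/\<^sup>2\<close> and
  \<open>(4 \<Sum>|T\<^sub>\<alpha>\<^sub>\<beta>\<^sub>\<gamma>\<^sub>\<delta>|\<^sup>2)\<^sup>1\<^sup>/\<^sup>2\<close>. The factors \<open>2\<close> and \<open>4\<close> count the components obtained from
  the given ones by conjugation and by the symmetries of a curvature tensor. Conjugation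
  exchanges barred and unbarred indices, hence the swapped arguments of \<open>ginv\<close>.
\<close>

definition norm11 :: "'m metric_comp \<Rightarrow> complex ^ 'm \<Rightarrow> ('m::finite \<Rightarrow> 'm \<Rightarrow> complex) \<Rightarrow> real" where
  "norm11 h z T = sqrt (2 * Re (\<Sum>\<alpha>\<in>UNIV. \<Sum>\<beta>\<in>UNIV. \<Sum>\<alpha>'\<in>UNIV. \<Sum>\<beta>'\<in>UNIV.
     ginv h z \<alpha> \<alpha>' * ginv h z \<beta>' \<beta> * T \<alpha> \<beta> * cnj (T \<alpha>' \<beta>')))"

definition norm22 ::
    "'m metric_comp \<Rightarrow> complex ^ 'm \<Rightarrow> ('m::finite \<Rightarrow> 'm \<Rightarrow> 'm \<Rightarrow> 'm \<Rightarrow> complex) \<Rightarrow> real" where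
  "norm22 h z T = sqrt (4 * Re (\<Sum>\<alpha>\<in>UNIV. \<Sum>\<beta>\<in>UNIV. \<Sum>\<gamma>\<in>UNIV. \<Sum>\<delta>\<in>UNIV.
     \<Sum>\<alpha>'\<in>UNIV. \<Sum>\<beta>'\<in>UNIV. \<Sum>\<gamma>'\<in>UNIV. \<Sum>\<delta>'\<in>UNIV.
     ginv h z \<alpha> \<alpha>' * ginv h z \<beta>' \<beta> * ginv h z \<gamma> \<gamma>' * ginv h z \<delta>' \<delta> *
     T \<alpha> \<beta> \<gamma> \<delta> * cnj (T \<alpha>' \<beta>' \<gamma>' \<delta>')))"

definition kaehler_einstein ::
    "'a topology \<Rightarrow> ('a, 'm::finite) chart set \<Rightarrow> (('a, 'm) chart \<Rightarrow> 'm metric_comp) \<Rightarrow> bool" where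
  "kaehler_einstein X A g \<longleftrightarrow> kaehler_manifold X A g \<and>
     (\<forall>c\<in>A. \<forall>z\<in>chart_image c. \<forall>\<alpha> \<beta>. traceless_ricci (g c) z \<alpha> \<beta> = 0)"

end

theory Submission
  imports Defs "HOL-Complex_Analysis.Cauchy_Integral_Formula"
begin

text \<open>
  Constant scalar curvature makes the Ricci form harmonic, and \<open>f = |Ric|\<^sup>2 = |E|\<^sup>2 + R\<^sup>2 / m\<close> (here \<open>|E|\<^sup>2\<close> is the
  sum of the squares of the components in a unitary frame) satisfies the Bochner formula
  \<open>\<Delta>f / 2 = |\<nabla>Ric|\<^sup>2 + Q\<close> with \<open>Q = R / (m + 1) |E|\<^sup>2 + m / (m + 2) tr E\<^sup>3 + B(E, E)\<close>. By the Cauchy-Schwarz inequality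
  \<open>B(E, E)\<close> is bounded by the norm of \<open>B\<close> times the norm of the traceless part of the symmetrised square of \<open>E\<close>, and
  the pinching condition gives \<open>Q > 0\<close> wherever \<open>E \<noteq> 0\<close>, also in the case of equality. At a maximum of \<open>f\<close> the
  Laplacian is nonpositive, so \<open>E = 0\<close> there, hence everywhere. Because \<open>Q\<close> is strictly positive, neither integration
  nor the strong maximum principle is needed.
\<close>

section \<open>Smooth functions\<close>

text \<open>The Bochner formula is derived from coordinate matrices, so it splits into an identity
  for traces of noncommuting matrices and two contractions that rest on index symmetries. The other
  obstacle is that \<open>f\<close> must be the same function in all charts, while a chart change is
  only assumed complex differentiable at each point: its Jacobian is first shown to be smooth.
  Between charts only the Ricci tensor, minus the complex Hessian of log det of the metric, is
  transformed, never the full curvature tensor. Origin of the constant: with N the sum of the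
  squared components of \<open>E\<close>, the squared norm of the projected square of
  \<open>E\<close> is a N^2 + b tr E^4, where a = 1/2 + 1/(2(m+1)(m+2)) and b = 1/2 - 1/(m+2). As tr
  E^4 is at most N^2, the norm is at most C N with C^2 = a + b = (2m^2+4m+3)/(2(m+1)(m+2)), and 1/C
  is the square root in the theorem. The factor 2/(m+1) combines the coefficient R/(m+1) of N in
  \<open>Q\<close> with the factor 2 by which sqrt 2 |E| and |B|, as real tensors, exceed the norms
  of their components.\<close>

lemma Ck_on_cong:
  assumes "open S" "\<And>x. x \<in> S \<Longrightarrow> f x = g x" "Ck_on k S f"
  shows "Ck_on k S g"
  using assms(2,3)
proof (induction k arbitrary: f g)
  case 0
  then show ?case using continuous_on_cong[of S S f g] by simp
next
  case (Suc k)
  have d: "(g has_derivative frechet_derivative f (at x)) (at x)" if "x \<in> S" for x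
  proof (rule has_derivative_transform_within_open[OF _ \<open>open S\<close> that])
    show "(f has_derivative frechet_derivative f (at x)) (at x)"
      using Suc.prems that frechet_derivative_works by auto
  qed (use Suc.prems in auto)
  have e: "frechet_derivative f (at x) = frechet_derivative g (at x)" if "x \<in> S" for x
    by (rule frechet_derivative_at[OF d[OF that]])
  have "Ck_on k S (\<lambda>x. frechet_derivative g (at x) v)" for v
    by (rule Suc.IH[where f = "\<lambda>x. frechet_derivative f (at x) v"]) (use Suc.prems e in auto)
  then show ?case
    using d by (auto simp: differentiable_def)
qed

text \<open>\<open>frechet_derivative\<close> is a chosen derivative; by uniqueness any explicit
  formula may stand in for it. The closure properties below are inductions through this
  rule.\<close>

lemma Ck_on_SucI:
  assumes "open S" "\<And>x. x \<in> S \<Longrightarrow> (f has_derivative f' x) (at x)" "\<And>v. Ck_on k S (\<lambda>x. f' x v)"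
  shows "Ck_on (Suc k) S f"
proof -
  have "f' x = frechet_derivative f (at x)" if "x \<in> S" for x
    by (rule frechet_derivative_at[OF assms(2)[OF that]])
  then have "Ck_on k S (\<lambda>x. frechet_derivative f (at x) v)" for v
    by (intro Ck_on_cong[OF assms(1) _ assms(3)[of v]]) simp
  then show ?thesis
    using assms(2) by (auto simp: differentiable_def)
qed

lemma Ck_on_has_derivative:
  "Ck_on (Suc k) S f \<Longrightarrow> x \<in> S \<Longrightarrow> (f has_derivative frechet_derivative f (at x)) (at x)"
  unfolding Ck_on.simps using frechet_derivative_works by blast

lemma Ck_on_Suc_imp_Ck_on: "Ck_on (Suc k) S f \<Longrightarrow> Ck_on k S f"
proof (induction k arbitrary: f)
  case 0
  then show ?case
    using differentiable_imp_continuous_on[of f S]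
    by (auto simp: differentiable_on_def intro: differentiable_at_withinI)
qed auto

lemma Ck_on_const: "open S \<Longrightarrow> Ck_on k S (\<lambda>x. c)"
proof (induction k arbitrary: c)
  case (Suc k)
  then show ?case by (intro Ck_on_SucI[where f' = "\<lambda>x v. 0"]) auto
qed auto

lemma Ck_on_add:
  assumes "open S" "Ck_on k S f" "Ck_on k S g"
  shows "Ck_on k S (\<lambda>x. f x + g x)"
  using assms(2,3)
proof (induction k arbitrary: f g)
  case (Suc k)
  show ?case
    using Suc.prems Ck_on_has_derivative[OF Suc.prems(1)] Ck_on_has_derivative[OF Suc.prems(2)]
    by (intro Ck_on_SucI[OF \<open>open S\<close>, where f' = "\<lambda>x v. frechet_derivative f (at x) v + frechet_derivative g (at x) v"])
      (auto intro!: derivative_eq_intros Suc.IH)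
qed (auto intro: continuous_intros)

lemma Ck_on_linear:
  assumes "open S" "bounded_linear L" "Ck_on k S f"
  shows "Ck_on k S (\<lambda>x. L (f x))"
  using assms(3)
proof (induction k arbitrary: f)
  case 0
  then show ?case using assms(2) by (simp add: linear_continuous_on_compose linear_continuous_on bounded_linear.continuous_on)
next
  case (Suc k)
  show ?case
    using Suc.prems Ck_on_has_derivative[OF Suc.prems(1)]
    by (intro Ck_on_SucI[OF \<open>open S\<close>, where f' = "\<lambda>x v. L (frechet_derivative f (at x) v)"])
      (auto intro!: bounded_linear.has_derivative[OF assms(2)] Suc.IH)
qed

lemma Ck_on_mult:
  fixes f g :: "'a::real_normed_vector \<Rightarrow> 'b::real_normed_algebra"
  assumes "open S" "Ck_on k S f" "Ck_on k S g"
  shows "Ck_on k S (\<lambda>x. f x * g x)"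
  using assms(2,3)
proof (induction k arbitrary: f g)
  case (Suc k)
  show ?case
    using Suc.prems Ck_on_has_derivative[OF Suc.prems(1)] Ck_on_has_derivative[OF Suc.prems(2)]
      Ck_on_Suc_imp_Ck_on[OF Suc.prems(1)] Ck_on_Suc_imp_Ck_on[OF Suc.prems(2)]
    by (intro Ck_on_SucI[OF \<open>open S\<close>,
          where f' = "\<lambda>x v. f x * frechet_derivative g (at x) v + frechet_derivative f (at x) v * g x"])
      (auto intro!: has_derivative_mult Suc.IH Ck_on_add[OF \<open>open S\<close>])
qed (auto intro: continuous_intros)

lemma Ck_on_inverse:
  fixes f :: "'a::real_normed_vector \<Rightarrow> 'b::real_normed_field"
  assumes "open S" "Ck_on k S f" "\<And>x. x \<in> S \<Longrightarrow> f x \<noteq> 0"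
  shows "Ck_on k S (\<lambda>x. inverse (f x))"
  using assms(2,3)
proof (induction k arbitrary: f)
  case (Suc k)
  \<comment> \<open>The derivative of the inverse contains the inverse again; the induction
    hypothesis supplies it at order \<open>k\<close>.\<close>
  have i: "Ck_on k S (\<lambda>x. inverse (f x))"
    using Suc.IH Suc.prems Ck_on_Suc_imp_Ck_on by blast
  show ?case
    using Suc.prems Ck_on_has_derivative[OF Suc.prems(1)]
    by (intro Ck_on_SucI[OF \<open>open S\<close>,
          where f' = "\<lambda>x v. - (inverse (f x) * frechet_derivative f (at x) v * inverse (f x))"])
      (auto intro!: has_derivative_inverse Ck_on_mult[OF \<open>open S\<close>] i
        Ck_on_linear[OF \<open>open S\<close> bounded_linear_minus[OF bounded_linear_ident]])
qed (auto intro!: continuous_intros)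

lemma smooth_on_cong:
  "open S \<Longrightarrow> (\<And>x. x \<in> S \<Longrightarrow> f x = g x) \<Longrightarrow> smooth_on S f \<Longrightarrow> smooth_on S g"
  unfolding smooth_on_def using Ck_on_cong by blast

lemma smooth_on_const: "open S \<Longrightarrow> smooth_on S (\<lambda>x. c)"
  unfolding smooth_on_def using Ck_on_const by blast

lemma smooth_on_add: "open S \<Longrightarrow> smooth_on S f \<Longrightarrow> smooth_on S g \<Longrightarrow> smooth_on S (\<lambda>x. f x + g x)"
  unfolding smooth_on_def using Ck_on_add by blast

lemma smooth_on_linear: "open S \<Longrightarrow> bounded_linear L \<Longrightarrow> smooth_on S f \<Longrightarrow> smooth_on S (\<lambda>x. L (f x))"
  unfolding smooth_on_def using Ck_on_linear by blast

lemma smooth_on_uminus: "open S \<Longrightarrow> smooth_on S f \<Longrightarrow> smooth_on S (\<lambda>x. - f x)"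
  by (rule smooth_on_linear[OF _ bounded_linear_minus[OF bounded_linear_ident]])

lemma smooth_on_diff: "open S \<Longrightarrow> smooth_on S f \<Longrightarrow> smooth_on S g \<Longrightarrow> smooth_on S (\<lambda>x. f x - g x)"
  using smooth_on_add[OF _ _ smooth_on_uminus, of S f g] by simp

lemma smooth_on_mult:
  fixes f g :: "'a::real_normed_vector \<Rightarrow> 'b::real_normed_algebra"
  shows "open S \<Longrightarrow> smooth_on S f \<Longrightarrow> smooth_on S g \<Longrightarrow> smooth_on S (\<lambda>x. f x * g x)"
  unfolding smooth_on_def using Ck_on_mult by blast

lemma smooth_on_inverse:
  fixes f :: "'a::real_normed_vector \<Rightarrow> 'b::real_normed_field"
  shows "open S \<Longrightarrow> smooth_on S f \<Longrightarrow> (\<And>x. x \<in> S \<Longrightarrow> f x \<noteq> 0) \<Longrightarrow> smooth_on S (\<lambda>x. inverse (f x))"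
  unfolding smooth_on_def using Ck_on_inverse by blast

lemma smooth_on_divide:
  fixes f g :: "'a::real_normed_vector \<Rightarrow> 'b::real_normed_field"
  shows "open S \<Longrightarrow> smooth_on S f \<Longrightarrow> smooth_on S g \<Longrightarrow> (\<And>x. x \<in> S \<Longrightarrow> g x \<noteq> 0) \<Longrightarrow> smooth_on S (\<lambda>x. f x / g x)"
  using smooth_on_mult[of S f "\<lambda>x. inverse (g x)"] smooth_on_inverse[of S g] by (simp add: divide_inverse)

lemma smooth_on_sum:
  assumes "open S" "\<And>i. i \<in> I \<Longrightarrow> smooth_on S (f i)"
  shows "smooth_on S (\<lambda>x. \<Sum>i\<in>I. f i x)"
  using assms(2) by (induction I rule: infinite_finite_induct) (auto intro: smooth_on_const smooth_on_add assms(1))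

lemma smooth_on_prod:
  fixes f :: "'i \<Rightarrow> 'a::real_normed_vector \<Rightarrow> 'b::real_normed_field"
  assumes "open S" "\<And>i. i \<in> I \<Longrightarrow> smooth_on S (f i)"
  shows "smooth_on S (\<lambda>x. \<Prod>i\<in>I. f i x)"
  using assms(2) by (induction I rule: infinite_finite_induct) (auto intro: smooth_on_const smooth_on_mult assms(1))

lemma smooth_on_frechet_derivative: "smooth_on S f \<Longrightarrow> smooth_on S (\<lambda>x. frechet_derivative f (at x) v)"
  unfolding smooth_on_def using Ck_on.simps(2) by blast

lemma smooth_on_imp_has_derivative:
  "smooth_on S f \<Longrightarrow> x \<in> S \<Longrightarrow> (f has_derivative frechet_derivative f (at x)) (at x)"
  unfolding smooth_on_def using Ck_on_has_derivative by blast

lemma smooth_on_imp_differentiable: "smooth_on S f \<Longrightarrow> x \<in> S \<Longrightarrow> f differentiable (at x)"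
  using smooth_on_imp_has_derivative differentiable_def by blast

lemma smooth_on_imp_continuous_on: "smooth_on S f \<Longrightarrow> continuous_on S f"
  unfolding smooth_on_def using Ck_on.simps(1) by blast

lemma pd_fun:
  "pd (Inl \<alpha>) f = (\<lambda>z. (frechet_derivative f (at z) (axis \<alpha> 1) - \<i> * frechet_derivative f (at z) (axis \<alpha> \<i>)) / 2)"
  "pd (Inr \<alpha>) f = (\<lambda>z. (frechet_derivative f (at z) (axis \<alpha> 1) + \<i> * frechet_derivative f (at z) (axis \<alpha> \<i>)) / 2)"
  by auto

lemma smooth_on_pd:
  assumes "open S" "smooth_on S f"
  shows "smooth_on S (pd a f)"
proof -
  have c: "smooth_on S (\<lambda>x. \<i> * frechet_derivative f (at x) v)"
    "smooth_on S (\<lambda>x. frechet_derivative f (at x) v)" for v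
    using assms by (auto intro: smooth_on_mult smooth_on_const smooth_on_frechet_derivative)
  show ?thesis
    by (cases a) (simp_all add: pd_fun assms(1) c smooth_on_divide smooth_on_const smooth_on_diff smooth_on_add)
qed

section \<open>Determinants and inverses of matrix-valued functions\<close>

lemma smooth_on_det:
  fixes M :: "'a::real_normed_vector \<Rightarrow> complex ^ 'm::finite ^ 'm"
  assumes "open S" "\<And>i j. smooth_on S (\<lambda>x. M x $ i $ j)"
  shows "smooth_on S (\<lambda>x. det (M x))"
  unfolding det_def using assms
  by (intro smooth_on_sum smooth_on_mult smooth_on_prod smooth_on_const) auto

lemma matrix_inv_inverse:
  assumes "invertible M"
  shows "M ** matrix_inv M = mat 1" "matrix_inv M ** M = mat 1"
  using someI_ex[OF assms[unfolded invertible_def]] unfolding matrix_inv_def by auto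

text \<open>Cramer's rule makes the entries of the inverse quotients of polynomials in the entries
  of \<open>M\<close>, so their smoothness reduces to that of sums, products and quotients.\<close>

lemma matrix_inv_cramer:
  fixes M :: "complex ^ 'm::finite ^ 'm"
  assumes "det M \<noteq> 0"
  shows "matrix_inv M $ k $ l = det (\<chi> i j. if j = k then (if i = l then 1 else 0) else M $ i $ j) / det M"
proof -
  have "M ** matrix_inv M = mat 1"
    using assms by (simp add: invertible_det_nz matrix_inv_inverse)
  then have "M *v column l (matrix_inv M) = axis l 1"
    by (simp add: vec_eq_iff matrix_vector_mult_def column_def matrix_matrix_mult_def mat_def axis_def)
  then have "column l (matrix_inv M) = (\<chi> k. det (\<chi> i j. if j = k then (axis l 1 :: complex^'m) $ i else M $ i $ j) / det M)"
    using cramer[OF assms] by blast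
  then show ?thesis
    by (simp add: vec_eq_iff column_def axis_def cong: if_cong)
qed

lemma smooth_on_matrix_inv:
  fixes M :: "'a::real_normed_vector \<Rightarrow> complex ^ 'm::finite ^ 'm"
  assumes "open S" "\<And>i j. smooth_on S (\<lambda>x. M x $ i $ j)" "\<And>x. x \<in> S \<Longrightarrow> det (M x) \<noteq> 0"
  shows "smooth_on S (\<lambda>x. matrix_inv (M x) $ k $ l)"
proof (rule smooth_on_cong[OF assms(1)])
  have "smooth_on S (\<lambda>x. (\<chi> i j. if j = k then (if i = l then 1 else 0) else M x $ i $ j) $ i $ j)" for i j
    using assms by (cases "j = k") (auto intro: smooth_on_const)
  then show "smooth_on S (\<lambda>x. det (\<chi> i j. if j = k then (if i = l then 1 else 0) else M x $ i $ j) / det (M x))"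
    using assms by (intro smooth_on_divide smooth_on_det) auto
qed (simp add: matrix_inv_cramer assms(3))

section \<open>Wirtinger derivatives\<close>

text \<open>The algebraic part of \<open>pd\<close>. With the linear map as an argument, any known
  derivative can be inserted, and two such operators can be nested on a bilinear form.\<close>

definition wirt :: "'m::finite + 'm \<Rightarrow> (complex ^ 'm \<Rightarrow> complex) \<Rightarrow> complex" where
  "wirt a L = (case a of Inl \<alpha> \<Rightarrow> (L (axis \<alpha> 1) - \<i> * L (axis \<alpha> \<i>)) / 2
                       | Inr \<alpha> \<Rightarrow> (L (axis \<alpha> 1) + \<i> * L (axis \<alpha> \<i>)) / 2)"

lemma pd_eq_wirt: "(f has_derivative f') (at z) \<Longrightarrow> pd a f z = wirt a f'"
  using frechet_derivative_at[of f f' z] by (cases a) (auto simp: wirt_def)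

lemma pd_cong_open:
  assumes "open S" "z \<in> S" "\<And>w. w \<in> S \<Longrightarrow> f w = g w" "f differentiable (at z)"
  shows "pd a f z = pd a g z"
proof -
  obtain f' where f': "(f has_derivative f') (at z)" using assms(4) by (auto simp: differentiable_def)
  then have "(g has_derivative f') (at z)"
    using has_derivative_transform_within_open[OF f' assms(1,2)] assms(3) by simp
  then show ?thesis using f' pd_eq_wirt by metis
qed

lemma pd_const: "pd a (\<lambda>w. c) z = 0"
  by (subst pd_eq_wirt[of _ "\<lambda>v. 0"]) (auto simp: wirt_def split: sum.splits)

lemma pd_add:
  assumes "f differentiable (at z)" "g differentiable (at z)"
  shows "pd a (\<lambda>w. f w + g w) z = pd a f z + pd a g z"
proof -
  obtain f' g' where d: "(f has_derivative f') (at z)" "(g has_derivative g') (at z)"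
    using assms by (auto simp: differentiable_def)
  show ?thesis
    by (subst pd_eq_wirt[OF has_derivative_add[OF d]], subst pd_eq_wirt[OF d(1)], subst pd_eq_wirt[OF d(2)])
      (auto simp: wirt_def algebra_simps add_divide_distrib diff_divide_distrib split: sum.splits)
qed

lemma pd_mult:
  assumes "f differentiable (at z)" "g differentiable (at z)"
  shows "pd a (\<lambda>w. f w * g w) z = pd a f z * g z + f z * pd a g z"
proof -
  obtain f' g' where d: "(f has_derivative f') (at z)" "(g has_derivative g') (at z)"
    using assms by (auto simp: differentiable_def)
  show ?thesis
    by (subst pd_eq_wirt[OF has_derivative_mult[OF d]], subst pd_eq_wirt[OF d(1)], subst pd_eq_wirt[OF d(2)])
      (auto simp: wirt_def algebra_simps add_divide_distrib diff_divide_distrib split: sum.splits)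
qed

lemma pd_uminus:
  assumes "f differentiable (at z)"
  shows "pd a (\<lambda>w. - f w) z = - pd a f z"
  using pd_mult[of "\<lambda>w. -1" z f a] assms by (simp add: pd_const)

lemma pd_diff:
  assumes "f differentiable (at z)" "g differentiable (at z)"
  shows "pd a (\<lambda>w. f w - g w) z = pd a f z - pd a g z"
  using pd_add[of f z "\<lambda>w. - g w" a] assms by (simp add: pd_uminus)

lemma pd_sum:
  assumes "\<And>i. i \<in> I \<Longrightarrow> f i differentiable (at z)"
  shows "pd a (\<lambda>w. \<Sum>i\<in>I. f i w) z = (\<Sum>i\<in>I. pd a (f i) z)"
  using assms
proof (induction I rule: infinite_finite_induct)
  case (insert x F)
  then show ?case by (simp add: pd_add differentiable_sum)
qed (auto simp: pd_const)

lemma differentiable_cnj: "f differentiable (at z) \<Longrightarrow> (\<lambda>w. cnj (f w)) differentiable (at z)"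
  using has_derivative_cnj unfolding differentiable_def by blast

fun bar :: "'m + 'm \<Rightarrow> 'm + 'm" where
  "bar (Inl \<alpha>) = Inr \<alpha>"
| "bar (Inr \<alpha>) = Inl \<alpha>"

lemma pd_cnj:
  assumes "f differentiable (at z)"
  shows "pd a (\<lambda>w. cnj (f w)) z = cnj (pd (bar a) f z)"
proof -
  obtain f' where d: "(f has_derivative f') (at z)"
    using assms by (auto simp: differentiable_def)
  show ?thesis
    by (subst pd_eq_wirt[OF has_derivative_cnj[OF d]], subst pd_eq_wirt[OF d])
      (cases a; auto simp: wirt_def algebra_simps add_divide_distrib diff_divide_distrib)
qed

text \<open>The second difference \<open>f (x+su+sv) - f (x+su) - f (x+sv) + f x\<close> is \<open>s\<^sup>2\<close> times either of the
  two mixed derivatives at some nearby point.\<close>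

lemma second_difference_mvt:
  fixes f :: "'a::real_normed_vector \<Rightarrow> real"
  assumes S: "\<And>p q. 0 \<le> p \<Longrightarrow> p \<le> s \<Longrightarrow> 0 \<le> q \<Longrightarrow> q \<le> s \<Longrightarrow> x + p *\<^sub>R u + q *\<^sub>R v \<in> S"
    and f: "\<And>y. y \<in> S \<Longrightarrow> (f has_derivative f' y) (at y)"
    and f': "\<And>y. y \<in> S \<Longrightarrow> ((\<lambda>y. f' y u) has_derivative f'' y) (at y)"
    and "s > 0"
  obtains p q where "0 \<le> p" "p \<le> s" "0 \<le> q" "q \<le> s"
    "f (x + s *\<^sub>R u + s *\<^sub>R v) - f (x + s *\<^sub>R u) - f (x + s *\<^sub>R v) + f x = s * s * f'' (x + p *\<^sub>R u + q *\<^sub>R v) v"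
proof -
  \<comment> \<open>The second difference is \<open>g s - g 0\<close>. The mean value theorem is
    applied to \<open>g\<close>, and then to the resulting increment of the derivative along
    \<open>v\<close>.\<close>
  define g where "g p = f (x + p *\<^sub>R u + s *\<^sub>R v) - f (x + p *\<^sub>R u)" for p
  have S0: "x + p *\<^sub>R u \<in> S" if "0 \<le> p" "p \<le> s" for p
    using S[of p 0] that \<open>s > 0\<close> by simp
  have "DERIV g p :> f' (x + p *\<^sub>R u + s *\<^sub>R v) u - f' (x + p *\<^sub>R u) u" if p: "0 \<le> p" "p \<le> s" for p
  proof -
    have "((\<lambda>p. f (x + p *\<^sub>R u + s *\<^sub>R v)) has_derivative (\<lambda>h. f' (x + p *\<^sub>R u + s *\<^sub>R v) (h *\<^sub>R u))) (at p)"
      using p \<open>s > 0\<close> by (intro has_derivative_compose[of "\<lambda>p. x + p *\<^sub>R u + s *\<^sub>R v" _ _ _ f] f S)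
        (auto intro!: derivative_eq_intros)
    moreover have "((\<lambda>p. f (x + p *\<^sub>R u)) has_derivative (\<lambda>h. f' (x + p *\<^sub>R u) (h *\<^sub>R u))) (at p)"
      using p \<open>s > 0\<close> by (intro has_derivative_compose[of "\<lambda>p. x + p *\<^sub>R u" _ _ _ f] f S0)
        (auto intro!: derivative_eq_intros)
    moreover have "f' y (h *\<^sub>R u) = f' y u * h" if "y \<in> S" for y h
      using has_derivative_linear[OF f[OF that]] by (simp add: linear_cmul)
    ultimately show ?thesis
      unfolding g_def has_field_derivative_def using S[of p s] S0[of p] p \<open>s > 0\<close>
      by (auto intro!: has_derivative_diff derivative_eq_intros simp: left_diff_distrib)
  qed
  from MVT2[OF \<open>s > 0\<close> this] obtain p where p: "0 < p" "p < s"
    "g s - g 0 = s * (f' (x + p *\<^sub>R u + s *\<^sub>R v) u - f' (x + p *\<^sub>R u) u)" by auto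
  have "DERIV (\<lambda>q. f' (x + p *\<^sub>R u + q *\<^sub>R v) u) q :> f'' (x + p *\<^sub>R u + q *\<^sub>R v) v" if q: "0 \<le> q" "q \<le> s" for q
  proof -
    have "((\<lambda>q. f' (x + p *\<^sub>R u + q *\<^sub>R v) u) has_derivative (\<lambda>h. f'' (x + p *\<^sub>R u + q *\<^sub>R v) (h *\<^sub>R v))) (at q)"
      using p q by (intro has_derivative_compose[of "\<lambda>q. x + p *\<^sub>R u + q *\<^sub>R v" _ _ _ "\<lambda>y. f' y u"] f' S)
        (auto intro!: derivative_eq_intros)
    moreover have "f'' y (h *\<^sub>R v) = f'' y v * h" if "y \<in> S" for y h
      using has_derivative_linear[OF f'[OF that]] by (simp add: linear_cmul)
    ultimately show ?thesis
      unfolding has_field_derivative_def using S[of p q] p q by (auto intro!: derivative_eq_intros)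
  qed
  from MVT2[OF \<open>s > 0\<close> this] obtain q where q: "0 < q" "q < s"
    "f' (x + p *\<^sub>R u + s *\<^sub>R v) u - f' (x + p *\<^sub>R u) u = s * f'' (x + p *\<^sub>R u + q *\<^sub>R v) v" by auto
  show ?thesis
    using p q by (intro that[of p q]) (auto simp: g_def)
qed

text \<open>Each mixed derivative, at some point near \<open>x\<close>, equals the same second
  difference divided by \<open>s * s\<close>. If they differed at \<open>x\<close>, continuity would
  keep them apart at nearby points.\<close>

lemma second_derivative_commute_real:
  fixes f :: "'a::real_normed_vector \<Rightarrow> real"
  assumes "open S" "x \<in> S"
    and f: "\<And>y. y \<in> S \<Longrightarrow> (f has_derivative f' y) (at y)"
    and fu: "\<And>y. y \<in> S \<Longrightarrow> ((\<lambda>y. f' y u) has_derivative fu y) (at y)"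
    and fv: "\<And>y. y \<in> S \<Longrightarrow> ((\<lambda>y. f' y v) has_derivative fv y) (at y)"
    and cont: "isCont (\<lambda>y. fu y v) x" "isCont (\<lambda>y. fv y u) x"
  shows "fu x v = fv x u"
proof (rule ccontr)
  assume ne: "fu x v \<noteq> fv x u"
  \<comment> \<open>Half of the gap: the open intervals of radius \<open>e\<close> about the two
    values are disjoint.\<close>
  define e where "e = \<bar>fu x v - fv x u\<bar> / 2"
  have "e > 0" using ne by (simp add: e_def)
  obtain d1 where d1: "d1 > 0" "\<And>y. dist y x < d1 \<Longrightarrow> dist (fu y v) (fu x v) < e"
    using cont(1) \<open>e > 0\<close> unfolding continuous_at_eps_delta by (metis dist_commute)
  obtain d2 where d2: "d2 > 0" "\<And>y. dist y x < d2 \<Longrightarrow> dist (fv y u) (fv x u) < e"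
    using cont(2) \<open>e > 0\<close> unfolding continuous_at_eps_delta by (metis dist_commute)
  obtain d3 where d3: "d3 > 0" "ball x d3 \<subseteq> S"
    using assms(1,2) open_contains_ball by blast
  define d where "d = min d1 (min d2 d3)"
  \<comment> \<open>So small that the whole parallelogram spanned by \<open>s *\<^sub>R u\<close>
    and \<open>s *\<^sub>R v\<close> stays within \<open>d / 2\<close> of \<open>x\<close>; the
    summand 1 covers \<open>u = v = 0\<close>.\<close>
  define s where "s = d / (2 * (norm u + norm v + 1))"
  have nuv: "norm u + norm v + 1 > 0" by (smt (verit) norm_ge_zero)
  have "d > 0" using d1 d2 d3 by (simp add: d_def)
  then have "s > 0" using nuv by (simp add: s_def)
  have *: "dist (x + p *\<^sub>R u + q *\<^sub>R v) x < d" if "0 \<le> p" "p \<le> s" "0 \<le> q" "q \<le> s" for p q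
  proof -
    have "dist (x + p *\<^sub>R u + q *\<^sub>R v) x \<le> norm (p *\<^sub>R u) + norm (q *\<^sub>R v)"
      using norm_triangle_ineq[of "p *\<^sub>R u" "q *\<^sub>R v"] by (simp add: dist_norm add.assoc)
    also have "\<dots> \<le> s * norm u + s * norm v"
      using that by (intro add_mono) (auto intro!: mult_right_mono)
    also have "\<dots> \<le> s * (norm u + norm v + 1)" using \<open>s > 0\<close> by (simp add: algebra_simps)
    also have "\<dots> = d / 2" using nuv by (simp add: s_def field_simps)
    also have "\<dots> < d" using \<open>d > 0\<close> by simp
    finally show ?thesis .
  qed
  have S: "x + p *\<^sub>R u + q *\<^sub>R v \<in> S" if "0 \<le> p" "p \<le> s" "0 \<le> q" "q \<le> s" for p q
    using *[OF that] d3 by (auto simp: d_def dist_commute subset_iff)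
  obtain p q where pq: "0 \<le> p" "p \<le> s" "0 \<le> q" "q \<le> s"
    "f (x + s *\<^sub>R u + s *\<^sub>R v) - f (x + s *\<^sub>R u) - f (x + s *\<^sub>R v) + f x = s * s * fu (x + p *\<^sub>R u + q *\<^sub>R v) v"
    using second_difference_mvt[OF S f fu \<open>s > 0\<close>] by blast
  have S': "x + q *\<^sub>R v + p *\<^sub>R u \<in> S" if "0 \<le> q" "q \<le> s" "0 \<le> p" "p \<le> s" for p q
    using S[OF that(3,4,1,2)] by (simp add: add.commute add.left_commute)
  obtain p' q' where pq': "0 \<le> p'" "p' \<le> s" "0 \<le> q'" "q' \<le> s"
    "f (x + s *\<^sub>R v + s *\<^sub>R u) - f (x + s *\<^sub>R v) - f (x + s *\<^sub>R u) + f x = s * s * fv (x + q' *\<^sub>R v + p' *\<^sub>R u) u"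
    using second_difference_mvt[OF S' f fv \<open>s > 0\<close>] by blast
  have sw: "x + q' *\<^sub>R v + p' *\<^sub>R u = x + p' *\<^sub>R u + q' *\<^sub>R v" "x + s *\<^sub>R v + s *\<^sub>R u = x + s *\<^sub>R u + s *\<^sub>R v"
    by (auto simp: add.commute add.left_commute)
  have "s * s * fu (x + p *\<^sub>R u + q *\<^sub>R v) v = s * s * fv (x + p' *\<^sub>R u + q' *\<^sub>R v) u"
    using pq(5) pq'(5) unfolding sw by linarith
  then have "fu (x + p *\<^sub>R u + q *\<^sub>R v) v = fv (x + p' *\<^sub>R u + q' *\<^sub>R v) u" using \<open>s > 0\<close> by simp
  then show False
    using d1(2)[of "x + p *\<^sub>R u + q *\<^sub>R v"] d2(2)[of "x + p' *\<^sub>R u + q' *\<^sub>R v"]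
      *[OF pq(1-4)] *[OF pq'(1-4)]
    unfolding e_def d_def dist_real_def by (auto simp: abs_if split: if_splits)
qed

lemma frechet_derivative_commute_complex:
  fixes f :: "'a::real_normed_vector \<Rightarrow> complex"
  assumes "open S" "smooth_on S f" "x \<in> S"
  shows "frechet_derivative (\<lambda>y. frechet_derivative f (at y) u) (at x) v =
         frechet_derivative (\<lambda>y. frechet_derivative f (at y) v) (at x) u"
proof -
  let ?D = "\<lambda>w y. frechet_derivative f (at y) w"
  let ?DD = "\<lambda>w w' y. frechet_derivative (?D w) (at y) w'"
  have f: "(f has_derivative (\<lambda>v. ?D v y)) (at y)" if "y \<in> S" for y
    using smooth_on_imp_has_derivative[OF assms(2) that] .
  have ff: "(?D w has_derivative (\<lambda>v. ?DD w v y)) (at y)" if "y \<in> S" for y w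
    using smooth_on_imp_has_derivative[OF smooth_on_frechet_derivative[OF assms(2)] that] .
  have c: "isCont (?DD w w') x" for w w'
    using smooth_on_imp_continuous_on[OF smooth_on_frechet_derivative[OF smooth_on_frechet_derivative[OF assms(2)]]]
      assms(1,3) continuous_on_eq_continuous_at by blast
  \<comment> \<open>The mean value argument is for real functions, so the identity is tested with
    \<open>Re\<close> and \<open>Im\<close>.\<close>
  have "L (?DD u v x) = L (?DD v u x)" if L: "bounded_linear L" for L :: "complex \<Rightarrow> real"
    by (rule second_derivative_commute_real[OF assms(1,3), where f = "\<lambda>y. L (f y)" and f' = "\<lambda>y v. L (?D v y)"])
      (auto intro!: bounded_linear.has_derivative[OF L] f ff bounded_linear.isCont[OF L] c)
  from this[OF bounded_linear_Re] this[OF bounded_linear_Im] show ?thesis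
    by (rule complex_eqI)
qed

text \<open>Reduces mixed Wirtinger derivatives to algebra on the real second derivative, a bilinear
  form. Its symmetry yields \<open>pd_commute\<close>, and its expansion yields
  \<open>complex_hessian\<close>.\<close>

lemma pd_pd_eq_wirt:
  assumes "open S" "smooth_on S f" "z \<in> S"
  shows "pd a (pd b f) z = wirt a (\<lambda>v. wirt b (\<lambda>u. frechet_derivative (\<lambda>y. frechet_derivative f (at y) u) (at z) v))"
proof -
  have ff: "((\<lambda>y. frechet_derivative f (at y) w) has_derivative
      frechet_derivative (\<lambda>y. frechet_derivative f (at y) w) (at z)) (at z)" for w
    using smooth_on_imp_has_derivative[OF smooth_on_frechet_derivative[OF assms(2)] assms(3)] .
  have "(pd b f has_derivative (\<lambda>v. wirt b (\<lambda>u. frechet_derivative (\<lambda>y. frechet_derivative f (at y) u) (at z) v))) (at z)"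
    by (cases b) (auto simp: pd_fun wirt_def intro!: derivative_eq_intros ff)
  then show ?thesis by (rule pd_eq_wirt)
qed

lemma pd_commute:
  assumes "open S" "smooth_on S f" "z \<in> S"
  shows "pd a (pd b f) z = pd b (pd a f) z"
proof -
  define Q where "Q u v = frechet_derivative (\<lambda>y. frechet_derivative f (at y) u) (at z) v" for u v
  have Q: "Q u v = Q v u" for u v
    unfolding Q_def by (rule frechet_derivative_commute_complex[OF assms])
  have "wirt a (\<lambda>v. wirt b (\<lambda>u. Q u v)) = wirt b (\<lambda>v. wirt a (\<lambda>u. Q u v))"
    unfolding wirt_def
    by (cases a; cases b) (simp_all add: algebra_simps add_divide_distrib diff_divide_distrib Q[of "axis _ 1" "axis _ \<i>"],
        simp_all add: Q)
  then show ?thesis unfolding pd_pd_eq_wirt[OF assms] Q_def .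
qed

section \<open>Matrix-valued functions\<close>

declare pd.simps [simp del]

definition hadj :: "complex ^ 'm::finite ^ 'n::finite \<Rightarrow> complex ^ 'n ^ 'm" where
  "hadj M = (\<chi> i j. cnj (M $ j $ i))"

definition smooth_mat :: "'a::real_normed_vector set \<Rightarrow> ('a \<Rightarrow> complex ^ 'n::finite ^ 'm::finite) \<Rightarrow> bool" where
  "smooth_mat S M \<longleftrightarrow> (\<forall>i j. smooth_on S (\<lambda>w. M w $ i $ j))"

definition diff_mat :: "('a::real_normed_vector \<Rightarrow> complex ^ 'n::finite ^ 'm::finite) \<Rightarrow> 'a \<Rightarrow> bool" where
  "diff_mat M z \<longleftrightarrow> (\<forall>i j. (\<lambda>w. M w $ i $ j) differentiable (at z))"

definition pdm :: "'k::finite + 'k \<Rightarrow> (complex ^ 'k \<Rightarrow> complex ^ 'n::finite ^ 'm::finite) \<Rightarrow> complex ^ 'k \<Rightarrow> complex ^ 'n ^ 'm" where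
  "pdm a M z = (\<chi> i j. pd a (\<lambda>w. M w $ i $ j) z)"

lemma hadj_mult: "hadj (A ** B) = hadj B ** hadj A"
  by (simp add: hadj_def vec_eq_iff matrix_matrix_mult_def mult.commute)

lemma hadj_hadj [simp]: "hadj (hadj A) = A"
  by (simp add: hadj_def vec_eq_iff)

lemma hadj_diff: "hadj (A - B) = hadj A - hadj B"
  by (simp add: hadj_def vec_eq_iff)

lemma hadj_mat_1 [simp]: "hadj (mat 1) = mat 1"
  by (auto simp: hadj_def vec_eq_iff mat_def)

lemma trace_hadj: "trace (hadj A) = cnj (trace A)"
  by (simp add: hadj_def trace_def)

lemma matrix_mult_uminus_left: "(- A) ** B = - (A ** (B :: complex ^ 'a::finite ^ 'b::finite))"
  by (simp add: vec_eq_iff matrix_matrix_mult_def sum_negf)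

lemma matrix_mult_uminus_right: "A ** (- B) = - (A ** (B :: complex ^ 'a::finite ^ 'b::finite))"
  by (simp add: vec_eq_iff matrix_matrix_mult_def sum_negf)

lemma matrix_mult_diff_left: "(A - A') ** B = A ** B - A' ** (B :: complex ^ 'a::finite ^ 'b::finite)"
  by (simp add: vec_eq_iff matrix_matrix_mult_def sum_subtractf algebra_simps)

lemma matrix_mult_diff_right: "A ** (B - B') = A ** B - A ** (B' :: complex ^ 'a::finite ^ 'b::finite)"
  by (simp add: vec_eq_iff matrix_matrix_mult_def sum_subtractf algebra_simps)

lemma matrix_mult_add_left: "(A + A') ** B = A ** B + A' ** (B :: complex ^ 'a::finite ^ 'b::finite)"
  by (simp add: vec_eq_iff matrix_matrix_mult_def sum.distrib algebra_simps)

lemma trace_uminus: "trace (- A) = - trace (A :: complex ^ 'a::finite ^ 'a)"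
  by (simp add: trace_def sum_negf)

lemmas matrix_ring_simps = matrix_mult_uminus_left matrix_mult_uminus_right matrix_mult_diff_left
  matrix_mult_diff_right matrix_add_ldistrib matrix_mult_add_left

lemma smooth_mat_imp_diff_mat: "smooth_mat S M \<Longrightarrow> z \<in> S \<Longrightarrow> diff_mat M z"
  unfolding smooth_mat_def diff_mat_def using smooth_on_imp_differentiable by blast

lemma smooth_mat_mult: "open S \<Longrightarrow> smooth_mat S M \<Longrightarrow> smooth_mat S N \<Longrightarrow> smooth_mat S (\<lambda>w. M w ** N w)"
  by (auto simp: smooth_mat_def matrix_matrix_mult_def intro!: smooth_on_sum smooth_on_mult)

lemma smooth_mat_diff: "open S \<Longrightarrow> smooth_mat S M \<Longrightarrow> smooth_mat S N \<Longrightarrow> smooth_mat S (\<lambda>w. M w - N w)"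
  by (auto simp: smooth_mat_def intro!: smooth_on_diff)

lemma smooth_mat_uminus: "open S \<Longrightarrow> smooth_mat S M \<Longrightarrow> smooth_mat S (\<lambda>w. - M w)"
  by (auto simp: smooth_mat_def intro!: smooth_on_uminus)

lemma smooth_mat_pdm: "open S \<Longrightarrow> smooth_mat S M \<Longrightarrow> smooth_mat S (pdm a M)"
  by (auto simp: smooth_mat_def pdm_def intro!: smooth_on_pd)

lemma smooth_on_trace: "open S \<Longrightarrow> smooth_mat S M \<Longrightarrow> smooth_on S (\<lambda>w. trace (M w))"
  by (auto simp: smooth_mat_def trace_def intro!: smooth_on_sum)

lemma pdm_mult:
  assumes "diff_mat M z" "diff_mat N z"
  shows "pdm a (\<lambda>w. M w ** N w) z = pdm a M z ** N z + M z ** pdm a N z"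
proof -
  have "(\<lambda>w. M w $ i $ k * N w $ k $ j) differentiable at z" for i j k
    using assms by (auto simp: diff_mat_def intro!: differentiable_mult)
  then show ?thesis
    using assms by (simp add: pdm_def vec_eq_iff matrix_matrix_mult_def pd_sum pd_mult diff_mat_def sum.distrib)
qed

lemma pdm_diff: "diff_mat M z \<Longrightarrow> diff_mat N z \<Longrightarrow> pdm a (\<lambda>w. M w - N w) z = pdm a M z - pdm a N z"
  by (simp add: pdm_def vec_eq_iff diff_mat_def pd_diff)

lemma pdm_const: "pdm a (\<lambda>w. M) z = 0"
  by (simp add: pdm_def vec_eq_iff pd_const)

lemma pd_trace: "diff_mat M z \<Longrightarrow> pd a (\<lambda>w. trace (M w)) z = trace (pdm a M z)"
  by (simp add: pdm_def trace_def diff_mat_def pd_sum)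

lemma pdm_hadj: "diff_mat M z \<Longrightarrow> pdm a (\<lambda>w. hadj (M w)) z = hadj (pdm (bar a) M z)"
  by (simp add: pdm_def hadj_def vec_eq_iff diff_mat_def pd_cnj)

lemma pdm_cong_open:
  assumes "open S" "z \<in> S" "\<And>w. w \<in> S \<Longrightarrow> M w = N w" "diff_mat M z"
  shows "pdm a M z = pdm a N z"
  using assms by (auto simp: pdm_def vec_eq_iff diff_mat_def intro!: pd_cong_open[OF assms(1,2)])

lemma pdm_commute: "open S \<Longrightarrow> smooth_mat S M \<Longrightarrow> z \<in> S \<Longrightarrow> pdm a (pdm b M) z = pdm b (pdm a M) z"
proof -
  assume a: "open S" "smooth_mat S M" "z \<in> S"
  have "pd a (pd b (\<lambda>w. M w $ i $ j)) z = pd b (pd a (\<lambda>w. M w $ i $ j)) z" for i j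
    using a by (intro pd_commute) (auto simp: smooth_mat_def)
  then show ?thesis by (simp add: pdm_def vec_eq_iff)
qed

section \<open>Kaehler metrics on an open set\<close>

text \<open>Everything up to the Bochner formula is local, so it is done in one coordinate domain.
  Tensors with one unbarred and one barred index become matrices with the unbarred index as
  row.\<close>

locale kaehler_domain =
  fixes S :: "(complex ^ 'm::finite) set" and h :: "'m metric_comp"
  assumes open_S: "open S"
    and pos_def: "z \<in> S \<Longrightarrow> hermitian_pos_def (h z)"
    and smooth: "smooth_on S (\<lambda>z. h z $ \<alpha> $ \<beta>)"
    and closed: "z \<in> S \<Longrightarrow> pd (Inl \<gamma>) (\<lambda>w. h w $ \<alpha> $ \<beta>) z = pd (Inl \<alpha>) (\<lambda>w. h w $ \<gamma> $ \<beta>) z"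
begin

text \<open>The row index of the inverse is the barred one. Contractions with the metric are thus
  matrix products, and \<open>trace (T ** G z)\<close> is the metric trace of
  \<open>T\<close>.\<close>

definition G :: "complex ^ 'm \<Rightarrow> complex ^ 'm ^ 'm" where
  "G z = matrix_inv (h z)"

text \<open>\<open>Chr a z $ b $ e\<close> is the Christoffel symbol with lower indices \<open>a\<close>, \<open>b\<close> and upper index \<open>e\<close>.\<close>

definition Chr :: "'m \<Rightarrow> complex ^ 'm \<Rightarrow> complex ^ 'm ^ 'm" where
  "Chr a z = pdm (Inl a) h z ** G z"

text \<open>The entry \<open>$ c $ d\<close> is the inner product of R(d_a, dbar_b) d_c with dbar_d,
  the negative of \<open>curv\<close>. With this sign its metric trace is
  \<open>Ric\<close>.\<close>

definition Kap :: "'m \<Rightarrow> 'm \<Rightarrow> complex ^ 'm \<Rightarrow> complex ^ 'm ^ 'm" where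
  "Kap a b z = pdm (Inl a) h z ** G z ** pdm (Inr b) h z - pdm (Inl a) (pdm (Inr b) h) z"

definition Ric :: "complex ^ 'm \<Rightarrow> complex ^ 'm ^ 'm" where
  "Ric z = (\<chi> a b. trace (Kap a b z ** G z))"

lemma smooth_h: "smooth_mat S h"
  by (simp add: smooth_mat_def smooth)

lemma hermitian_h: "z \<in> S \<Longrightarrow> hadj (h z) = h z"
  using pos_def[of z] unfolding hermitian_pos_def_def hadj_def by (metis (no_types, lifting) vec_eq_iff vec_lambda_beta)

lemma invertible_h:
  assumes "z \<in> S"
  shows "invertible (h z)"
proof -
  have "x = 0" if "h z *v x = 0" for x
  proof (rule ccontr)
    assume "x \<noteq> 0"
    \<comment> \<open>The hermitian form conjugates its second argument, so the kernel vector
      \<open>x\<close> enters as \<open>cnj\<close> of \<open>v\<close>.\<close>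
    define v where "v = (\<chi> i. cnj (x $ i))"
    have "v \<noteq> 0" using \<open>x \<noteq> 0\<close> by (auto simp: v_def vec_eq_iff)
    then have "Re (\<Sum>\<alpha>\<in>UNIV. \<Sum>\<beta>\<in>UNIV. h z $ \<alpha> $ \<beta> * v $ \<alpha> * cnj (v $ \<beta>)) > 0"
      using pos_def[OF assms] unfolding hermitian_pos_def_def by blast
    also have "(\<Sum>\<alpha>\<in>UNIV. \<Sum>\<beta>\<in>UNIV. h z $ \<alpha> $ \<beta> * v $ \<alpha> * cnj (v $ \<beta>)) = (\<Sum>\<alpha>\<in>UNIV. v $ \<alpha> * (h z *v x) $ \<alpha>)"
      unfolding v_def matrix_vector_mult_def vec_lambda_beta sum_distrib_left complex_cnj_cnj
      by (intro sum.cong refl) (simp only: mult_ac)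
    finally show False by (simp add: that)
  qed
  then show ?thesis
    unfolding invertible_left_inverse matrix_left_invertible_ker by blast
qed

lemma h_G: "z \<in> S \<Longrightarrow> h z ** G z = mat 1" and G_h: "z \<in> S \<Longrightarrow> G z ** h z = mat 1"
  using matrix_inv_inverse[OF invertible_h] by (auto simp: G_def)

lemma smooth_G: "smooth_mat S G"
  unfolding smooth_mat_def G_def
  by (intro allI smooth_on_matrix_inv open_S smooth) (use invertible_h in \<open>simp add: invertible_det_nz\<close>)

lemma hermitian_G:
  assumes "z \<in> S"
  shows "hadj (G z) = G z"
proof -
  have "h z ** hadj (G z) = mat 1"
    by (metis G_h assms hadj_mat_1 hadj_mult hermitian_h)
  then show ?thesis
    by (metis G_h assms matrix_mul_assoc matrix_mul_lid matrix_mul_rid)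
qed

lemmas smooths = smooth_h smooth_G smooth_mat_mult[OF open_S] smooth_mat_pdm[OF open_S]
  smooth_mat_diff[OF open_S] smooth_mat_uminus[OF open_S]

lemma diff_mats: "z \<in> S \<Longrightarrow> smooth_mat S M \<Longrightarrow> diff_mat M z"
  using smooth_mat_imp_diff_mat by blast

lemma pdm_G:
  assumes "z \<in> S"
  shows "pdm a G z = - (G z ** pdm a h z ** G z)"
proof -
  have "pdm a (\<lambda>w. h w ** G w) z = 0"
    by (subst pdm_cong_open[OF open_S assms h_G]) (auto intro!: diff_mats smooths assms simp: pdm_const)
  then have "pdm a h z ** G z + h z ** pdm a G z = 0"
    by (simp add: pdm_mult diff_mats smooths assms)
  then have "G z ** (h z ** pdm a G z) = G z ** (- (pdm a h z ** G z))"
    by (metis add.commute eq_neg_iff_add_eq_0)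
  then show ?thesis
    by (simp add: matrix_mul_assoc G_h assms matrix_mult_uminus_right)
qed

lemma pdm_bar_h: "z \<in> S \<Longrightarrow> pdm (bar a) h z = hadj (pdm a h z)"
proof -
  assume z: "z \<in> S"
  have "pdm (bar a) h z = pdm (bar a) (\<lambda>w. hadj (h w)) z"
    by (rule pdm_cong_open[OF open_S z]) (auto simp: hermitian_h intro!: diff_mats smooths z)
  also have "\<dots> = hadj (pdm (bar (bar a)) h z)"
    by (rule pdm_hadj) (auto intro!: diff_mats smooths z)
  finally show ?thesis by (cases a) auto
qed

lemma closed_mat: "z \<in> S \<Longrightarrow> pdm (Inl c) h z $ a $ b = pdm (Inl a) h z $ c $ b"
  unfolding pdm_def vec_lambda_beta by (rule closed)

lemma closed_bar: "z \<in> S \<Longrightarrow> pdm (Inr d) h z $ a $ b = pdm (Inr b) h z $ a $ d"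
  using pdm_bar_h[of z "Inl d"] pdm_bar_h[of z "Inl b"] closed_mat[of z d b a]
  by (simp add: hadj_def)

lemma Chr_commute: "z \<in> S \<Longrightarrow> Chr c z $ a $ e = Chr a z $ c $ e"
  by (simp add: Chr_def matrix_matrix_mult_def closed_mat[of z c a])

lemma hadj_Chr: "z \<in> S \<Longrightarrow> hadj (Chr c z) = G z ** pdm (Inr c) h z"
  using pdm_bar_h[of z "Inl c"] by (simp add: Chr_def hadj_mult hermitian_G)

lemma hadj_Chr_commute: "z \<in> S \<Longrightarrow> hadj (Chr d z) $ e $ b = hadj (Chr b z) $ e $ d"
  using Chr_commute[of z d b] by (simp add: hadj_def)

text \<open>The Kaehler symmetries exchange a differentiation index with a matrix index. They relate
  single entries of different matrices, and in this form they can be differentiated.\<close>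

lemma pdm_entry_cong:
  assumes "z \<in> S" "smooth_mat S M" "smooth_mat S N" "\<And>w. w \<in> S \<Longrightarrow> M w $ a $ b = N w $ c $ d"
  shows "pdm e M z $ a $ b = pdm e N z $ c $ d"
  unfolding pdm_def vec_lambda_beta
  using assms by (intro pd_cong_open[OF open_S]) (auto simp: smooth_mat_def intro: smooth_on_imp_differentiable)

lemma pd_pd_h_commute:
  assumes "z \<in> S"
  shows "pdm (Inl c) (pdm (Inr d) h) z $ a $ b = pdm (Inl a) (pdm (Inr d) h) z $ c $ b"
    and "pdm (Inl c) (pdm (Inr d) h) z $ a $ b = pdm (Inl c) (pdm (Inr b) h) z $ a $ d"
proof -
  have "pdm (Inr d) (pdm (Inl c) h) z $ a $ b = pdm (Inr d) (pdm (Inl a) h) z $ c $ b"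
    by (rule pdm_entry_cong[OF assms]) (auto intro: smooths closed_mat)
  then show "pdm (Inl c) (pdm (Inr d) h) z $ a $ b = pdm (Inl a) (pdm (Inr d) h) z $ c $ b"
    by (simp add: pdm_commute[OF open_S smooth_h assms, of "Inl _"])
  show "pdm (Inl c) (pdm (Inr d) h) z $ a $ b = pdm (Inl c) (pdm (Inr b) h) z $ a $ d"
    by (rule pdm_entry_cong[OF assms]) (auto intro: smooths closed_bar)
qed

lemma Kap_eq: "Kap a b z = Chr a z ** pdm (Inr b) h z - pdm (Inl a) (pdm (Inr b) h) z"
  by (simp add: Kap_def Chr_def)

text \<open>In both terms of \<open>Kap\<close> the Kaehler condition exchanges the differentiation
  index with the matrix index of the same type. These symmetries produce the Ricci tensor in the
  Bochner formula.\<close>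

lemma Kap_commute:
  assumes "z \<in> S"
  shows "Kap c d z $ a $ b = Kap a d z $ c $ b" and "Kap c d z $ a $ b = Kap c b z $ a $ d"
  using pd_pd_h_commute[OF assms, of c d a b]
  by (simp_all add: Kap_eq matrix_matrix_mult_def Chr_commute[OF assms, of c a] closed_bar[OF assms, of d _ b])

lemma hadj_Kap:
  assumes "z \<in> S"
  shows "hadj (Kap c d z) = Kap d c z"
proof -
  have "hadj (pdm (Inl c) (pdm (Inr d) h) z) = pdm (Inr c) (\<lambda>w. hadj (pdm (Inr d) h w)) z"
    by (subst pdm_hadj) (auto intro!: diff_mats smooths assms)
  also have "\<dots> = pdm (Inr c) (pdm (Inl d) h) z"
    using pdm_bar_h[of _ "Inr d"] smooths assms
    by (intro pdm_cong_open[OF open_S assms, symmetric]) (auto intro!: diff_mats)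
  also have "\<dots> = pdm (Inl d) (pdm (Inr c) h) z"
    by (rule pdm_commute[OF open_S smooth_h assms])
  finally show ?thesis
    using pdm_bar_h[OF assms, of "Inl c"] pdm_bar_h[OF assms, of "Inr d"]
    by (simp add: Kap_def hadj_diff hadj_mult hermitian_G assms matrix_mul_assoc)
qed

text \<open>A connection matrix of the form (dh) h^(-1) has curvature minus its barred derivative.
  This is what identifies \<open>Kap\<close> with the Riemann tensor later on.\<close>

lemma pdm_Chr:
  assumes "z \<in> S"
  shows "pdm (Inr b) (Chr a) z = - (Kap a b z ** G z)"
proof -
  have "pdm (Inr b) (Chr a) z = pdm (Inr b) (pdm (Inl a) h) z ** G z + pdm (Inl a) h z ** pdm (Inr b) G z"
    unfolding Chr_def[abs_def] by (subst pdm_mult) (auto intro!: diff_mats smooths assms)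
  then show ?thesis
    by (simp add: Kap_def pdm_G assms matrix_ring_simps matrix_mul_assoc
        pdm_commute[OF open_S smooth_h assms, of "Inr b"])
qed

lemma smooth_Chr: "smooth_mat S (Chr a)"
  unfolding Chr_def[abs_def] by (intro smooths)

lemma smooth_Kap: "smooth_mat S (Kap a b)"
  unfolding Kap_def[abs_def] by (intro smooths)

lemma smooth_Ric: "smooth_mat S Ric"
  unfolding smooth_mat_def Ric_def by (auto intro!: smooth_on_trace open_S smooth_mat_mult smooth_Kap smooth_G)

text \<open>By Jacobi's formula \<open>trace (Chr a w)\<close> is the derivative of log det h in
  direction \<open>a\<close>, so this is the classical formula for the Ricci form, without
  determinants.\<close>

lemma Ric_eq_pd:
  assumes "z \<in> S"
  shows "Ric z $ a $ b = - pd (Inr b) (\<lambda>w. trace (Chr a w)) z"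
  using assms by (simp add: pd_trace diff_mats smooth_Chr Ric_def pdm_Chr trace_uminus)

lemma hermitian_Ric:
  assumes "z \<in> S"
  shows "hadj (Ric z) = Ric z"
proof -
  have "cnj (trace (Kap a b z ** G z)) = trace (Kap b a z ** G z)" for a b
  proof -
    have "cnj (trace (Kap a b z ** G z)) = trace (hadj (Kap a b z ** G z))" by (simp add: trace_hadj)
    also have "\<dots> = trace (G z ** Kap b a z)" by (simp add: hadj_mult hadj_Kap hermitian_G assms)
    also have "\<dots> = trace (Kap b a z ** G z)" by (rule trace_mul_sym)
    finally show ?thesis .
  qed
  then show ?thesis by (simp add: Ric_def hadj_def vec_eq_iff)
qed

lemma Ric_closed:
  assumes "z \<in> S"
  shows "pdm (Inl c) Ric z $ a $ b = pdm (Inl a) Ric z $ c $ b"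
proof -
  \<comment> \<open>Symmetry of the second derivatives of log det h, obtained from the cyclicity of
    the trace.\<close>
  have t: "pd (Inl c) (\<lambda>w. trace (Chr a w)) w = pd (Inl a) (\<lambda>w. trace (Chr c w)) w" if w: "w \<in> S" for w a c
  proof -
    have e: "pd (Inl c) (\<lambda>w. trace (Chr a w)) w =
       trace (pdm (Inl c) (pdm (Inl a) h) w ** G w) - trace ((pdm (Inl a) h w ** G w) ** (pdm (Inl c) h w ** G w))" for a c
    proof -
      have "pdm (Inl c) (Chr a) w = pdm (Inl c) (pdm (Inl a) h) w ** G w + pdm (Inl a) h w ** pdm (Inl c) G w"
        unfolding Chr_def[abs_def] by (subst pdm_mult) (auto intro!: diff_mats smooths w)
      then show ?thesis
        by (simp add: pd_trace diff_mats smooth_Chr w pdm_G matrix_mult_uminus_right trace_sub matrix_mul_assoc)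
    qed
    show ?thesis
      unfolding e pdm_commute[OF open_S smooth_h w, of "Inl c" "Inl a"]
        trace_mul_sym[of "pdm (Inl a) h w ** G w" "pdm (Inl c) h w ** G w"] ..
  qed
  have s: "smooth_on S (\<lambda>w. trace (Chr a w))" for a
    by (intro smooth_on_trace smooth_Chr open_S)
  have e: "pdm (Inl c) Ric z $ a $ b = - pd (Inr b) (pd (Inl c) (\<lambda>w. trace (Chr a w))) z" for a c
  proof -
    have "pdm (Inl c) Ric z $ a $ b = pd (Inl c) (\<lambda>w. - pd (Inr b) (\<lambda>w. trace (Chr a w)) w) z"
      using smooth_Ric assms unfolding pdm_def smooth_mat_def
      by (auto intro!: pd_cong_open[OF open_S assms] Ric_eq_pd intro: smooth_on_imp_differentiable)
    also have "\<dots> = - pd (Inl c) (pd (Inr b) (\<lambda>w. trace (Chr a w))) z"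
      using assms by (intro pd_uminus smooth_on_imp_differentiable[OF smooth_on_pd[OF open_S s]])
    finally show ?thesis by (simp add: pd_commute[OF open_S s assms])
  qed
  have "pd (Inr b) (pd (Inl c) (\<lambda>w. trace (Chr a w))) z = pd (Inr b) (pd (Inl a) (\<lambda>w. trace (Chr c w))) z"
    by (rule pd_cong_open[OF open_S assms t])
      (auto intro!: smooth_on_imp_differentiable[OF smooth_on_pd[OF open_S s]] assms)
  then show ?thesis by (simp add: e)
qed

lemma pdm_bar_Ric: "z \<in> S \<Longrightarrow> pdm (bar a) Ric z = hadj (pdm a Ric z)"
proof -
  assume z: "z \<in> S"
  have "pdm (bar a) Ric z = pdm (bar a) (\<lambda>w. hadj (Ric w)) z"
    by (rule pdm_cong_open[OF open_S z]) (auto simp: hermitian_Ric intro!: diff_mats smooth_Ric z)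
  also have "\<dots> = hadj (pdm (bar (bar a)) Ric z)"
    by (rule pdm_hadj) (auto intro!: diff_mats smooth_Ric z)
  finally show ?thesis by (cases a) auto
qed

lemma Ric_closed_bar: "z \<in> S \<Longrightarrow> pdm (Inr d) Ric z $ a $ b = pdm (Inr b) Ric z $ a $ d"
  using pdm_bar_Ric[of z "Inl d"] pdm_bar_Ric[of z "Inl b"] Ric_closed[of z d b a]
  by (simp add: hadj_def)

text \<open>Closedness of the Ricci form, used once for the unbarred and once for the barred
  indices, exchanges the two pairs. It is the leading term in the symmetry of
  \<open>Psi\<close>.\<close>

lemma pd_pd_Ric_commute:
  assumes "z \<in> S"
  shows "pdm (Inl c) (pdm (Inr d) Ric) z $ a $ b = pdm (Inl a) (pdm (Inr b) Ric) z $ c $ d"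
proof -
  have "pdm (Inr d) (pdm (Inl c) Ric) z $ a $ b = pdm (Inr d) (pdm (Inl a) Ric) z $ c $ b"
    by (rule pdm_entry_cong[OF assms]) (auto intro: smooths smooth_Ric Ric_closed)
  then have "pdm (Inl c) (pdm (Inr d) Ric) z $ a $ b = pdm (Inl a) (pdm (Inr d) Ric) z $ c $ b"
    by (simp add: pdm_commute[OF open_S smooth_Ric assms, of "Inl _"])
  also have "\<dots> = pdm (Inl a) (pdm (Inr b) Ric) z $ c $ d"
    by (rule pdm_entry_cong[OF assms]) (auto intro: smooths smooth_Ric Ric_closed_bar)
  finally show ?thesis .
qed

end

section \<open>The Bochner formula\<close>

text \<open>Here \<open>X\<close> stands for Ric G. \<open>P\<close>, \<open>Q\<close>,
  \<open>Z\<close> are the unbarred, barred and mixed derivatives of the metric times G, and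
  \<open>U\<close>, \<open>W\<close>, \<open>Y\<close> those of Ric times G. The left side is half
  the mixed derivative of tr X^2; the right side groups it into \<open>Psi\<close>, curvature and
  gradient terms.\<close>

lemma trace_bochner_identity:
  fixes P Q U W X Y Z :: "complex ^ 'm::finite ^ 'm"
  shows "trace ((U - X ** P) ** (W - X ** Q)) + trace (X ** (Y - W ** P - U ** Q + X ** P ** Q - X ** Z + X ** Q ** P))
    = trace ((Y - P ** W - U ** Q + P ** X ** Q) ** X) + trace (X ** X ** (P ** Q - Z))
      + trace ((U - P ** X) ** (W - X ** Q))"
  using trace_mul_sym[of Y X] trace_mul_sym[of "P ** W" X] trace_mul_sym[of "U ** Q" X]
    trace_mul_sym[of "P ** X ** Q" X] trace_mul_sym[of P "X ** W"] trace_mul_sym[of P "X ** X ** Q"]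
  by (simp add: matrix_ring_simps trace_add trace_sub matrix_mul_assoc)

text \<open>The same regrouping for the mixed derivative of tr X, which is zero when the scalar
  curvature is constant.\<close>

lemma trace_contracted_identity:
  fixes P Q U W X Y Z :: "complex ^ 'm::finite ^ 'm"
  shows "trace (Y - W ** P - U ** Q + X ** P ** Q - X ** Z + X ** Q ** P)
    = trace (Y - P ** W - U ** Q + P ** X ** Q) + trace (X ** (P ** Q - Z))"
  using trace_mul_sym[of W P] trace_mul_sym[of P "X ** Q"]
  by (simp add: matrix_ring_simps trace_add trace_sub matrix_mul_assoc)

lemma trace_mult_eq: "trace (M ** N) = (\<Sum>i\<in>UNIV. \<Sum>j\<in>UNIV. M $ i $ j * N $ j $ i)"
  by (simp add: trace_def matrix_matrix_mult_def)

lemma sum_swap4: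
  "(\<Sum>a\<in>A. \<Sum>b\<in>B. \<Sum>c\<in>C. \<Sum>d\<in>D. f a b c d) = (\<Sum>c\<in>C. \<Sum>d\<in>D. \<Sum>a\<in>A. \<Sum>b\<in>B. f a b c d)"
proof -
  have "(\<Sum>a\<in>A. \<Sum>b\<in>B. \<Sum>c\<in>C. \<Sum>d\<in>D. f a b c d) = (\<Sum>a\<in>A. \<Sum>c\<in>C. \<Sum>b\<in>B. \<Sum>d\<in>D. f a b c d)"
    by (intro sum.cong refl sum.swap)
  also have "\<dots> = (\<Sum>c\<in>C. \<Sum>a\<in>A. \<Sum>b\<in>B. \<Sum>d\<in>D. f a b c d)"
    by (rule sum.swap)
  also have "\<dots> = (\<Sum>c\<in>C. \<Sum>a\<in>A. \<Sum>d\<in>D. \<Sum>b\<in>B. f a b c d)"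
    by (intro sum.cong refl sum.swap)
  also have "\<dots> = (\<Sum>c\<in>C. \<Sum>d\<in>D. \<Sum>a\<in>A. \<Sum>b\<in>B. f a b c d)"
    by (intro sum.cong refl sum.swap)
  finally show ?thesis .
qed

context kaehler_domain
begin

text \<open>\<open>Cov c z\<close> is the covariant derivative of \<open>Ric\<close> in direction \<open>\<partial>\<^sub>c\<close>. \<open>Psi c d z\<close> is its mixed second covariant
  derivative without the curvature term. Unlike the full covariant derivative, it is symmetric under exchange of the
  pairs \<open>(c, d)\<close> and \<open>(a, b)\<close>, so that its contraction over \<open>(c, d)\<close> is a contraction over the indices of
  \<open>Ric\<close>, which is known because the scalar curvature is constant.\<close>

definition Cov :: "'m \<Rightarrow> complex ^ 'm \<Rightarrow> complex ^ 'm ^ 'm" where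
  "Cov c z = pdm (Inl c) Ric z - Chr c z ** Ric z"

definition Psi :: "'m \<Rightarrow> 'm \<Rightarrow> complex ^ 'm \<Rightarrow> complex ^ 'm ^ 'm" where
  "Psi c d z = pdm (Inl c) (pdm (Inr d) Ric) z - Chr c z ** pdm (Inr d) Ric z
     - pdm (Inl c) Ric z ** hadj (Chr d z) + Chr c z ** Ric z ** hadj (Chr d z)"

lemma Psi_commute:
  assumes "z \<in> S"
  shows "Psi c d z $ a $ b = Psi a b z $ c $ d"
proof -
  have 1: "(Chr c z ** pdm (Inr d) Ric z) $ a $ b = (Chr a z ** pdm (Inr b) Ric z) $ c $ d"
    by (simp add: matrix_matrix_mult_def Chr_commute[OF assms, of c a] Ric_closed_bar[OF assms, of d _ b])
  have 2: "(pdm (Inl c) Ric z ** hadj (Chr d z)) $ a $ b = (pdm (Inl a) Ric z ** hadj (Chr b z)) $ c $ d"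
    by (simp add: matrix_matrix_mult_def Ric_closed[OF assms, of c a] hadj_Chr_commute[OF assms, of d _ b])
  have 3: "(Chr c z ** Ric z ** hadj (Chr d z)) $ a $ b = (Chr a z ** Ric z ** hadj (Chr b z)) $ c $ d"
    by (simp add: matrix_matrix_mult_def Chr_commute[OF assms, of c a] hadj_Chr_commute[OF assms, of d _ b])
  show ?thesis
    by (simp add: Psi_def 1 2 3 pd_pd_Ric_commute[OF assms, of c d a b])
qed

lemma hadj_Cov:
  assumes "z \<in> S"
  shows "hadj (Cov d z) = pdm (Inr d) Ric z - Ric z ** hadj (Chr d z)"
  using pdm_bar_Ric[OF assms, of "Inl d"] by (simp add: Cov_def hadj_diff hadj_mult hermitian_Ric assms)

lemma smooth_Ric_G: "smooth_mat S (\<lambda>w. Ric w ** G w)"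
  by (intro smooths smooth_Ric)

lemma pdm_Ric_G:
  assumes "z \<in> S"
  shows "pdm a (\<lambda>w. Ric w ** G w) z = pdm a Ric z ** G z - (Ric z ** G z) ** (pdm a h z ** G z)"
  using assms by (simp add: pdm_mult diff_mats smooths smooth_Ric pdm_G matrix_ring_simps matrix_mul_assoc)

lemma pdm_pdm_Ric_G:
  assumes z: "z \<in> S"
  shows "pdm (Inl c) (pdm (Inr d) (\<lambda>w. Ric w ** G w)) z =
    (let X = Ric z ** G z; P = pdm (Inl c) h z ** G z; Q = pdm (Inr d) h z ** G z;
         U = pdm (Inl c) Ric z ** G z; W = pdm (Inr d) Ric z ** G z
     in pdm (Inl c) (pdm (Inr d) Ric) z ** G z - W ** P - U ** Q + X ** P ** Q
        - X ** (pdm (Inl c) (pdm (Inr d) h) z ** G z) + X ** Q ** P)"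
proof -
  have "pdm (Inl c) (pdm (Inr d) (\<lambda>w. Ric w ** G w)) z =
      pdm (Inl c) (\<lambda>w. pdm (Inr d) Ric w ** G w - (Ric w ** G w) ** (pdm (Inr d) h w ** G w)) z"
    using z by (intro pdm_cong_open[OF open_S]) (auto intro!: pdm_Ric_G diff_mats smooths smooth_Ric)
  also have "\<dots> = pdm (Inl c) (\<lambda>w. pdm (Inr d) Ric w ** G w) z
     - pdm (Inl c) (\<lambda>w. (Ric w ** G w) ** (pdm (Inr d) h w ** G w)) z"
    using z by (intro pdm_diff) (auto intro!: diff_mats smooths smooth_Ric)
  also have "pdm (Inl c) (\<lambda>w. pdm (Inr d) Ric w ** G w) z =
     pdm (Inl c) (pdm (Inr d) Ric) z ** G z + pdm (Inr d) Ric z ** pdm (Inl c) G z"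
    using z by (intro pdm_mult) (auto intro!: diff_mats smooths smooth_Ric)
  also have "pdm (Inl c) (\<lambda>w. (Ric w ** G w) ** (pdm (Inr d) h w ** G w)) z =
     pdm (Inl c) (\<lambda>w. Ric w ** G w) z ** (pdm (Inr d) h z ** G z)
     + (Ric z ** G z) ** pdm (Inl c) (\<lambda>w. pdm (Inr d) h w ** G w) z"
    using z by (intro pdm_mult) (auto intro!: diff_mats smooths smooth_Ric)
  also have "pdm (Inl c) (\<lambda>w. pdm (Inr d) h w ** G w) z =
     pdm (Inl c) (pdm (Inr d) h) z ** G z + pdm (Inr d) h z ** pdm (Inl c) G z"
    using z by (intro pdm_mult) (auto intro!: diff_mats smooths smooth_Ric)
  finally show ?thesis
    by (simp add: Let_def pdm_Ric_G pdm_G z matrix_ring_simps matrix_mul_assoc)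
qed

lemma Psi_G:
  assumes "z \<in> S"
  shows "Psi c d z ** G z =
    (let X = Ric z ** G z; P = pdm (Inl c) h z ** G z; Q = pdm (Inr d) h z ** G z;
         U = pdm (Inl c) Ric z ** G z; W = pdm (Inr d) Ric z ** G z
     in pdm (Inl c) (pdm (Inr d) Ric) z ** G z - P ** W - U ** Q + P ** X ** Q)"
  by (simp add: Let_def Psi_def hadj_Chr assms matrix_ring_simps matrix_mul_assoc)
    (simp add: Chr_def matrix_mul_assoc)

lemma Kap_G: "Kap c d z ** G z = pdm (Inl c) h z ** G z ** (pdm (Inr d) h z ** G z)
    - pdm (Inl c) (pdm (Inr d) h) z ** G z"
  by (simp add: Kap_def matrix_ring_simps matrix_mul_assoc)

lemma Cov_G: "Cov c z ** G z = pdm (Inl c) Ric z ** G z - pdm (Inl c) h z ** G z ** (Ric z ** G z)"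
  by (simp add: Cov_def Chr_def matrix_ring_simps matrix_mul_assoc)

lemma hadj_Cov_G:
  assumes "z \<in> S"
  shows "hadj (Cov d z) ** G z = pdm (Inr d) Ric z ** G z - Ric z ** G z ** (pdm (Inr d) h z ** G z)"
  by (simp add: hadj_Cov hadj_Chr assms matrix_ring_simps matrix_mul_assoc)

text \<open>Obtained by differentiating the constant \<open>trace (Ric w ** G w)\<close> twice.
  Constancy of the scalar curvature enters the Bochner formula through this lemma.\<close>

lemma trace_Psi:
  assumes "z \<in> S" "\<And>w. w \<in> S \<Longrightarrow> trace (Ric w ** G w) = R"
  shows "trace (Psi c d z ** G z) = - trace (Ric z ** G z ** Kap c d z ** G z)"
proof -
  have 0: "trace (pdm (Inr d) (\<lambda>w. Ric w ** G w) w) = 0" if w: "w \<in> S" for w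
  proof -
    have "pd (Inr d) (\<lambda>w. trace (Ric w ** G w)) w = pd (Inr d) (\<lambda>w. R) w"
      by (rule pd_cong_open[OF open_S w assms(2)])
        (auto intro: smooth_on_imp_differentiable[OF smooth_on_trace[OF open_S smooth_Ric_G] w])
    then show ?thesis by (simp add: pd_trace diff_mats[OF w] smooth_Ric_G pd_const)
  qed
  have "pd (Inl c) (\<lambda>w. trace (pdm (Inr d) (\<lambda>w. Ric w ** G w) w)) z = pd (Inl c) (\<lambda>w. 0) z"
    by (rule pd_cong_open[OF open_S assms(1) 0])
      (auto intro!: smooth_on_imp_differentiable[OF smooth_on_trace[OF open_S smooth_mat_pdm] assms(1)] open_S smooth_Ric_G)
  then have "trace (pdm (Inl c) (pdm (Inr d) (\<lambda>w. Ric w ** G w)) z) = 0"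
    by (simp add: pd_trace diff_mats[OF assms(1)] smooth_Ric_G smooth_mat_pdm open_S pd_const)
  then have "trace (Psi c d z ** G z) + trace ((Ric z ** G z) ** (Kap c d z ** G z)) = 0"
    unfolding pdm_pdm_Ric_G[OF assms(1)] Psi_G[OF assms(1)] Kap_G Let_def
    by (simp only: trace_contracted_identity)
  then show ?thesis by (simp add: matrix_mul_assoc eq_neg_iff_add_eq_0)
qed

text \<open>The factor 2 comes from cyclicity: both factors of the square contribute the same trace.
  \<open>Cov\<close> is the covariant gradient that remains after completing the derivative
  terms.\<close>

lemma pd_pd_trace_square:
  assumes z: "z \<in> S"
  shows "pd (Inl c) (pd (Inr d) (\<lambda>w. trace (Ric w ** G w ** Ric w ** G w))) z =
    2 * (trace (Psi c d z ** G z ** Ric z ** G z) + trace (Ric z ** G z ** Ric z ** G z ** Kap c d z ** G z)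
         + trace (Cov c z ** G z ** hadj (Cov d z) ** G z))"
proof -
  define A where "A w = Ric w ** G w" for w
  have sA: "smooth_mat S A" unfolding A_def[abs_def] by (rule smooth_Ric_G)
  have s: "smooth_mat S (\<lambda>w. A w ** A w)" by (intro smooths sA)
  have d: "pd (Inr d) (\<lambda>w. trace (A w ** A w)) w = 2 * trace (A w ** pdm (Inr d) A w)" if "w \<in> S" for w
  proof -
    have "pd (Inr d) (\<lambda>w. trace (A w ** A w)) w = trace (pdm (Inr d) A w ** A w + A w ** pdm (Inr d) A w)"
      using that by (simp add: pd_trace pdm_mult diff_mats s sA)
    then show ?thesis
      using trace_mul_sym[of "pdm (Inr d) A w" "A w"] by (simp add: trace_add)
  qed
  have s2: "smooth_mat S (\<lambda>w. A w ** pdm (Inr d) A w)" by (intro smooths sA)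
  have "pd (Inl c) (pd (Inr d) (\<lambda>w. trace (A w ** A w))) z = pd (Inl c) (\<lambda>w. 2 * trace (A w ** pdm (Inr d) A w)) z"
    by (rule pd_cong_open[OF open_S z d])
      (auto intro!: smooth_on_imp_differentiable[OF smooth_on_pd[OF open_S]] smooth_on_trace s z open_S)
  also have "\<dots> = 2 * trace (pdm (Inl c) A z ** pdm (Inr d) A z + A z ** pdm (Inl c) (pdm (Inr d) A) z)"
    using z smooth_on_imp_differentiable[OF smooth_on_trace[OF open_S s2] z]
    by (simp add: pd_mult pd_const pd_trace diff_mats s2 pdm_mult sA smooth_mat_pdm open_S)
  also have "\<dots> = 2 * (trace (pdm (Inl c) A z ** pdm (Inr d) A z) + trace (A z ** pdm (Inl c) (pdm (Inr d) A) z))"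
    by (simp add: trace_add)
  also have "\<dots> = 2 * (trace ((Psi c d z ** G z) ** (Ric z ** G z))
      + trace ((Ric z ** G z) ** (Ric z ** G z) ** (Kap c d z ** G z))
      + trace ((Cov c z ** G z) ** (hadj (Cov d z) ** G z)))"
    unfolding A_def[abs_def] pdm_pdm_Ric_G[OF z] pdm_Ric_G[OF z] Psi_G[OF z] Kap_G Cov_G hadj_Cov_G[OF z] Let_def
    by (simp only: trace_bochner_identity)
  finally show ?thesis by (simp add: A_def matrix_mul_assoc)
qed

text \<open>Contraction with \<open>G z $ d $ c\<close> is the complex Laplacian. It acts on three
  terms: the gradient term is kept, and in the other two the contraction is moved to the other index
  pair by symmetry.\<close>

theorem bochner_formula:
  assumes z: "z \<in> S" and R: "\<And>w. w \<in> S \<Longrightarrow> trace (Ric w ** G w) = R"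
  shows "(\<Sum>c\<in>UNIV. \<Sum>d\<in>UNIV. G z $ d $ c * pd (Inl c) (pd (Inr d) (\<lambda>w. trace (Ric w ** G w ** Ric w ** G w))) z) =
    2 * (trace (Ric z ** G z ** Ric z ** G z ** Ric z ** G z)
      - (\<Sum>a\<in>UNIV. \<Sum>b\<in>UNIV. trace (Ric z ** G z ** Kap a b z ** G z) * (G z ** Ric z ** G z) $ b $ a)
      + (\<Sum>c\<in>UNIV. \<Sum>d\<in>UNIV. G z $ d $ c * trace (Cov c z ** G z ** hadj (Cov d z) ** G z)))"
proof -
  define N where "N = G z ** Ric z ** G z"
  define M where "M = G z ** Ric z ** G z ** Ric z ** G z"
  \<comment> \<open>After the exchange of pairs, \<open>G\<close> contracts the matrix indices of
    \<open>Psi\<close>, where \<open>trace_Psi\<close> applies.\<close>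
  have "(\<Sum>c\<in>UNIV. \<Sum>d\<in>UNIV. G z $ d $ c * trace (Psi c d z ** N)) =
        (\<Sum>c\<in>UNIV. \<Sum>d\<in>UNIV. \<Sum>a\<in>UNIV. \<Sum>b\<in>UNIV. Psi a b z $ c $ d * G z $ d $ c * N $ b $ a)"
    unfolding trace_mult_eq sum_distrib_left
    by (intro sum.cong refl) (subst Psi_commute[OF z], simp)
  also have "\<dots> = (\<Sum>a\<in>UNIV. \<Sum>b\<in>UNIV. \<Sum>c\<in>UNIV. \<Sum>d\<in>UNIV. Psi a b z $ c $ d * G z $ d $ c * N $ b $ a)"
    by (rule sum_swap4)
  also have "\<dots> = (\<Sum>a\<in>UNIV. \<Sum>b\<in>UNIV. trace (Psi a b z ** G z) * N $ b $ a)"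
    by (simp add: trace_mult_eq sum_distrib_right)
  finally have 1: "(\<Sum>c\<in>UNIV. \<Sum>d\<in>UNIV. G z $ d $ c * trace (Psi c d z ** N)) =
      - (\<Sum>a\<in>UNIV. \<Sum>b\<in>UNIV. trace (Ric z ** G z ** Kap a b z ** G z) * N $ b $ a)"
    by (simp add: trace_Psi[OF z R] sum_negf)
  \<comment> \<open>The same exchange for \<open>Kap\<close>: its contraction is \<open>Ric\<close>,
    which gives the trace of the cube of the Ricci tensor.\<close>
  have "(\<Sum>c\<in>UNIV. \<Sum>d\<in>UNIV. G z $ d $ c * trace (Kap c d z ** M)) =
        (\<Sum>c\<in>UNIV. \<Sum>d\<in>UNIV. \<Sum>a\<in>UNIV. \<Sum>b\<in>UNIV. Kap a b z $ c $ d * G z $ d $ c * M $ b $ a)"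
    unfolding trace_mult_eq sum_distrib_left
    by (intro sum.cong refl) (subst Kap_commute(1)[OF z], subst Kap_commute(2)[OF z], simp)
  also have "\<dots> = (\<Sum>a\<in>UNIV. \<Sum>b\<in>UNIV. \<Sum>c\<in>UNIV. \<Sum>d\<in>UNIV. Kap a b z $ c $ d * G z $ d $ c * M $ b $ a)"
    by (rule sum_swap4)
  also have "\<dots> = (\<Sum>a\<in>UNIV. \<Sum>b\<in>UNIV. Ric z $ a $ b * M $ b $ a)"
    by (simp add: Ric_def trace_mult_eq sum_distrib_right)
  also have "\<dots> = trace (Ric z ** M)" by (simp add: trace_mult_eq)
  finally have 2: "(\<Sum>c\<in>UNIV. \<Sum>d\<in>UNIV. G z $ d $ c * trace (Kap c d z ** M)) = trace (Ric z ** M)" .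
  have "trace (Ric z ** G z ** Ric z ** G z ** Kap c d z ** G z) = trace (Kap c d z ** M)" for c d
    using trace_mul_sym[of "Ric z ** G z ** Ric z ** G z" "Kap c d z ** G z"]
    by (simp add: M_def matrix_mul_assoc)
  then have p: "pd (Inl c) (pd (Inr d) (\<lambda>w. trace (Ric w ** G w ** Ric w ** G w))) z =
    2 * (trace (Psi c d z ** N) + trace (Kap c d z ** M) + trace (Cov c z ** G z ** hadj (Cov d z) ** G z))" for c d
    by (simp add: pd_pd_trace_square[OF z] N_def matrix_mul_assoc)
  have "(\<Sum>c\<in>UNIV. \<Sum>d\<in>UNIV. G z $ d $ c * pd (Inl c) (pd (Inr d) (\<lambda>w. trace (Ric w ** G w ** Ric w ** G w))) z) =
     2 * ((\<Sum>c\<in>UNIV. \<Sum>d\<in>UNIV. G z $ d $ c * trace (Psi c d z ** N))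
      + (\<Sum>c\<in>UNIV. \<Sum>d\<in>UNIV. G z $ d $ c * trace (Kap c d z ** M))
      + (\<Sum>c\<in>UNIV. \<Sum>d\<in>UNIV. G z $ d $ c * trace (Cov c z ** G z ** hadj (Cov d z) ** G z)))"
    unfolding p sum.distrib[symmetric] sum_distrib_left by (intro sum.cong refl) (simp add: algebra_simps)
  then show ?thesis
    unfolding 1 2 by (simp add: M_def N_def matrix_mul_assoc)
qed

end

section \<open>The curvature of a Kaehler metric in coordinates\<close>

lemma sum_UNIV_Plus:
  "(\<Sum>x\<in>UNIV. f x) = (\<Sum>a\<in>UNIV. f (Inl a)) + (\<Sum>b\<in>UNIV. f (Inr b :: 'a::finite + 'b::finite))"
  using sum.Plus[of UNIV UNIV f] by (simp add: comp_def)

lemma matrix_inv_unique: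
  fixes A B :: "'a::field ^ 'n::finite ^ 'n"
  assumes "A ** B = mat 1"
  shows "matrix_inv A = B"
proof -
  have "B ** A = mat 1" using assms by (simp add: matrix_left_right_inverse)
  then have "invertible A" using assms by (auto simp: invertible_def)
  then have "matrix_inv A ** (A ** B) = B"
    by (simp add: matrix_inv_inverse matrix_mul_assoc)
  then show ?thesis by (simp add: assms)
qed

lemma cmetric_simps [simp]:
  "cmetric h z $ Inl \<alpha> $ Inl \<beta> = 0" "cmetric h z $ Inr \<alpha> $ Inr \<beta> = 0"
  "cmetric h z $ Inl \<alpha> $ Inr \<beta> = h z $ \<alpha> $ \<beta>" "cmetric h z $ Inr \<alpha> $ Inl \<beta> = h z $ \<beta> $ \<alpha>"
  by (simp_all add: cmetric_def)

context kaehler_domain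
begin

lemma inv_cmetric_eq:
  assumes "z \<in> S"
  shows "inv_cmetric h z = (\<chi> a b. case (a, b) of
       (Inl \<alpha>, Inr \<beta>) \<Rightarrow> G z $ \<beta> $ \<alpha> | (Inr \<alpha>, Inl \<beta>) \<Rightarrow> G z $ \<alpha> $ \<beta> | _ \<Rightarrow> 0)" (is "_ = ?N")
  unfolding inv_cmetric_def
proof (rule matrix_inv_unique)
  have 1: "(\<Sum>k\<in>UNIV. h z $ i $ k * G z $ k $ j) = (if i = j then 1 else 0)" for i j
    using h_G[OF assms] by (simp add: vec_eq_iff matrix_matrix_mult_def mat_def)
  have 2: "(\<Sum>k\<in>UNIV. h z $ k $ i * G z $ j $ k) = (if i = j then 1 else 0)" for i j
  proof -
    have "(G z ** h z) $ j $ i = (if i = j then 1 else 0)" by (simp add: G_h assms mat_def)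
    then show ?thesis by (simp add: matrix_matrix_mult_def mult.commute)
  qed
  show "cmetric h z ** ?N = mat 1"
    unfolding vec_eq_iff
  proof (intro allI)
    fix a b
    show "(cmetric h z ** ?N) $ a $ b = (mat 1 :: complex ^ ('m + 'm) ^ ('m + 'm)) $ a $ b"
      by (cases a; cases b) (simp_all add: matrix_matrix_mult_def sum_UNIV_Plus 1 2 mat_def)
  qed
qed

lemma inv_cmetric_simps:
  assumes "z \<in> S"
  shows "inv_cmetric h z $ Inl \<alpha> $ Inl \<beta> = 0" "inv_cmetric h z $ Inr \<alpha> $ Inr \<beta> = 0"
    "inv_cmetric h z $ Inl \<alpha> $ Inr \<beta> = G z $ \<beta> $ \<alpha>" "inv_cmetric h z $ Inr \<alpha> $ Inl \<beta> = G z $ \<alpha> $ \<beta>"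
  by (simp_all add: inv_cmetric_eq assms)

lemma ginv_eq: "z \<in> S \<Longrightarrow> ginv h z \<alpha> \<beta> = G z $ \<beta> $ \<alpha>"
  by (simp add: ginv_def inv_cmetric_simps)

lemma pd_h: "pd a (\<lambda>w. h w $ \<alpha> $ \<beta>) z = pdm a h z $ \<alpha> $ \<beta>"
  by (simp add: pdm_def)

text \<open>In a symbol with mixed lower indices the two surviving derivatives of the metric cancel
  by the Kaehler condition, so the Levi-Civita connection preserves the type of a vector.\<close>

lemma christoffel_eq:
  assumes "z \<in> S"
  shows "christoffel h (Inl e) (Inl a) (Inl b) z = Chr a z $ b $ e"
    "christoffel h (Inr e) (Inl a) (Inl b) z = 0"
    "christoffel h f (Inl a) (Inr b) z = 0"
    "christoffel h f (Inr b) (Inl a) z = 0"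
  using assms
  by (cases f; simp add: christoffel_def sum_UNIV_Plus inv_cmetric_simps pd_const pd_h Chr_def
      matrix_matrix_mult_def closed_mat[of z b a] closed_mat[of z _ a] closed_bar[of z b] mult.commute sum_divide_distrib)+

end

section \<open>A pointwise estimate\<close>

lemma sum_mult_mat1:
  fixes f :: "'n::finite \<Rightarrow> complex"
  shows "(\<Sum>s\<in>UNIV. f s * mat 1 $ s $ r) = f r" "(\<Sum>s\<in>UNIV. f s * mat 1 $ r $ s) = f r"
  by (simp_all add: mat_def if_distrib[of "\<lambda>x. _ * x"] cong: if_cong)

definition sum4 :: "('m::finite \<Rightarrow> 'm \<Rightarrow> 'm \<Rightarrow> 'm \<Rightarrow> 'a) \<Rightarrow> 'a::comm_monoid_add" where
  "sum4 f = (\<Sum>p\<in>UNIV. \<Sum>q\<in>UNIV. \<Sum>r\<in>UNIV. \<Sum>s\<in>UNIV. f p q r s)"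

lemma sum4_swap13: "sum4 (\<lambda>p q r s. f r q p s) = sum4 f"
proof -
  have "sum4 (\<lambda>p q r s. f r q p s) = (\<Sum>q\<in>UNIV. \<Sum>p\<in>UNIV. \<Sum>r\<in>UNIV. \<Sum>s\<in>UNIV. f r q p s)"
    unfolding sum4_def by (rule sum.swap)
  also have "\<dots> = (\<Sum>q\<in>UNIV. \<Sum>r\<in>UNIV. \<Sum>p\<in>UNIV. \<Sum>s\<in>UNIV. f r q p s)"
    by (intro sum.cong refl sum.swap)
  also have "\<dots> = sum4 f"
    unfolding sum4_def by (rule sum.swap)
  finally show ?thesis .
qed

lemma sum4_swap24: "sum4 (\<lambda>p q r s. f p s r q) = sum4 f"
proof -
  have "sum4 (\<lambda>p q r s. f p s r q) = (\<Sum>p\<in>UNIV. \<Sum>r\<in>UNIV. \<Sum>q\<in>UNIV. \<Sum>s\<in>UNIV. f p s r q)"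
    unfolding sum4_def by (intro sum.cong refl sum.swap)
  also have "\<dots> = (\<Sum>p\<in>UNIV. \<Sum>r\<in>UNIV. \<Sum>s\<in>UNIV. \<Sum>q\<in>UNIV. f p s r q)"
    by (intro sum.cong refl sum.swap)
  also have "\<dots> = sum4 f"
    unfolding sum4_def by (intro sum.cong refl sum.swap)
  finally show ?thesis .
qed

lemma sum4_add: "sum4 (\<lambda>p q r s. f p q r s + g p q r s) = sum4 f + sum4 g"
  by (simp add: sum4_def sum.distrib)

lemma sum4_diff:
  fixes f g :: "'m::finite \<Rightarrow> 'm \<Rightarrow> 'm \<Rightarrow> 'm \<Rightarrow> 'a::ab_group_add"
  shows "sum4 (\<lambda>p q r s. f p q r s - g p q r s) = sum4 f - sum4 g"
  by (simp add: sum4_def sum_subtractf)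

lemma sum4_uminus:
  fixes f :: "'m::finite \<Rightarrow> 'm \<Rightarrow> 'm \<Rightarrow> 'm \<Rightarrow> 'a::ab_group_add"
  shows "sum4 (\<lambda>p q r s. - f p q r s) = - sum4 f"
  by (simp add: sum4_def sum_negf)

lemma sum4_cmult:
  fixes f :: "'m::finite \<Rightarrow> 'm \<Rightarrow> 'm \<Rightarrow> 'm \<Rightarrow> 'a::semiring_0"
  shows "sum4 (\<lambda>p q r s. c * f p q r s) = c * sum4 f"
  by (simp add: sum4_def sum_distrib_left)

lemma sum4_tuple: "sum4 f = (\<Sum>(p, q, r, s)\<in>UNIV. f p q r s)"
  by (simp add: sum4_def sum.cartesian_product UNIV_Times_UNIV[symmetric] del: UNIV_Times_UNIV)

section \<open>Kaehler symmetric tensors and their traceless projection\<close>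

type_synonym 'm tensor4 = "'m \<Rightarrow> 'm \<Rightarrow> 'm \<Rightarrow> 'm \<Rightarrow> complex"

definition kaehler_symmetric :: "'m::finite tensor4 \<Rightarrow> bool" where
  "kaehler_symmetric F \<longleftrightarrow> (\<forall>p q r s. F p q r s = F r q p s \<and> F p q r s = F p s r q)"

text \<open>One contraction is enough: for a Kaehler symmetric tensor all contractions of an
  unbarred with a barred index agree, as \<open>sum4_trace_symmetric\<close> shows.\<close>

definition traceless4 :: "'m::finite tensor4 \<Rightarrow> bool" where
  "traceless4 F \<longleftrightarrow> (\<forall>p q. (\<Sum>r\<in>UNIV. F p q r r) = 0)"

lemma sum4_trace:
  fixes F :: "'m::finite tensor4"
  assumes "\<And>p q. (\<Sum>r\<in>UNIV. F p q r r) = X $ p $ q"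
  shows "sum4 (\<lambda>p q r s. F p q r s * (Y $ q $ p * mat 1 $ s $ r)) = trace (X ** Y)"
proof -
  have "sum4 (\<lambda>p q r s. F p q r s * (Y $ q $ p * mat 1 $ s $ r)) =
      (\<Sum>p\<in>UNIV. \<Sum>q\<in>UNIV. \<Sum>r\<in>UNIV. \<Sum>s\<in>UNIV. (F p q r s * Y $ q $ p) * mat 1 $ s $ r)"
    by (simp add: sum4_def mult.assoc)
  also have "\<dots> = (\<Sum>p\<in>UNIV. \<Sum>q\<in>UNIV. \<Sum>r\<in>UNIV. F p q r r * Y $ q $ p)"
    unfolding sum_mult_mat1 ..
  also have "\<dots> = trace (X ** Y)"
    by (simp add: assms trace_def matrix_matrix_mult_def sum_distrib_right[symmetric])
  finally show ?thesis .
qed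

lemma sum4_trace_symmetric:
  fixes F :: "'m::finite tensor4"
  assumes F: "kaehler_symmetric F" and t: "\<And>p q. (\<Sum>r\<in>UNIV. F p q r r) = X $ p $ q"
  shows "sum4 (\<lambda>p q r s. F p q r s * (Y $ q $ p * mat 1 $ s $ r)) = trace (X ** Y)"
    "sum4 (\<lambda>p q r s. F p q r s * (Y $ q $ r * mat 1 $ s $ p)) = trace (X ** Y)"
    "sum4 (\<lambda>p q r s. F p q r s * (Y $ s $ r * mat 1 $ q $ p)) = trace (X ** Y)"
    "sum4 (\<lambda>p q r s. F p q r s * (Y $ s $ p * mat 1 $ q $ r)) = trace (X ** Y)"
proof -
  have s: "F p q r s = F r q p s" "F p q r s = F p s r q" for p q r s
    using F by (auto simp: kaehler_symmetric_def)
  show 1: "sum4 (\<lambda>p q r s. F p q r s * (Y $ q $ p * mat 1 $ s $ r)) = trace (X ** Y)"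
    by (rule sum4_trace[of F X Y, OF t])
  show 2: "sum4 (\<lambda>p q r s. F p q r s * (Y $ q $ r * mat 1 $ s $ p)) = trace (X ** Y)"
    unfolding 1[symmetric]
    by (subst sum4_swap13[symmetric]) (simp only: s(1)[of _ _ _ _, symmetric])
  show "sum4 (\<lambda>p q r s. F p q r s * (Y $ s $ p * mat 1 $ q $ r)) = trace (X ** Y)"
    unfolding 1[symmetric]
    by (subst sum4_swap24[symmetric]) (simp only: s(2)[of _ _ _ _, symmetric])
  show "sum4 (\<lambda>p q r s. F p q r s * (Y $ s $ r * mat 1 $ q $ p)) = trace (X ** Y)"
    unfolding 2[symmetric]
    by (subst sum4_swap24[symmetric]) (simp only: s(2)[of _ _ _ _, symmetric])
qed

text \<open>For traceless \<open>X\<close>, the orthogonal projection of the symmetrised square of \<open>X\<close> to the traceless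
  Kaehler symmetric tensors.\<close>

definition bproj :: "complex ^ 'm ^ 'm \<Rightarrow> 'm::finite tensor4" where
  "bproj X p q r s = (let m = of_nat CARD('m); U = X ** X; I = mat 1 :: complex ^ 'm ^ 'm in
     (X $ q $ p * X $ s $ r + X $ q $ r * X $ s $ p) / 2
     - (U $ q $ p * I $ s $ r + U $ q $ r * I $ s $ p + U $ s $ r * I $ q $ p + U $ s $ p * I $ q $ r) / (2 * (m + 2))
     + trace U / (2 * (m + 1) * (m + 2)) * (I $ q $ p * I $ s $ r + I $ q $ r * I $ s $ p))"

lemma bproj_symmetric: "kaehler_symmetric (bproj X)"
  by (auto simp: kaehler_symmetric_def bproj_def Let_def algebra_simps)

text \<open>\<open>bproj X\<close> differs from the square of \<open>X\<close> by a symmetrisation,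
  which a symmetric \<open>F\<close> does not see, and by multiples of the identity, which a
  traceless \<open>F\<close> annihilates.\<close>

lemma bproj_pairing:
  fixes F :: "'m::finite tensor4"
  assumes F: "kaehler_symmetric F" "traceless4 F"
  shows "sum4 (\<lambda>p q r s. F p q r s * bproj X p q r s) = sum4 (\<lambda>p q r s. F p q r s * (X $ q $ p * X $ s $ r))"
proof -
  let ?m = "of_nat CARD('m) :: complex"
  let ?I = "mat 1 :: complex ^ 'm ^ 'm"
  define U where "U = X ** X"
  have s: "F p q r s = F r q p s" for p q r s
    using F by (auto simp: kaehler_symmetric_def)
  have t: "(\<Sum>r\<in>UNIV. F p q r r) = (0 :: complex^'m^'m) $ p $ q" for p q
    using F by (simp add: traceless4_def)
  have z: "trace ((0 :: complex^'m^'m) ** Y) = 0" for Y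
    by (simp add: trace_def matrix_matrix_mult_def)
  note tr = sum4_trace_symmetric[of F 0, OF F(1) t, unfolded z]
  have sw: "sum4 (\<lambda>p q r s. F p q r s * (X $ q $ r * X $ s $ p)) = sum4 (\<lambda>p q r s. F p q r s * (X $ q $ p * X $ s $ r))"
    by (subst sum4_swap13[symmetric]) (simp only: s[of _ _ _ _, symmetric])
  have "sum4 (\<lambda>p q r s. F p q r s * bproj X p q r s) = sum4 (\<lambda>p q r s.
      1/2 * (F p q r s * (X $ q $ p * X $ s $ r)) + 1/2 * (F p q r s * (X $ q $ r * X $ s $ p))
      - (1 / (2 * (?m + 2))) * (F p q r s * (U $ q $ p * ?I $ s $ r))
      - (1 / (2 * (?m + 2))) * (F p q r s * (U $ q $ r * ?I $ s $ p))
      - (1 / (2 * (?m + 2))) * (F p q r s * (U $ s $ r * ?I $ q $ p))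
      - (1 / (2 * (?m + 2))) * (F p q r s * (U $ s $ p * ?I $ q $ r))
      + trace U / (2 * (?m + 1) * (?m + 2)) * (F p q r s * (?I $ q $ p * ?I $ s $ r))
      + trace U / (2 * (?m + 1) * (?m + 2)) * (F p q r s * (?I $ q $ r * ?I $ s $ p)))"
    unfolding bproj_def Let_def U_def by (simp add: algebra_simps add_divide_distrib)
  also have "\<dots> = sum4 (\<lambda>p q r s. F p q r s * (X $ q $ p * X $ s $ r))"
    unfolding sum4_add sum4_diff sum4_cmult tr sw by simp
  finally show ?thesis .
qed

text \<open>The coefficients of \<open>bproj\<close> come from here. Contracting the middle bracket
  gives m + 2 copies of X^2, which cancel the contracted square, and a multiple of tr X^2 times the
  identity. The contraction of the last bracket carries a factor m + 1 and cancels that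
  multiple.\<close>

lemma bproj_traceless:
  fixes X :: "complex ^ 'm::finite ^ 'm"
  assumes "trace X = 0"
  shows "traceless4 (bproj X)"
  unfolding traceless4_def
proof (intro allI)
  fix p q
  let ?m = "of_nat CARD('m) :: complex"
  let ?I = "mat 1 :: complex ^ 'm ^ 'm"
  define U where "U = X ** X"
  have m: "?m + 1 \<noteq> 0" "?m + 2 \<noteq> 0"
    using of_nat_neq_0[of "CARD('m)", where 'a = complex] of_nat_neq_0[of "CARD('m) + 1", where 'a = complex]
    by (simp_all add: algebra_simps)
  have 1: "(\<Sum>r\<in>UNIV. X $ r $ r) = 0" using assms by (simp add: trace_def)
  have 2: "(\<Sum>r\<in>UNIV. X $ q $ r * X $ r $ p) = U $ q $ p" by (simp add: U_def matrix_matrix_mult_def)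
  have 3: "(\<Sum>r\<in>UNIV. ?I $ r $ r) = ?m" by (simp add: mat_def)
  have 4: "(\<Sum>r\<in>UNIV. U $ r $ r) = trace U" by (simp add: trace_def)
  have "(\<Sum>r\<in>UNIV. bproj X p q r r) =
      (X $ q $ p * (\<Sum>r\<in>UNIV. X $ r $ r) + (\<Sum>r\<in>UNIV. X $ q $ r * X $ r $ p)) / 2
     - (U $ q $ p * (\<Sum>r\<in>UNIV. ?I $ r $ r) + (\<Sum>r\<in>UNIV. U $ q $ r * ?I $ r $ p) + (\<Sum>r\<in>UNIV. U $ r $ r) * ?I $ q $ p
         + (\<Sum>r\<in>UNIV. U $ r $ p * ?I $ q $ r)) / (2 * (?m + 2))
     + trace U / (2 * (?m + 1) * (?m + 2)) * (?I $ q $ p * (\<Sum>r\<in>UNIV. ?I $ r $ r) + (\<Sum>r\<in>UNIV. ?I $ q $ r * ?I $ r $ p))"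
    unfolding bproj_def Let_def U_def
    by (simp only: sum.distrib sum_subtractf sum_divide_distrib[symmetric] sum_distrib_left[symmetric] sum_distrib_right[symmetric])
  also have "\<dots> = 0"
    unfolding 1 2 3 4 sum_mult_mat1 using m by (simp add: divide_simps) algebra
  finally show "(\<Sum>r\<in>UNIV. bproj X p q r r) = 0" .
qed

lemma cnj_bproj: "cnj (bproj X p q r s) = bproj (\<chi> i j. cnj (X $ i $ j)) p q r s"
proof -
  let ?Y = "\<chi> i j. cnj (X $ i $ j)"
  have "cnj ((X ** X) $ i $ j) = (?Y ** ?Y) $ i $ j" for i j
    by (simp add: matrix_matrix_mult_def)
  moreover from this have "cnj (trace (X ** X)) = trace (?Y ** ?Y)" by (simp add: trace_def)
  moreover have "cnj (mat 1 $ i $ j) = (mat 1 :: complex^'a^'a) $ i $ j" for i j by (simp add: mat_def)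
  ultimately show ?thesis by (simp add: bproj_def Let_def)
qed

section \<open>Cauchy-Schwarz inequalities for matrices and tensors\<close>

definition fnorm2 :: "complex ^ 'm::finite ^ 'n::finite \<Rightarrow> real" where
  "fnorm2 X = (\<Sum>p\<in>UNIV. \<Sum>q\<in>UNIV. (cmod (X $ p $ q))\<^sup>2)"

lemma fnorm2_nonneg: "fnorm2 X \<ge> 0"
  by (simp add: fnorm2_def sum_nonneg)

lemma trace_hadj_self: "trace (X ** hadj X) = of_real (fnorm2 X)"
  by (simp add: trace_def matrix_matrix_mult_def hadj_def fnorm2_def complex_norm_square[symmetric] del: of_real_power)

lemma cmod_sum_mult_le:
  "(cmod (\<Sum>i\<in>A. f i * g i))\<^sup>2 \<le> (\<Sum>i\<in>A. (cmod (f i))\<^sup>2) * (\<Sum>i\<in>A. (cmod (g i))\<^sup>2)"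
proof -
  have "cmod (\<Sum>i\<in>A. f i * g i) \<le> (\<Sum>i\<in>A. cmod (f i) * cmod (g i))"
    by (rule order_trans[OF norm_sum]) (simp add: norm_mult)
  then have "(cmod (\<Sum>i\<in>A. f i * g i))\<^sup>2 \<le> (\<Sum>i\<in>A. cmod (f i) * cmod (g i))\<^sup>2"
    by (simp add: power_mono)
  also have "\<dots> \<le> (\<Sum>i\<in>A. (cmod (f i))\<^sup>2) * (\<Sum>i\<in>A. (cmod (g i))\<^sup>2)"
    by (rule Cauchy_Schwarz_ineq_sum)
  finally show ?thesis .
qed

lemma fnorm2_mult_le: "fnorm2 (X ** Y) \<le> fnorm2 X * fnorm2 Y"
proof -
  have "fnorm2 (X ** Y) \<le> (\<Sum>p\<in>UNIV. \<Sum>q\<in>UNIV. (\<Sum>k\<in>UNIV. (cmod (X $ p $ k))\<^sup>2) * (\<Sum>k\<in>UNIV. (cmod (Y $ k $ q))\<^sup>2))"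
    unfolding fnorm2_def matrix_matrix_mult_def by (intro sum_mono) (simp add: cmod_sum_mult_le)
  also have "\<dots> = fnorm2 X * (\<Sum>q\<in>UNIV. \<Sum>k\<in>UNIV. (cmod (Y $ k $ q))\<^sup>2)"
    by (simp only: fnorm2_def sum_product)
  also have "(\<Sum>q\<in>UNIV. \<Sum>k\<in>UNIV. (cmod (Y $ k $ q))\<^sup>2) = fnorm2 Y"
    unfolding fnorm2_def by (rule sum.swap)
  finally show ?thesis .
qed

lemma cmod_trace_mult_le: "(cmod (trace (X ** Y)))\<^sup>2 \<le> fnorm2 X * fnorm2 Y"
proof -
  have "trace (X ** Y) = (\<Sum>(p, q)\<in>UNIV. X $ p $ q * Y $ q $ p)"
    by (simp add: trace_def matrix_matrix_mult_def sum.cartesian_product)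
  also have "(cmod \<dots>)\<^sup>2 \<le> (\<Sum>(p, q)\<in>UNIV. (cmod (X $ p $ q))\<^sup>2) * (\<Sum>(p, q)\<in>UNIV. (cmod (Y $ q $ p))\<^sup>2)"
    using cmod_sum_mult_le[of "\<lambda>(p, q). X $ p $ q" "\<lambda>(p, q). Y $ q $ p" UNIV] by (simp add: case_prod_beta)
  also have "(\<Sum>(p, q)\<in>UNIV. (cmod (X $ p $ q))\<^sup>2) = fnorm2 X"
    by (simp add: fnorm2_def sum.cartesian_product)
  also have "(\<Sum>(p, q)\<in>UNIV. (cmod (Y $ q $ p))\<^sup>2) = fnorm2 Y"
    unfolding fnorm2_def by (subst sum.swap) (simp add: sum.cartesian_product)
  finally show ?thesis .
qed

definition norm4 :: "'m::finite tensor4 \<Rightarrow> real" where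
  "norm4 F = sqrt (sum4 (\<lambda>p q r s. (cmod (F p q r s))\<^sup>2))"

lemma sum4_nonneg: "(\<And>p q r s. 0 \<le> f p q r s) \<Longrightarrow> 0 \<le> (sum4 f :: real)"
  by (simp add: sum4_def sum_nonneg)

lemma cmod_sum4_mult_le: "cmod (sum4 (\<lambda>p q r s. F p q r s * H p q r s)) \<le> norm4 F * norm4 H"
proof -
  have "(cmod (sum4 (\<lambda>p q r s. F p q r s * H p q r s)))\<^sup>2 \<le> (norm4 F * norm4 H)\<^sup>2"
    using cmod_sum_mult_le[of "\<lambda>(p, q, r, s). F p q r s" "\<lambda>(p, q, r, s). H p q r s" UNIV]
    by (simp add: norm4_def power_mult_distrib sum4_nonneg sum4_tuple case_prod_beta sum_nonneg)
  then show ?thesis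
    by (rule power2_le_imp_le) (simp add: norm4_def sum4_nonneg)
qed

text \<open>In the quartic contractions below the indices form either two cycles of length 2 or one
  cycle of length 4. The variants account for the order in which the factors arise.\<close>

lemma sum4_pair:
  "sum4 (\<lambda>p q r s. A $ p $ q * B $ q $ p * C $ r $ s * D $ s $ r) = trace (A ** B) * trace (C ** D)"
  for A B C D :: "complex ^ 'm::finite ^ 'm"
  unfolding sum4_def trace_def matrix_matrix_mult_def vec_lambda_beta sum_distrib_right
  unfolding sum_distrib_left by (simp add: mult.assoc)

lemma sum4_pair':
  "sum4 (\<lambda>p q r s. C $ r $ s * D $ s $ r * A $ p $ q * B $ q $ p) = trace (A ** B) * trace (C ** D)"
  for A B C D :: "complex ^ 'm::finite ^ 'm"
  unfolding sum4_pair[symmetric] by (simp add: mult_ac)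

lemma sum4_cycle:
  "sum4 (\<lambda>p q r s. A $ p $ q * B $ q $ r * C $ r $ s * D $ s $ p) = trace (A ** B ** (C ** D))"
  for A B C D :: "complex ^ 'm::finite ^ 'm"
proof -
  have "trace (A ** B ** (C ** D)) = (\<Sum>p\<in>UNIV. \<Sum>r\<in>UNIV. (\<Sum>q\<in>UNIV. A $ p $ q * B $ q $ r) * (\<Sum>s\<in>UNIV. C $ r $ s * D $ s $ p))"
    by (simp add: trace_def matrix_matrix_mult_def)
  also have "\<dots> = (\<Sum>p\<in>UNIV. \<Sum>r\<in>UNIV. \<Sum>q\<in>UNIV. \<Sum>s\<in>UNIV. A $ p $ q * B $ q $ r * C $ r $ s * D $ s $ p)"
    by (simp add: sum_product mult.assoc)
  also have "\<dots> = sum4 (\<lambda>p q r s. A $ p $ q * B $ q $ r * C $ r $ s * D $ s $ p)"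
    unfolding sum4_def by (intro sum.cong refl sum.swap)
  finally show ?thesis by simp
qed

lemma sum4_cycle':
  "sum4 (\<lambda>p q r s. C $ r $ s * D $ s $ p * A $ p $ q * B $ q $ r) = trace (A ** B ** (C ** D))"
  for A B C D :: "complex ^ 'm::finite ^ 'm"
  unfolding sum4_cycle[symmetric] by (simp add: mult_ac)

lemma sum4_cycle_rev:
  "sum4 (\<lambda>p q r s. A $ p $ s * B $ s $ r * C $ r $ q * D $ q $ p) = trace (A ** B ** (C ** D))"
  for A B C D :: "complex ^ 'm::finite ^ 'm"
  unfolding sum4_cycle[symmetric]
  using sum4_swap24[of "\<lambda>p q r s. A $ p $ q * B $ q $ r * C $ r $ s * D $ s $ p"] by simp

text \<open>As \<open>bproj X\<close> is the projection of the symmetrised square, its squared norm is its pairing with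
  the (conjugated) square itself.\<close>

lemma norm4_bproj:
  fixes X :: "complex ^ 'm::finite ^ 'm"
  assumes herm: "hadj X = X" and tr: "trace X = 0"
  shows "(norm4 (bproj X))\<^sup>2 = (fnorm2 X)\<^sup>2 * (1/2 + 1 / (2 * (real CARD('m) + 1) * (real CARD('m) + 2)))
     + fnorm2 (X ** X) * (1/2 - 1 / (real CARD('m) + 2))"
proof -
  let ?m = "of_nat CARD('m) :: complex"
  let ?I = "mat 1 :: complex ^ 'm ^ 'm"
  let ?Y = "(\<chi> i j. cnj (X $ i $ j)) :: complex^'m^'m"
  define U where "U = X ** X"
  have Y: "cnj (X $ q $ p) = X $ p $ q" for p q
    using herm by (metis (mono_tags, lifting) hadj_def vec_lambda_beta)
  have N: "trace U = of_real (fnorm2 X)"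
    using trace_hadj_self[of X] by (simp add: herm U_def)
  have "hadj U = U" by (simp add: U_def hadj_mult herm)
  then have N2: "trace (U ** U) = of_real (fnorm2 U)"
    using trace_hadj_self[of U] by simp
  have "complex_of_real ((norm4 (bproj X))\<^sup>2) = sum4 (\<lambda>p q r s. bproj X p q r s * cnj (bproj X p q r s))"
    by (simp add: norm4_def sum4_nonneg) (simp add: sum4_def complex_norm_square[symmetric] del: of_real_power)
  also have "\<dots> = sum4 (\<lambda>p q r s. bproj X p q r s * (?Y $ q $ p * ?Y $ s $ r))"
    unfolding cnj_bproj by (rule bproj_pairing[OF bproj_symmetric bproj_traceless[OF tr]])
  also have "\<dots> = sum4 (\<lambda>p q r s. bproj X p q r s * (X $ p $ q * X $ r $ s))"
    by (simp add: Y)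
  also have "\<dots> = sum4 (\<lambda>p q r s.
       1/2 * ((X $ p $ q * X $ q $ p) * (X $ r $ s * X $ s $ r))
     + 1/2 * (X $ p $ q * X $ q $ r * (X $ r $ s * X $ s $ p))
     - 1 / (2 * (?m + 2)) * (X $ p $ q * U $ q $ p * X $ r $ s * ?I $ s $ r)
     - 1 / (2 * (?m + 2)) * (X $ p $ q * U $ q $ r * X $ r $ s * ?I $ s $ p)
     - 1 / (2 * (?m + 2)) * (X $ r $ s * U $ s $ r * X $ p $ q * ?I $ q $ p)
     - 1 / (2 * (?m + 2)) * (X $ r $ s * U $ s $ p * X $ p $ q * ?I $ q $ r)
     + trace U / (2 * (?m + 1) * (?m + 2)) * (X $ p $ q * ?I $ q $ p * X $ r $ s * ?I $ s $ r)
     + trace U / (2 * (?m + 1) * (?m + 2)) * (X $ p $ q * ?I $ q $ r * X $ r $ s * ?I $ s $ p))"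
    unfolding bproj_def Let_def U_def by (simp add: algebra_simps add_divide_distrib)
  finally have *: "complex_of_real ((norm4 (bproj X))\<^sup>2) = \<dots>" .
  have "?m + 2 = of_nat (CARD('m) + 2)" "2 * ?m + 4 = of_nat (2 * CARD('m) + 4)" by simp_all
  then have m: "?m + 2 \<noteq> 0" "2 * ?m + 4 \<noteq> 0"
    by (simp_all only: of_nat_eq_0_iff)
  have tI: "trace (X ** ?I) = 0" by (simp add: tr)
  have c1: "trace (X ** U ** (X ** ?I)) = trace (U ** U)"
    using trace_mul_sym[of "X ** U" X] by (simp add: U_def matrix_mul_assoc)
  have c2: "trace (X ** ?I ** (X ** U)) = trace (U ** U)" "trace (X ** ?I ** (X ** ?I)) = trace U"
    by (simp_all add: U_def matrix_mul_assoc)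
  \<comment> \<open>Of the four terms with X^2, the two that split into 2-cycles contain tr X = 0;
    the two 4-cycles give tr X^4 each, hence the coefficient 1/(m + 2). Of the last two terms only
    the 4-cycle survives.\<close>
  have "complex_of_real ((norm4 (bproj X))\<^sup>2) =
     1/2 * (trace U * trace U) + 1/2 * trace (U ** U) - 1 / (?m + 2) * trace (U ** U)
     + trace U / (2 * (?m + 1) * (?m + 2)) * trace U"
    unfolding * sum4_add sum4_diff sum4_cmult
    unfolding mult.assoc[symmetric]
    unfolding sum4_pair sum4_pair' sum4_cycle sum4_cycle' tI c1 c2
    by (simp add: U_def matrix_mul_assoc) (use m in \<open>simp add: frac_eq_eq algebra_simps\<close>)
  also have "\<dots> = of_real ((fnorm2 X)\<^sup>2 * (1/2 + 1 / (2 * (real CARD('m) + 1) * (real CARD('m) + 2)))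
     + fnorm2 U * (1/2 - 1 / (real CARD('m) + 2)))"
    unfolding N N2 by (simp add: power2_eq_square algebra_simps)
  finally show ?thesis unfolding of_real_eq_iff U_def .
qed

lemma mat_mult: "mat c ** X = (\<chi> i j. c * X $ i $ j)" "X ** mat c = (\<chi> i j. c * X $ i $ j)"
  for X :: "complex ^ 'm::finite ^ 'm"
  by (simp_all add: vec_eq_iff matrix_matrix_mult_def mat_def if_distrib[of "\<lambda>x. x * _"]
      if_distrib[of "\<lambda>x. _ * x"] mult.commute cong: if_cong)

lemma trace_cmult: "trace (\<chi> i j. c * X $ i $ j) = c * trace X" for X :: "complex ^ 'm::finite ^ 'm"
  by (simp add: trace_def sum_distrib_left)

lemma trace_shift:
  fixes F :: "complex ^ 'm::finite ^ 'm"
  assumes "trace F = 0"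
  shows "trace ((F + mat c) ** (F + mat c)) = trace (F ** F) + c * c * of_nat CARD('m)"
    "trace ((F + mat c) ** (F + mat c) ** (F + mat c)) = trace (F ** F ** F) + 3 * c * trace (F ** F) + c * c * c * of_nat CARD('m)"
proof -
  have tI: "trace (mat d :: complex^'m^'m) = d * of_nat CARD('m)" for d by (simp add: trace_def mat_def)
  have mm: "mat c ** (mat d :: complex^'m^'m) = mat (c * d)" for c d
    unfolding mat_mult(1) by (simp add: vec_eq_iff mat_def)
  have t1: "trace (mat d ** X) = d * trace X" "trace (X ** mat d) = d * trace X" for d and X :: "complex^'m^'m"
    by (simp_all add: mat_mult trace_cmult)
  have t2: "trace (X ** mat d ** Y) = d * trace (X ** Y)" for d and X Y :: "complex^'m^'m"
    using trace_mul_sym[of "X ** mat d" Y] trace_mul_sym[of X Y] by (simp add: matrix_mul_assoc t1)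
  have t3: "trace (mat d ** X ** Y) = d * trace (X ** Y)" for d and X Y :: "complex^'m^'m"
    using t1(1)[of d "X ** Y"] by (simp add: matrix_mul_assoc)
  show "trace ((F + mat c) ** (F + mat c)) = trace (F ** F) + c * c * of_nat CARD('m)"
    by (simp add: matrix_add_ldistrib matrix_mult_add_left trace_add t1 mm tI assms)
  show "trace ((F + mat c) ** (F + mat c) ** (F + mat c)) = trace (F ** F ** F) + 3 * c * trace (F ** F) + c * c * c * of_nat CARD('m)"
    by (simp add: matrix_add_ldistrib matrix_mult_add_left trace_add t1 t2 t3 mm tI assms)
qed

section \<open>The Bochner tensor and the zero-order term in a unitary frame\<close>

definition bochner_frame :: "'m::finite tensor4 \<Rightarrow> complex ^ 'm ^ 'm \<Rightarrow> complex \<Rightarrow> 'm tensor4" where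
  "bochner_frame K r R p q u v = (let m = of_nat CARD('m); I = mat 1 :: complex ^ 'm ^ 'm in
     - K p q u v + 1 / (m + 2) * (r $ p $ q * I $ u $ v + r $ u $ q * I $ p $ v + I $ p $ q * r $ u $ v + I $ u $ q * r $ p $ v)
     - R / ((m + 1) * (m + 2)) * (I $ p $ q * I $ u $ v + I $ u $ q * I $ p $ v))"

text \<open>Pure linear algebra at one point: \<open>K\<close> plays the role of \<open>Kap\<close>
  in a unitary frame, so it has the sign opposite to the curvature tensor in the definition of the
  Bochner tensor, hence \<open>- K\<close> in \<open>bochner_frame\<close>.\<close>

locale curvature_frame =
  fixes K :: "'m::finite tensor4" and r :: "complex ^ 'm ^ 'm" and R :: complex
  assumes K_symmetric: "kaehler_symmetric K"
    and K_trace: "(\<Sum>u\<in>UNIV. K p q u u) = r $ p $ q"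
    and r_trace: "trace r = R"
begin

definition E :: "complex ^ 'm ^ 'm" where
  "E = r - mat (R / of_nat CARD('m))"

lemma dim_nonzero: "(of_nat CARD('m) :: complex) \<noteq> 0" "(of_nat CARD('m) :: complex) + 1 \<noteq> 0" "(of_nat CARD('m) :: complex) + 2 \<noteq> 0"
  using of_nat_neq_0[of "CARD('m)", where 'a = complex] of_nat_neq_0[of "CARD('m) + 1", where 'a = complex]
  by (simp_all add: algebra_simps)

lemma trace_E: "trace E = 0"
  using dim_nonzero by (simp add: E_def trace_sub r_trace) (simp add: trace_def mat_def)

lemma bochner_frame_symmetric: "kaehler_symmetric (bochner_frame K r R)"
proof -
  have K: "K p q u v = K u q p v" "K p q u v = K p v u q" for p q u v
    using K_symmetric by (auto simp: kaehler_symmetric_def)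
  show ?thesis
    unfolding kaehler_symmetric_def
  proof (intro allI conjI)
    fix p q u v
    show "bochner_frame K r R p q u v = bochner_frame K r R u q p v"
      unfolding bochner_frame_def Let_def by (subst K(1)) (simp add: algebra_simps)
    show "bochner_frame K r R p q u v = bochner_frame K r R p v u q"
      unfolding bochner_frame_def Let_def by (subst K(2)) (simp add: algebra_simps)
  qed
qed

lemma bochner_frame_traceless: "traceless4 (bochner_frame K r R)"
  unfolding traceless4_def
proof (intro allI)
  fix p q
  let ?I = "mat 1 :: complex ^ 'm ^ 'm"
  have 3: "(\<Sum>u\<in>UNIV. ?I $ u $ u) = of_nat CARD('m)" by (simp add: mat_def)
  have 4: "(\<Sum>u\<in>UNIV. r $ u $ u) = R" using r_trace by (simp add: trace_def)
  have 5: "(\<Sum>u\<in>UNIV. ?I $ u $ q * r $ p $ u) = r $ p $ q"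
    using sum_mult_mat1(1)[of "\<lambda>u. r $ p $ u" q] by (simp add: mult.commute)
  have "(\<Sum>u\<in>UNIV. bochner_frame K r R p q u u) = - (\<Sum>u\<in>UNIV. K p q u u)
     + 1 / (of_nat CARD('m) + 2) * (r $ p $ q * (\<Sum>u\<in>UNIV. ?I $ u $ u) + (\<Sum>u\<in>UNIV. r $ u $ q * ?I $ p $ u)
        + ?I $ p $ q * (\<Sum>u\<in>UNIV. r $ u $ u) + (\<Sum>u\<in>UNIV. ?I $ u $ q * r $ p $ u))
     - R / ((of_nat CARD('m) + 1) * (of_nat CARD('m) + 2)) * (?I $ p $ q * (\<Sum>u\<in>UNIV. ?I $ u $ u) + (\<Sum>u\<in>UNIV. ?I $ u $ q * ?I $ p $ u))"
    unfolding bochner_frame_def Let_def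
    by (simp only: sum.distrib sum_subtractf sum_divide_distrib[symmetric] sum_distrib_left[symmetric] sum_distrib_right[symmetric] sum_negf)
  also have "\<dots> = 0"
    unfolding K_trace 3 4 5 sum_mult_mat1 using dim_nonzero by (simp add: divide_simps) algebra
  finally show "(\<Sum>u\<in>UNIV. bochner_frame K r R p q u u) = 0" .
qed

text \<open>\<open>r\<close> and \<open>E\<close> differ by a multiple of the identity, and the
  terms containing the identity vanish because the Bochner tensor is traceless.\<close>

lemma bochner_frame_pairing:
  "sum4 (\<lambda>p q u v. bochner_frame K r R p q u v * (r $ q $ p * r $ v $ u)) =
   sum4 (\<lambda>p q u v. bochner_frame K r R p q u v * (E $ q $ p * E $ v $ u))"
proof -
  let ?B = "bochner_frame K r R"
  let ?I = "mat 1 :: complex ^ 'm ^ 'm"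
  let ?s = "R / of_nat CARD('m)"
  have t: "(\<Sum>u\<in>UNIV. ?B p q u u) = (0 :: complex^'m^'m) $ p $ q" for p q
    using bochner_frame_traceless by (simp add: traceless4_def)
  have z: "trace ((0 :: complex^'m^'m) ** Y) = 0" for Y
    by (simp add: trace_def matrix_matrix_mult_def)
  note tr = sum4_trace_symmetric[of ?B 0, OF bochner_frame_symmetric t, unfolded z]
  have r: "r $ i $ j = E $ i $ j + ?s * ?I $ i $ j" for i j
    by (simp add: E_def mat_def)
  have "sum4 (\<lambda>p q u v. ?B p q u v * (r $ q $ p * r $ v $ u)) = sum4 (\<lambda>p q u v.
      ?B p q u v * (E $ q $ p * E $ v $ u) + ?s * (?B p q u v * (E $ q $ p * ?I $ v $ u))
      + ?s * (?B p q u v * (E $ v $ u * ?I $ q $ p)) + ?s * ?s * (?B p q u v * (?I $ q $ p * ?I $ v $ u)))"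
    unfolding r by (simp add: algebra_simps)
  then show ?thesis
    unfolding sum4_add sum4_cmult tr by simp
qed

text \<open>The definition of the Bochner tensor is solved for \<open>K\<close> and paired with the
  square of \<open>r\<close>. Substituting \<open>r\<close> as \<open>E\<close> plus R/m times the
  identity makes the terms in R^3 cancel.\<close>

lemma zero_order_term:
  "trace (r ** r ** r) - sum4 (\<lambda>p q u v. K p q u v * (r $ q $ p * r $ v $ u)) =
   of_nat CARD('m) / (of_nat CARD('m) + 2) * trace (E ** E ** E) + R / (of_nat CARD('m) + 1) * trace (E ** E)
   + sum4 (\<lambda>p q u v. bochner_frame K r R p q u v * (E $ q $ p * E $ v $ u))"
proof -
  let ?I = "mat 1 :: complex ^ 'm ^ 'm"
  let ?s = "R / of_nat CARD('m)"
  let ?c = "1 / (of_nat CARD('m) + 2)" and ?d = "R / ((of_nat CARD('m) + 1) * (of_nat CARD('m) + 2))"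
  have "sum4 (\<lambda>p q u v. bochner_frame K r R p q u v * (r $ q $ p * r $ v $ u)) = sum4 (\<lambda>p q u v.
      - (K p q u v * (r $ q $ p * r $ v $ u))
      + ?c * (r $ p $ q * r $ q $ p * ?I $ u $ v * r $ v $ u)
      + ?c * (?I $ p $ v * r $ v $ u * r $ u $ q * r $ q $ p)
      + ?c * (?I $ p $ q * r $ q $ p * r $ u $ v * r $ v $ u)
      + ?c * (r $ p $ v * r $ v $ u * ?I $ u $ q * r $ q $ p)
      - ?d * (?I $ p $ q * r $ q $ p * ?I $ u $ v * r $ v $ u)
      - ?d * (?I $ p $ v * r $ v $ u * ?I $ u $ q * r $ q $ p))"
    unfolding bochner_frame_def Let_def by (simp add: algebra_simps)
  also have "\<dots> = - sum4 (\<lambda>p q u v. K p q u v * (r $ q $ p * r $ v $ u))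
      + ?c * (2 * R * trace (r ** r) + 2 * trace (r ** r ** r)) - ?d * (R * R + trace (r ** r))"
    unfolding sum4_add sum4_diff sum4_cmult sum4_uminus sum4_pair sum4_cycle_rev
    by (simp add: r_trace matrix_mul_assoc algebra_simps add_divide_distrib)
  finally have 1: "sum4 (\<lambda>p q u v. K p q u v * (r $ q $ p * r $ v $ u)) =
      ?c * (2 * R * trace (r ** r) + 2 * trace (r ** r ** r)) - ?d * (R * R + trace (r ** r))
      - sum4 (\<lambda>p q u v. bochner_frame K r R p q u v * (E $ q $ p * E $ v $ u))"
    unfolding bochner_frame_pairing by (simp add: algebra_simps)
  have "E + mat ?s = r" by (simp add: E_def)
  then have 2: "trace (r ** r) = trace (E ** E) + R * R / of_nat CARD('m)"
    and 3: "trace (r ** r ** r) = trace (E ** E ** E) + 3 * ?s * trace (E ** E) + R * R * R / (of_nat CARD('m) * of_nat CARD('m))"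
    using trace_shift[OF trace_E, of ?s] dim_nonzero by simp_all
  show ?thesis
    unfolding 1 2 3 using dim_nonzero by (simp add: divide_simps) algebra
qed

end

text \<open>\<open>C\<close> bounds the norm of \<open>bproj E\<close> by a multiple of
  \<open>fnorm2 E\<close>, and n/(n + 2) is the coefficient of tr E^3 in the zero-order term. The
  strict inequality between the two is the source of strict positivity.\<close>

lemma pinching_constant:
  fixes n :: real
  assumes "n > 0"
  defines "C \<equiv> sqrt ((2 * n\<^sup>2 + 4 * n + 3) / (2 * (n + 1) * (n + 2)))"
  shows "C > n / (n + 2)"
    and "C\<^sup>2 = (1/2 + 1 / (2 * (n + 1) * (n + 2))) + (1/2 - 1 / (n + 2))"
    and "sqrt (2 * (n + 1) * (n + 2) / (2 * n\<^sup>2 + 4 * n + 3)) = 1 / C"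
proof -
  have p: "2 * n\<^sup>2 + 4 * n + 3 > 0" using assms by (intro add_pos_pos) auto
  have "(n / (n + 2))\<^sup>2 < (2 * n\<^sup>2 + 4 * n + 3) / (2 * (n + 1) * (n + 2))"
  proof -
    have "n\<^sup>2 * (2 * (n + 1) * (n + 2)) < (2 * n\<^sup>2 + 4 * n + 3) * (n + 2)\<^sup>2"
    proof -
      \<comment> \<open>After the factor n + 2 is taken out, the cubic terms cancel and only
        positive coefficients remain.\<close>
      have "(2 * n\<^sup>2 + 4 * n + 3) * (n + 2)\<^sup>2 - n\<^sup>2 * (2 * (n + 1) * (n + 2)) = (n + 2) * (6 * n\<^sup>2 + 11 * n + 6)"
        by (simp add: power2_eq_square algebra_simps)
      also have "\<dots> > 0" using assms by (intro mult_pos_pos add_pos_pos) auto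
      finally show ?thesis by simp
    qed
    then show ?thesis using assms by (simp add: power_divide divide_less_eq less_divide_eq)
  qed
  then show "C > n / (n + 2)" unfolding C_def by (rule real_less_rsqrt)
  show "C\<^sup>2 = (1/2 + 1 / (2 * (n + 1) * (n + 2))) + (1/2 - 1 / (n + 2))"
  proof -
    have "C\<^sup>2 = (2 * n\<^sup>2 + 4 * n + 3) / (2 * (n + 1) * (n + 2))"
      unfolding C_def using assms p by (intro real_sqrt_pow2 divide_nonneg_pos) auto
    also have "\<dots> = (1/2 + 1 / (2 * (n + 1) * (n + 2))) + (1/2 - 1 / (n + 2))"
    proof -
      have "n + 1 \<noteq> 0" "n + 2 \<noteq> 0" using assms(1) by auto
      then show ?thesis by (simp add: divide_simps) (simp add: algebra_simps power2_eq_square)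
    qed
    finally show ?thesis .
  qed
  show "sqrt (2 * (n + 1) * (n + 2) / (2 * n\<^sup>2 + 4 * n + 3)) = 1 / C"
    unfolding C_def by (simp add: real_sqrt_divide)
qed

lemma norm4_bproj_le:
  fixes X :: "complex ^ 'm::finite ^ 'm"
  assumes "hadj X = X" "trace X = 0"
  defines "n \<equiv> real CARD('m)"
  shows "norm4 (bproj X) \<le> sqrt ((2 * n\<^sup>2 + 4 * n + 3) / (2 * (n + 1) * (n + 2))) * fnorm2 X"
    (is "_ \<le> ?C * _")
proof (rule power2_le_imp_le)
  have "n > 0" by (simp add: n_def)
  \<comment> \<open>The coefficient 1/2 - 1/(n + 2) is nonnegative, so
    \<open>fnorm2 (X ** X)\<close> may be replaced by its upper bound.\<close>
  have "(norm4 (bproj X))\<^sup>2 \<le> (fnorm2 X)\<^sup>2 * (1/2 + 1 / (2 * (n + 1) * (n + 2))) + (fnorm2 X)\<^sup>2 * (1/2 - 1 / (n + 2))"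
    unfolding norm4_bproj[OF assms(1,2)] n_def[symmetric]
    using fnorm2_mult_le[of X X] \<open>n > 0\<close>
    by (intro add_left_mono mult_right_mono) (auto simp: power2_eq_square field_simps)
  also have "\<dots> = (?C * fnorm2 X)\<^sup>2"
    unfolding power_mult_distrib pinching_constant(2)[OF \<open>n > 0\<close>] by (simp add: algebra_simps)
  finally show "(norm4 (bproj X))\<^sup>2 \<le> (?C * fnorm2 X)\<^sup>2" .
  show "0 \<le> ?C * fnorm2 X"
    using \<open>n > 0\<close> by (simp add: fnorm2_nonneg)
qed

lemma cmod_trace_cube_le:
  "cmod (trace (X ** X ** X)) \<le> fnorm2 X * sqrt (fnorm2 X)"
proof (rule power2_le_imp_le)
  have "(cmod (trace (X ** X ** X)))\<^sup>2 \<le> fnorm2 (X ** X) * fnorm2 X"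
    by (rule cmod_trace_mult_le)
  also have "\<dots> \<le> (fnorm2 X * fnorm2 X) * fnorm2 X"
    by (intro mult_right_mono fnorm2_mult_le fnorm2_nonneg)
  finally show "(cmod (trace (X ** X ** X)))\<^sup>2 \<le> (fnorm2 X * sqrt (fnorm2 X))\<^sup>2"
    by (simp add: power_mult_distrib fnorm2_nonneg) (simp add: power2_eq_square)
qed (simp add: fnorm2_nonneg)

text \<open>The pinching constant is the one for which the bound \<open>tr E\<^sup>4 \<le> |E|\<^sup>4\<close> suffices in the Bochner term.
  The bound \<open>|tr E\<^sup>3| \<le> |E|\<^sup>3\<close> then leaves room in the cubic term, so that positivity is strict even when
  equality holds in the pinching condition.\<close>

lemma (in curvature_frame) zero_order_term_pos:
  fixes \<rho> :: real
  defines "n \<equiv> real CARD('m)"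
  assumes r: "hadj r = r" and R: "R = of_real \<rho>" and "E \<noteq> 0"
    and pinch: "2 * sqrt (fnorm2 E) + 2 * norm4 (bochner_frame K r R)
      \<le> 2 / (n + 1) * sqrt (2 * (n + 1) * (n + 2) / (2 * n\<^sup>2 + 4 * n + 3)) * \<rho>"
  shows "Re (trace (r ** r ** r) - sum4 (\<lambda>p q u v. K p q u v * (r $ q $ p * r $ v $ u))) > 0"
proof -
  define C where "C = sqrt ((2 * n\<^sup>2 + 4 * n + 3) / (2 * (n + 1) * (n + 2)))"
  define N where "N = fnorm2 E"
  let ?B = "bochner_frame K r R"
  have n: "n > 0" by (simp add: n_def)
  note C = pinching_constant[OF n, folded C_def]
  have "C > 0" using C(1) n by (smt (verit) divide_pos_pos)
  have hE: "hadj E = E"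
  proof -
    have "hadj (mat (R / of_nat CARD('m))) = (mat (R / of_nat CARD('m)) :: complex^'m^'m)"
      by (simp add: R hadj_def mat_def vec_eq_iff)
    then show ?thesis by (simp add: E_def hadj_diff r)
  qed
  have "N > 0"
  proof -
    obtain i j where ij: "E $ i $ j \<noteq> 0" using \<open>E \<noteq> 0\<close> by (auto simp: vec_eq_iff)
    have "0 < (\<Sum>q\<in>UNIV. (cmod (E $ i $ q))\<^sup>2)" using ij by (intro sum_pos2[of _ j]) auto
    then show ?thesis unfolding N_def fnorm2_def by (rule sum_pos2[rotated 2]) (auto intro: sum_nonneg)
  qed
  have 1: "cmod (trace (E ** E ** E)) \<le> N * sqrt N"
    unfolding N_def by (rule cmod_trace_cube_le)
  have 2: "cmod (sum4 (\<lambda>p q u v. ?B p q u v * (E $ q $ p * E $ v $ u))) \<le> norm4 ?B * (C * N)"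
  proof -
    have "cmod (sum4 (\<lambda>p q u v. ?B p q u v * (E $ q $ p * E $ v $ u))) \<le> norm4 ?B * norm4 (bproj E)"
      unfolding bproj_pairing[OF bochner_frame_symmetric bochner_frame_traceless, symmetric]
      by (rule cmod_sum4_mult_le)
    also have "\<dots> \<le> norm4 ?B * (C * N)"
      using norm4_bproj_le[OF hE trace_E] unfolding C_def n_def N_def
      by (intro mult_left_mono) (auto simp: norm4_def sum4_nonneg)
    finally show ?thesis .
  qed
  have 3: "trace (E ** E) = of_real N"
    using trace_hadj_self[of E] by (simp add: hE N_def)
  have "C * (sqrt N + norm4 ?B) \<le> \<rho> / (n + 1)"
  proof -
    have "2 / (n + 1) * (1 / C) * \<rho> = 2 * (\<rho> / (n + 1) / C)" by simp
    then have "sqrt N + norm4 ?B \<le> \<rho> / (n + 1) / C"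
      using pinch unfolding C(3) N_def[symmetric] by linarith
    then show ?thesis unfolding pos_le_divide_eq[OF \<open>C > 0\<close>] by (simp only: mult.commute)
  qed
  then have 4: "C * (sqrt N + norm4 ?B) * N \<le> \<rho> / (n + 1) * N"
    using \<open>N > 0\<close> by (intro mult_right_mono) auto
  have 5: "n / (n + 2) * (N * sqrt N) < C * (N * sqrt N)"
    using C(1) \<open>N > 0\<close> by (intro mult_strict_right_mono) auto
  have co: "of_nat CARD('m) / (of_nat CARD('m) + 2) = complex_of_real (n / (n + 2))"
    "R / (of_nat CARD('m) + 1) = complex_of_real (\<rho> / (n + 1))"
    by (simp_all add: n_def R)
  have "Re (trace (r ** r ** r) - sum4 (\<lambda>p q u v. K p q u v * (r $ q $ p * r $ v $ u))) =
     n / (n + 2) * Re (trace (E ** E ** E)) + \<rho> / (n + 1) * N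
     + Re (sum4 (\<lambda>p q u v. ?B p q u v * (E $ q $ p * E $ v $ u)))"
    unfolding zero_order_term co 3 by simp
  moreover have "- (n / (n + 2) * (N * sqrt N)) \<le> n / (n + 2) * Re (trace (E ** E ** E))"
  proof -
    have "- (N * sqrt N) \<le> Re (trace (E ** E ** E))"
      using 1 abs_Re_le_cmod[of "trace (E ** E ** E)"] by linarith
    then have "n / (n + 2) * (- (N * sqrt N)) \<le> n / (n + 2) * Re (trace (E ** E ** E))"
      using n by (intro mult_left_mono) auto
    then show ?thesis by simp
  qed
  moreover have "- (norm4 ?B * (C * N)) \<le> Re (sum4 (\<lambda>p q u v. ?B p q u v * (E $ q $ p * E $ v $ u)))"
    using 2 abs_Re_le_cmod[of "sum4 (\<lambda>p q u v. ?B p q u v * (E $ q $ p * E $ v $ u))"] by linarith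
  \<comment> \<open>The cubic term is at least -n/(n + 2) N sqrt N, strictly above -C N sqrt N; the
    Bochner term is at least -C N times the norm of \<open>?B\<close>. By 4 these losses together do
    not exceed the positive term.\<close>
  ultimately show ?thesis using 4 5 by (simp add: algebra_simps)
qed

section \<open>Identification of the matrices with the coordinate curvature tensors\<close>

lemma matrix_mult_entry: "(A ** B) $ i $ j = (\<Sum>k\<in>UNIV. A $ i $ k * B $ k $ j)"
  by (simp add: matrix_matrix_mult_def)

context kaehler_domain
begin

text \<open>All products of Christoffel symbols and one of the two derivatives contain a symbol of
  mixed type and vanish; only the barred derivative of \<open>Chr\<close> is left.\<close>

lemma riemann_eq:
  assumes z: "z \<in> S"
  shows "riemann h (Inl e) (Inl c) (Inl a) (Inr b) z = (Kap a b z ** G z) $ c $ e"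
proof -
  have "pd (Inl a) (\<lambda>w. 0) z = pd (Inl a) (christoffel h (Inl e) (Inr b) (Inl c)) z"
    by (rule pd_cong_open[OF open_S z]) (auto simp: christoffel_eq)
  then have 1: "pd (Inl a) (christoffel h (Inl e) (Inr b) (Inl c)) z = 0"
    by (simp add: pd_const)
  have "pd (Inr b) (\<lambda>w. Chr a w $ c $ e) z = pd (Inr b) (christoffel h (Inl e) (Inl a) (Inl c)) z"
    using smooth_Chr[of a] z
    by (intro pd_cong_open[OF open_S z]) (auto simp: christoffel_eq smooth_mat_def intro: smooth_on_imp_differentiable)
  then have 2: "pd (Inr b) (christoffel h (Inl e) (Inl a) (Inl c)) z = - (Kap a b z ** G z) $ c $ e"
    using pdm_Chr[OF z, of b a] by (simp add: pdm_def vec_eq_iff)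
  show ?thesis
    unfolding riemann_def 1 2 sum_UNIV_Plus by (simp add: christoffel_eq z)
qed

lemma curv_eq:
  assumes z: "z \<in> S"
  shows "curv h z \<alpha> \<beta> \<gamma> \<delta> = - Kap \<alpha> \<beta> z $ \<gamma> $ \<delta>"
proof -
  have "Kap \<alpha> \<beta> z ** G z ** h z = Kap \<alpha> \<beta> z"
    by (simp add: G_h z flip: matrix_mul_assoc)
  then have "(\<Sum>e\<in>UNIV. (Kap \<alpha> \<beta> z ** G z) $ \<gamma> $ e * h z $ e $ \<delta>) = Kap \<alpha> \<beta> z $ \<gamma> $ \<delta>"
    using matrix_mult_entry[of "Kap \<alpha> \<beta> z ** G z" "h z" \<gamma> \<delta>] by simp
  then show ?thesis
    by (simp add: curv_def sum_UNIV_Plus riemann_eq z)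
qed

lemma ricci_eq: "z \<in> S \<Longrightarrow> ricci h z \<alpha> \<beta> = Ric z $ \<alpha> $ \<beta>"
  by (simp add: ricci_def curv_eq ginv_eq Ric_def trace_mult_eq sum_negf mult.commute)

lemma scalar_curv_eq: "z \<in> S \<Longrightarrow> scalar_curv h z = trace (Ric z ** G z)"
  by (simp add: scalar_curv_def ricci_eq ginv_eq trace_mult_eq mult.commute)

end

section \<open>Unitary frames\<close>

lemma orthogonal_vector_exists:
  fixes L :: "complex ^ 'm::finite ^ 'm"
  assumes "T \<noteq> UNIV"
  obtains x where "x \<noteq> 0" "\<And>p. p \<in> T \<Longrightarrow> (\<Sum>\<beta>\<in>UNIV. L $ p $ \<beta> * x $ \<beta>) = 0"
proof -
  obtain k where k: "k \<notin> T" using assms by blast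
  \<comment> \<open>the linear system, padded with zero rows to a singular square matrix\<close>
  define M where "M = (\<chi> p \<beta>. if p \<in> T then L $ p $ \<beta> else 0)"
  have "row k M = 0" using k by (simp add: M_def row_def vec_eq_iff)
  then have "det M = 0" by (rule det_zero_row)
  then have "\<not> invertible M" by (simp add: invertible_det_nz)
  then obtain x where x: "M *v x = 0" "x \<noteq> 0"
    unfolding invertible_left_inverse matrix_left_invertible_ker by blast
  show ?thesis
  proof (rule that[OF x(2)])
    fix p assume "p \<in> T"
    then show "(\<Sum>\<beta>\<in>UNIV. L $ p $ \<beta> * x $ \<beta>) = 0"
      using arg_cong[OF x(1), of "\<lambda>y. y $ p"] by (simp add: M_def matrix_vector_mult_def)
  qed
qed

text \<open>Gram-Schmidt by induction on the set of frame indices: a nonzero vector orthogonal to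
  the family found so far comes from \<open>orthogonal_vector_exists\<close> and is
  normalised.\<close>

lemma unitary_frame_exists:
  fixes H :: "complex ^ 'm::finite ^ 'm"
  assumes H: "hermitian_pos_def H"
  obtains V :: "complex ^ 'm ^ 'm" where "V ** H ** hadj V = mat 1"
proof -
  define b where "b v w = (\<Sum>\<alpha>\<in>UNIV. \<Sum>\<beta>\<in>UNIV. H $ \<alpha> $ \<beta> * v $ \<alpha> * cnj (w $ \<beta>))" for v w :: "complex ^ 'm"
  have herm: "cnj (H $ \<alpha> $ \<beta>) = H $ \<beta> $ \<alpha>" for \<alpha> \<beta>
    using H unfolding hermitian_pos_def_def by metis
  have b_cnj: "b w v = cnj (b v w)" for v w
  proof -
    have "cnj (b v w) = (\<Sum>\<alpha>\<in>UNIV. \<Sum>\<beta>\<in>UNIV. H $ \<beta> $ \<alpha> * w $ \<beta> * cnj (v $ \<alpha>))"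
      by (simp add: b_def herm mult_ac)
    also have "\<dots> = b w v" unfolding b_def by (rule sum.swap)
    finally show ?thesis by simp
  qed
  have b_pos: "b v v = of_real (Re (b v v))" "v \<noteq> 0 \<Longrightarrow> Re (b v v) > 0" for v
  proof -
    show "b v v = of_real (Re (b v v))"
      using b_cnj[of v v] by (metis Reals_cnj_iff of_real_Re)
    show "v \<noteq> 0 \<Longrightarrow> Re (b v v) > 0"
      using H unfolding hermitian_pos_def_def b_def by blast
  qed
  have "\<exists>V :: 'm \<Rightarrow> complex ^ 'm. \<forall>p\<in>T. \<forall>q\<in>T. b (V p) (V q) = (if p = q then 1 else 0)" for T :: "'m set"
    using finite[of T]
  proof (induction T rule: finite_induct)
    case (insert k T)
    then obtain V where V: "\<And>p q. p \<in> T \<Longrightarrow> q \<in> T \<Longrightarrow> b (V p) (V q) = (if p = q then 1 else 0)" by metis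
    have "T \<noteq> UNIV" using insert by auto
    then obtain x where x: "x \<noteq> 0" "\<And>p. p \<in> T \<Longrightarrow> (\<Sum>\<beta>\<in>UNIV. (\<chi> p \<beta>. \<Sum>\<alpha>\<in>UNIV. H $ \<alpha> $ \<beta> * V p $ \<alpha>) $ p $ \<beta> * x $ \<beta>) = 0"
      using orthogonal_vector_exists[OF \<open>T \<noteq> UNIV\<close>, of "\<chi> p \<beta>. \<Sum>\<alpha>\<in>UNIV. H $ \<alpha> $ \<beta> * V p $ \<alpha>"] by blast
    \<comment> \<open>The orthogonality equations are linear in the conjugate of the second argument
      of \<open>b\<close>, so their solution \<open>x\<close> is conjugated.\<close>
    define y where "y = (\<chi> i. cnj (x $ i))"
    have "y \<noteq> 0" using x(1) by (auto simp: y_def vec_eq_iff)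
    have by_orth: "b (V p) y = 0" if "p \<in> T" for p
    proof -
      have "b (V p) y = (\<Sum>\<beta>\<in>UNIV. (\<Sum>\<alpha>\<in>UNIV. H $ \<alpha> $ \<beta> * V p $ \<alpha>) * x $ \<beta>)"
        unfolding b_def by (subst sum.swap) (simp add: y_def sum_distrib_right)
      then show ?thesis using x(2)[OF that] by simp
    qed
    have by_orth': "b y (V p) = 0" if "p \<in> T" for p
      using b_cnj[where w = y and v = "V p"] by_orth[OF that] by simp
    \<comment> \<open>A real scalar, so that it leaves both arguments of the form
      unconjugated.\<close>
    define c where "c = complex_of_real (1 / sqrt (Re (b y y)))"
    have cc: "cnj c = c" by (simp add: c_def)
    have c: "b (c *s v) w = c * b v w" "b v (c *s w) = c * b v w" for v w
      by (simp_all add: b_def cc sum_distrib_left mult_ac)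
    have "c * (c * b y y) = 1"
    proof -
      have "c * (c * b y y) = of_real (1 / sqrt (Re (b y y)) * (1 / sqrt (Re (b y y)) * Re (b y y)))"
        unfolding c_def of_real_mult using b_pos(1)[of y] by simp
      also have "1 / sqrt (Re (b y y)) * (1 / sqrt (Re (b y y)) * Re (b y y)) = 1"
        using b_pos(2)[OF \<open>y \<noteq> 0\<close>] by (simp add: field_simps)
      finally show ?thesis by simp
    qed
    then have "\<forall>p\<in>insert k T. \<forall>q\<in>insert k T. b ((V(k := c *s y)) p) ((V(k := c *s y)) q) = (if p = q then 1 else 0)"
      using insert.hyps V by_orth by_orth' by (auto simp: c)
    then show ?case by blast
  qed auto
  from this[of UNIV] obtain V :: "'m \<Rightarrow> complex ^ 'm"
    where V: "\<And>p q. b (V p) (V q) = (if p = q then 1 else 0)" by auto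
  have "(\<chi> p. V p) ** H ** hadj (\<chi> p. V p) = mat 1"
  proof -
    have "((\<chi> p. V p) ** H ** hadj (\<chi> p. V p)) $ p $ q = b (V p) (V q)" for p q
      unfolding b_def
      by (subst sum.swap) (simp add: matrix_matrix_mult_def hadj_def sum_distrib_left sum_distrib_right mult_ac)
    then show ?thesis by (simp add: vec_eq_iff V mat_def)
  qed
  then show ?thesis by (rule that)
qed

text \<open>A contraction with a sum of rank-one hermitian matrices is a sum of squares. It serves
  for a single index in the gradient term and for a 4-tuple of indices in
  \<open>norm22_frame\<close>.\<close>

lemma frame_norm:
  fixes U :: "'p::finite \<Rightarrow> 'i::finite \<Rightarrow> complex"
  shows "(\<Sum>i\<in>UNIV. \<Sum>j\<in>UNIV. (\<Sum>p\<in>UNIV. U p i * cnj (U p j)) * T i * cnj (T j)) =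
    of_real (\<Sum>p\<in>UNIV. (cmod (\<Sum>i\<in>UNIV. U p i * T i))\<^sup>2)"
proof -
  have "(\<Sum>i\<in>UNIV. \<Sum>j\<in>UNIV. (\<Sum>p\<in>UNIV. U p i * cnj (U p j)) * T i * cnj (T j)) =
        (\<Sum>i\<in>UNIV. \<Sum>j\<in>UNIV. \<Sum>p\<in>UNIV. (U p i * T i) * cnj (U p j * T j))"
    by (simp add: sum_distrib_left sum_distrib_right mult_ac)
  also have "\<dots> = (\<Sum>i\<in>UNIV. \<Sum>p\<in>UNIV. \<Sum>j\<in>UNIV. (U p i * T i) * cnj (U p j * T j))"
    by (intro sum.cong refl sum.swap)
  also have "\<dots> = (\<Sum>p\<in>UNIV. \<Sum>i\<in>UNIV. \<Sum>j\<in>UNIV. (U p i * T i) * cnj (U p j * T j))"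
    by (rule sum.swap)
  also have "\<dots> = (\<Sum>p\<in>UNIV. (\<Sum>i\<in>UNIV. U p i * T i) * cnj (\<Sum>j\<in>UNIV. U p j * T j))"
    by (simp only: sum_product cnj_sum)
  also have "\<dots> = of_real (\<Sum>p\<in>UNIV. (cmod (\<Sum>i\<in>UNIV. U p i * T i))\<^sup>2)"
    by (simp only: of_real_sum complex_norm_square)
  finally show ?thesis .
qed

section \<open>Tensor components in a unitary frame\<close>

definition frame4 :: "complex ^ 'm ^ 'm \<Rightarrow> 'm::finite tensor4 \<Rightarrow> 'm tensor4" where
  "frame4 V T p q r s = sum4 (\<lambda>\<alpha> \<beta> \<gamma> \<delta>. V $ p $ \<alpha> * cnj (V $ q $ \<beta>) * V $ r $ \<gamma> * cnj (V $ s $ \<delta>) * T \<alpha> \<beta> \<gamma> \<delta>)"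

lemma frame_entry:
  "(V ** A ** hadj V) $ p $ q = (\<Sum>\<alpha>\<in>UNIV. \<Sum>\<beta>\<in>UNIV. V $ p $ \<alpha> * cnj (V $ q $ \<beta>) * A $ \<alpha> $ \<beta>)"
  by (subst sum.swap) (simp add: matrix_matrix_mult_def hadj_def sum_distrib_left sum_distrib_right mult_ac)

lemma frame4_add: "frame4 V (\<lambda>a b c d. T a b c d + T' a b c d) p q r s = frame4 V T p q r s + frame4 V T' p q r s"
  by (simp add: frame4_def distrib_left sum4_add)

lemma frame4_diff: "frame4 V (\<lambda>a b c d. T a b c d - T' a b c d) p q r s = frame4 V T p q r s - frame4 V T' p q r s"
  by (simp add: frame4_def right_diff_distrib sum4_diff)

lemma frame4_uminus: "frame4 V (\<lambda>a b c d. - T a b c d) p q r s = - frame4 V T p q r s"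
  by (simp add: frame4_def sum4_uminus)

lemma frame4_cmult: "frame4 V (\<lambda>a b c d. k * T a b c d) p q r s = k * frame4 V T p q r s"
  unfolding frame4_def sum4_cmult[symmetric] by (simp add: mult_ac)

lemma frame4_matrix:
  "frame4 V (\<lambda>a b c d. M a b $ c $ d) p q r s =
   (\<Sum>\<alpha>\<in>UNIV. \<Sum>\<beta>\<in>UNIV. V $ p $ \<alpha> * cnj (V $ q $ \<beta>) * (V ** M \<alpha> \<beta> ** hadj V) $ r $ s)"
  unfolding frame4_def sum4_def frame_entry sum_distrib_left by (simp add: mult_ac)

lemma frame4_product:
  "frame4 V (\<lambda>a b c d. A $ a $ b * B $ c $ d) p q r s = (V ** A ** hadj V) $ p $ q * (V ** B ** hadj V) $ r $ s"
  unfolding frame4_def sum4_def frame_entry sum_distrib_right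
  unfolding sum_distrib_left by (simp add: mult_ac)

lemma frame4_swap13: "frame4 V (\<lambda>a b c d. T c b a d) p q r s = frame4 V T r q p s"
  unfolding frame4_def
  by (subst sum4_swap13[symmetric]) (simp add: mult_ac)

lemma frame4_swap24: "frame4 V (\<lambda>a b c d. T a d c b) p q r s = frame4 V T p s r q"
  unfolding frame4_def
  by (subst sum4_swap24[symmetric]) (simp add: mult_ac)

lemma frame4_product_swap:
  "frame4 V (\<lambda>a b c d. A $ c $ b * B $ a $ d) p q r s = (V ** A ** hadj V) $ r $ q * (V ** B ** hadj V) $ p $ s"
  using frame4_swap13[of V "\<lambda>a b c d. A $ a $ b * B $ c $ d"] by (simp add: frame4_product)

lemma sum4_swap12: "sum4 (\<lambda>p q r s. f q p r s) = sum4 f"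
  unfolding sum4_def by (rule sum.swap)

lemma sum4_product: "sum4 (\<lambda>p q r s. a p * b q * c r * d s) =
    (\<Sum>p\<in>UNIV. a p) * (\<Sum>q\<in>UNIV. b q) * (\<Sum>r\<in>UNIV. c r) * (\<Sum>s\<in>UNIV. d s :: complex)"
  unfolding sum4_def by (simp only: sum_distrib_left[symmetric] sum_distrib_right[symmetric])

text \<open>The frame is needed only at the point \<open>z\<close>, whereas the scalar curvature is
  constant on all of \<open>S\<close> because it is differentiated.\<close>

locale kaehler_frame = kaehler_domain S h
  for S :: "(complex ^ 'm::finite) set" and h :: "'m metric_comp" +
  fixes z :: "complex ^ 'm" and V :: "complex ^ 'm ^ 'm" and R :: real
  assumes z: "z \<in> S" and frame: "V ** h z ** hadj V = mat 1"
    and const_scalar: "w \<in> S \<Longrightarrow> trace (Ric w ** G w) = of_real R"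
begin

text \<open>The rows of \<open>V\<close> are a unitary frame; \<open>rf\<close> and \<open>Kf\<close> are the Ricci and curvature tensors in this frame.\<close>

definition rf :: "complex ^ 'm ^ 'm" where
  "rf = V ** Ric z ** hadj V"

definition Kf :: "'m tensor4" where
  "Kf = frame4 V (\<lambda>a b c d. Kap a b z $ c $ d)"

lemma G_frame: "G z = hadj V ** V"
proof -
  have "(h z ** hadj V) ** V = mat 1"
    using frame iffD1[OF matrix_left_right_inverse, of V "h z ** hadj V"] by (simp add: matrix_mul_assoc)
  then have "h z ** (hadj V ** V) = mat 1" by (simp add: matrix_mul_assoc)
  then show ?thesis unfolding G_def by (rule matrix_inv_unique)
qed

lemma G_entry: "G z $ b $ a = (\<Sum>p\<in>UNIV. V $ p $ a * cnj (V $ p $ b))"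
  by (simp add: G_frame matrix_matrix_mult_def hadj_def mult.commute)

lemma trace_frame: "trace (A ** G z) = trace (V ** A ** hadj V)"
  unfolding G_frame using trace_mul_sym[of "A ** hadj V" V] by (simp add: matrix_mul_assoc)

lemma trace_frame2: "trace (A ** G z ** B ** G z) = trace ((V ** A ** hadj V) ** (V ** B ** hadj V))"
  unfolding G_frame using trace_mul_sym[of "A ** hadj V ** V ** B ** hadj V" V] by (simp add: matrix_mul_assoc)

sublocale curvature_frame Kf rf "of_real R"
proof
  have s: "(\<lambda>a b c d. Kap a b z $ c $ d) = (\<lambda>a b c d. Kap c b z $ a $ d)"
    "(\<lambda>a b c d. Kap a b z $ c $ d) = (\<lambda>a b c d. Kap a d z $ c $ b)"
    using Kap_commute[OF z] by (auto simp: fun_eq_iff)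
  show "kaehler_symmetric Kf"
    unfolding kaehler_symmetric_def
  proof (intro allI conjI)
    fix p q r s
    show "Kf p q r s = Kf r q p s"
      unfolding Kf_def by (subst s(1)) (rule frame4_swap13)
    show "Kf p q r s = Kf p s r q"
      unfolding Kf_def by (subst s(2)) (rule frame4_swap24)
  qed
  show "(\<Sum>u\<in>UNIV. Kf p q u u) = rf $ p $ q" for p q
  proof -
    have "(\<Sum>u\<in>UNIV. Kf p q u u) = (\<Sum>\<alpha>\<in>UNIV. \<Sum>u\<in>UNIV. \<Sum>\<beta>\<in>UNIV. V $ p $ \<alpha> * cnj (V $ q $ \<beta>) * (V ** Kap \<alpha> \<beta> z ** hadj V) $ u $ u)"
      unfolding Kf_def frame4_matrix by (rule sum.swap)
    also have "\<dots> = (\<Sum>\<alpha>\<in>UNIV. \<Sum>\<beta>\<in>UNIV. \<Sum>u\<in>UNIV. V $ p $ \<alpha> * cnj (V $ q $ \<beta>) * (V ** Kap \<alpha> \<beta> z ** hadj V) $ u $ u)"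
      by (intro sum.cong refl sum.swap)
    also have "\<dots> = (\<Sum>\<alpha>\<in>UNIV. \<Sum>\<beta>\<in>UNIV. V $ p $ \<alpha> * cnj (V $ q $ \<beta>) * trace (V ** Kap \<alpha> \<beta> z ** hadj V))"
      by (simp only: sum_distrib_left[symmetric] trace_def)
    also have "\<dots> = rf $ p $ q"
      by (simp add: rf_def frame_entry Ric_def trace_frame)
    finally show ?thesis .
  qed
  show "trace rf = of_real R"
    using const_scalar[OF z] by (simp add: rf_def trace_frame)
qed

lemma hadj_rf: "hadj rf = rf"
  by (simp add: rf_def hadj_mult hermitian_Ric z matrix_mul_assoc)

lemma traceless_frame: "V ** (\<chi> \<alpha> \<beta>. traceless_ricci h z \<alpha> \<beta>) ** hadj V = E"
proof -
  have t: "(\<chi> \<alpha> \<beta>. traceless_ricci h z \<alpha> \<beta>) = Ric z - mat (of_real R / of_nat CARD('m)) ** h z"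
    by (simp add: traceless_ricci_def ricci_eq scalar_curv_eq z const_scalar mat_mult vec_eq_iff)
  have "V ** (mat c ** h z) ** hadj V = mat c" for c
  proof -
    have "V ** (mat c ** h z) ** hadj V = mat c ** (V ** h z ** hadj V)"
      by (simp add: matrix_mul_assoc) (simp add: mat_mult flip: matrix_mul_assoc)
    then show ?thesis by (simp add: frame)
  qed
  then have "V ** (\<chi> \<alpha> \<beta>. traceless_ricci h z \<alpha> \<beta>) ** hadj V = rf - mat (of_real R / of_nat CARD('m))"
    unfolding t by (simp add: matrix_mult_diff_left matrix_mult_diff_right rf_def)
  then show ?thesis by (simp only: E_def)
qed

lemma norm11_frame: "norm11 h z (traceless_ricci h z) = sqrt (2 * fnorm2 E)"
proof -
  define T where "T = (\<chi> \<alpha> \<beta>. traceless_ricci h z \<alpha> \<beta>)"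
  have "(\<Sum>\<alpha>\<in>UNIV. \<Sum>\<beta>\<in>UNIV. \<Sum>\<alpha>'\<in>UNIV. \<Sum>\<beta>'\<in>UNIV.
     ginv h z \<alpha> \<alpha>' * ginv h z \<beta>' \<beta> * traceless_ricci h z \<alpha> \<beta> * cnj (traceless_ricci h z \<alpha>' \<beta>')) =
     sum4 (\<lambda>\<alpha> \<beta> \<alpha>' \<beta>'. G z $ \<alpha>' $ \<alpha> * T $ \<alpha> $ \<beta> * G z $ \<beta> $ \<beta>' * hadj T $ \<beta>' $ \<alpha>')"
    by (simp add: sum4_def ginv_eq z T_def hadj_def mult_ac)
  \<comment> \<open>Two exchanges of summation variables bring the indices into the order in which
    they form a 4-cycle.\<close>
  also have "\<dots> = sum4 (\<lambda>\<alpha> \<beta> \<alpha>' \<beta>'. G z $ \<alpha>' $ \<beta> * T $ \<beta> $ \<alpha> * G z $ \<alpha> $ \<beta>' * hadj T $ \<beta>' $ \<alpha>')"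
    by (rule sum4_swap12[symmetric])
  also have "\<dots> = sum4 (\<lambda>\<alpha>' \<alpha> \<beta> \<beta>'. G z $ \<alpha>' $ \<alpha> * T $ \<alpha> $ \<beta> * G z $ \<beta> $ \<beta>' * hadj T $ \<beta>' $ \<alpha>')"
    by (rule sum4_swap13[of "\<lambda>\<alpha>' \<alpha> \<beta> \<beta>'. G z $ \<alpha>' $ \<alpha> * T $ \<alpha> $ \<beta> * G z $ \<beta> $ \<beta>' * hadj T $ \<beta>' $ \<alpha>'"])
  also have "\<dots> = trace (G z ** T ** (G z ** hadj T))"
    by (rule sum4_cycle)
  also have "\<dots> = trace (T ** G z ** hadj T ** G z)"
    using trace_mul_sym[of "G z" "T ** G z ** hadj T"] by (simp add: matrix_mul_assoc)
  also have "\<dots> = trace (E ** hadj E)"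
    unfolding trace_frame2 traceless_frame[symmetric] T_def[symmetric]
    by (simp add: hadj_mult matrix_mul_assoc)
  finally show ?thesis
    by (simp add: norm11_def trace_hadj_self)
qed

lemma bochner_frame_eq: "frame4 V (bochner h z) = bochner_frame Kf rf (of_real R)"
proof (intro ext)
  fix p q r s
  let ?m = "of_nat CARD('m) :: complex"
  let ?h = "h z" and ?r = "Ric z"
  have e: "bochner h z = (\<lambda>a b c d. - Kap a b z $ c $ d + 1 / (?m + 2) *
        (?r $ a $ b * ?h $ c $ d + ?r $ c $ b * ?h $ a $ d + ?h $ a $ b * ?r $ c $ d + ?h $ c $ b * ?r $ a $ d)
      - of_real R / ((?m + 1) * (?m + 2)) * (?h $ a $ b * ?h $ c $ d + ?h $ c $ b * ?h $ a $ d))"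
    by (intro ext) (simp add: bochner_def Let_def curv_eq ricci_eq scalar_curv_eq z const_scalar)
  show "frame4 V (bochner h z) p q r s = bochner_frame Kf rf (of_real R) p q r s"
    unfolding e frame4_diff frame4_add frame4_uminus frame4_cmult frame4_product frame4_product_swap frame
    by (simp add: bochner_frame_def Let_def Kf_def rf_def)
qed

text \<open>Four indices are treated as one: with \<open>U\<close> the fourth tensor power of the
  frame, conjugated in the barred slots, the contraction is an instance of
  \<open>frame_norm\<close>.\<close>

lemma norm22_frame: "norm22 h z T = 2 * norm4 (frame4 V T)"
proof -
  define U where "U = (\<lambda>(p, q, r, s) (\<alpha>, \<beta>, \<gamma>, \<delta>). V $ p $ \<alpha> * cnj (V $ q $ \<beta>) * V $ r $ \<gamma> * cnj (V $ s $ \<delta>))"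
  have g: "ginv h z \<alpha> \<alpha>' * ginv h z \<beta>' \<beta> * ginv h z \<gamma> \<gamma>' * ginv h z \<delta>' \<delta> =
     (\<Sum>x\<in>UNIV. U x (\<alpha>, \<beta>, \<gamma>, \<delta>) * cnj (U x (\<alpha>', \<beta>', \<gamma>', \<delta>')))" for \<alpha> \<alpha>' \<beta> \<beta>' \<gamma> \<gamma>' \<delta> \<delta>'
  proof -
    have "ginv h z \<alpha> \<alpha>' * ginv h z \<beta>' \<beta> * ginv h z \<gamma> \<gamma>' * ginv h z \<delta>' \<delta> =
      sum4 (\<lambda>p q r s. (V $ p $ \<alpha> * cnj (V $ p $ \<alpha>')) * (V $ q $ \<beta>' * cnj (V $ q $ \<beta>)) * (V $ r $ \<gamma> * cnj (V $ r $ \<gamma>')) * (V $ s $ \<delta>' * cnj (V $ s $ \<delta>)))"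
      unfolding sum4_product ginv_eq[OF z] G_entry ..
    also have "\<dots> = (\<Sum>x\<in>UNIV. U x (\<alpha>, \<beta>, \<gamma>, \<delta>) * cnj (U x (\<alpha>', \<beta>', \<gamma>', \<delta>')))"
      unfolding sum4_tuple U_def by (simp add: case_prod_beta mult_ac)
    finally show ?thesis .
  qed
  have "(\<Sum>\<alpha>\<in>UNIV. \<Sum>\<beta>\<in>UNIV. \<Sum>\<gamma>\<in>UNIV. \<Sum>\<delta>\<in>UNIV.
     \<Sum>\<alpha>'\<in>UNIV. \<Sum>\<beta>'\<in>UNIV. \<Sum>\<gamma>'\<in>UNIV. \<Sum>\<delta>'\<in>UNIV.
     ginv h z \<alpha> \<alpha>' * ginv h z \<beta>' \<beta> * ginv h z \<gamma> \<gamma>' * ginv h z \<delta>' \<delta> *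
     T \<alpha> \<beta> \<gamma> \<delta> * cnj (T \<alpha>' \<beta>' \<gamma>' \<delta>')) =
     sum4 (\<lambda>\<alpha> \<beta> \<gamma> \<delta>. sum4 (\<lambda>\<alpha>' \<beta>' \<gamma>' \<delta>'.
       (\<Sum>x\<in>UNIV. U x (\<alpha>, \<beta>, \<gamma>, \<delta>) * cnj (U x (\<alpha>', \<beta>', \<gamma>', \<delta>'))) * T \<alpha> \<beta> \<gamma> \<delta> * cnj (T \<alpha>' \<beta>' \<gamma>' \<delta>')))"
    unfolding g sum4_def ..
  also have "\<dots> = (\<Sum>i\<in>UNIV. \<Sum>j\<in>UNIV. (\<Sum>x\<in>UNIV. U x i * cnj (U x j)) *
       (case i of (a, b, c, d) \<Rightarrow> T a b c d) * cnj (case j of (a, b, c, d) \<Rightarrow> T a b c d))"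
    unfolding sum4_tuple by (simp add: case_prod_beta)
  also have "\<dots> = of_real (\<Sum>x\<in>UNIV. (cmod (\<Sum>i\<in>UNIV. U x i * (case i of (a, b, c, d) \<Rightarrow> T a b c d)))\<^sup>2)"
    by (rule frame_norm)
  also have "(\<Sum>x\<in>UNIV. (cmod (\<Sum>i\<in>UNIV. U x i * (case i of (a, b, c, d) \<Rightarrow> T a b c d)))\<^sup>2) =
     sum4 (\<lambda>p q r s. (cmod (frame4 V T p q r s))\<^sup>2)"
    unfolding sum4_tuple frame4_def U_def by (simp add: case_prod_beta)
  finally show ?thesis
    by (simp add: norm22_def norm4_def real_sqrt_mult)
qed

text \<open>In the unitary frame this sum is the squared norm of the covariant derivative of the
  Ricci tensor.\<close>

lemma gradient_nonneg:
  "Re (\<Sum>c\<in>UNIV. \<Sum>d\<in>UNIV. G z $ d $ c * trace (Cov c z ** G z ** hadj (Cov d z) ** G z)) \<ge> 0"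
proof -
  define M where "M c = V ** Cov c z ** hadj V" for c
  have t: "trace (Cov c z ** G z ** hadj (Cov d z) ** G z) = (\<Sum>r\<in>UNIV. \<Sum>s\<in>UNIV. M c $ r $ s * cnj (M d $ r $ s))" for c d
  proof -
    have "trace (Cov c z ** G z ** hadj (Cov d z) ** G z) = trace (M c ** hadj (M d))"
      unfolding trace_frame2 M_def by (simp add: hadj_mult matrix_mul_assoc)
    then show ?thesis by (simp add: trace_mult_eq hadj_def)
  qed
  have "(\<Sum>c\<in>UNIV. \<Sum>d\<in>UNIV. G z $ d $ c * trace (Cov c z ** G z ** hadj (Cov d z) ** G z)) =
      (\<Sum>c\<in>UNIV. \<Sum>d\<in>UNIV. \<Sum>r\<in>UNIV. \<Sum>s\<in>UNIV. (\<Sum>p\<in>UNIV. V $ p $ c * cnj (V $ p $ d)) * M c $ r $ s * cnj (M d $ r $ s))"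
    unfolding t G_entry sum_distrib_left by (simp add: sum_distrib_left mult_ac)
  also have "\<dots> = (\<Sum>r\<in>UNIV. \<Sum>s\<in>UNIV. \<Sum>c\<in>UNIV. \<Sum>d\<in>UNIV. (\<Sum>p\<in>UNIV. V $ p $ c * cnj (V $ p $ d)) * M c $ r $ s * cnj (M d $ r $ s))"
    by (rule sum_swap4)
  also have "\<dots> = of_real (\<Sum>r\<in>UNIV. \<Sum>s\<in>UNIV. \<Sum>p\<in>UNIV. (cmod (\<Sum>c\<in>UNIV. V $ p $ c * M c $ r $ s))\<^sup>2)"
    by (simp only: frame_norm of_real_sum)
  finally show ?thesis by (simp add: sum_nonneg)
qed

lemma curvature_term:
  "(\<Sum>a\<in>UNIV. \<Sum>b\<in>UNIV. trace (Ric z ** G z ** Kap a b z ** G z) * (G z ** Ric z ** G z) $ b $ a) =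
   sum4 (\<lambda>p q u v. Kf p q u v * (rf $ q $ p * rf $ v $ u))"
proof -
  define t where "t a b = trace ((V ** Kap a b z ** hadj V) ** rf)" for a b
  have 1: "trace (Ric z ** G z ** Kap a b z ** G z) = t a b" for a b
    unfolding trace_frame2 rf_def[symmetric] t_def by (rule trace_mul_sym)
  have 2: "(G z ** Ric z ** G z) $ b $ a = (\<Sum>p\<in>UNIV. \<Sum>q\<in>UNIV. V $ p $ a * cnj (V $ q $ b) * rf $ q $ p)" for a b
  proof -
    have "G z ** Ric z ** G z = hadj V ** rf ** V"
      by (simp add: G_frame rf_def matrix_mul_assoc)
    then show ?thesis by (simp add: matrix_matrix_mult_def hadj_def sum_distrib_left sum_distrib_right mult_ac)
  qed
  have "sum4 (\<lambda>p q u v. Kf p q u v * (rf $ q $ p * rf $ v $ u)) =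
     (\<Sum>p\<in>UNIV. \<Sum>q\<in>UNIV. \<Sum>u\<in>UNIV. \<Sum>v\<in>UNIV. \<Sum>a\<in>UNIV. \<Sum>b\<in>UNIV.
        V $ p $ a * cnj (V $ q $ b) * rf $ q $ p * ((V ** Kap a b z ** hadj V) $ u $ v * rf $ v $ u))"
    unfolding sum4_def Kf_def frame4_matrix sum_distrib_right by (simp add: mult_ac)
  also have "\<dots> = (\<Sum>p\<in>UNIV. \<Sum>q\<in>UNIV. \<Sum>a\<in>UNIV. \<Sum>b\<in>UNIV. \<Sum>u\<in>UNIV. \<Sum>v\<in>UNIV.
        V $ p $ a * cnj (V $ q $ b) * rf $ q $ p * ((V ** Kap a b z ** hadj V) $ u $ v * rf $ v $ u))"
    by (intro sum.cong refl sum_swap4)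
  also have "\<dots> = (\<Sum>p\<in>UNIV. \<Sum>q\<in>UNIV. \<Sum>a\<in>UNIV. \<Sum>b\<in>UNIV. V $ p $ a * cnj (V $ q $ b) * rf $ q $ p * t a b)"
    unfolding t_def trace_mult_eq by (simp only: sum_distrib_left)
  also have "\<dots> = (\<Sum>a\<in>UNIV. \<Sum>b\<in>UNIV. \<Sum>p\<in>UNIV. \<Sum>q\<in>UNIV. V $ p $ a * cnj (V $ q $ b) * rf $ q $ p * t a b)"
    by (rule sum_swap4)
  also have "\<dots> = (\<Sum>a\<in>UNIV. \<Sum>b\<in>UNIV. t a b * (\<Sum>p\<in>UNIV. \<Sum>q\<in>UNIV. V $ p $ a * cnj (V $ q $ b) * rf $ q $ p))"
    by (simp add: sum_distrib_left mult_ac)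
  finally show ?thesis unfolding 1 2 by simp
qed

lemma laplacian_pos:
  assumes "E \<noteq> 0"
    and pinch: "sqrt 2 * norm11 h z (traceless_ricci h z) + norm22 h z (bochner h z)
      \<le> 2 / (real CARD('m) + 1) * sqrt (2 * (real CARD('m) + 1) * (real CARD('m) + 2) / (2 * (real CARD('m))\<^sup>2 + 4 * real CARD('m) + 3)) * R"
  shows "Re (\<Sum>c\<in>UNIV. \<Sum>d\<in>UNIV. G z $ d $ c * pd (Inl c) (pd (Inr d) (\<lambda>w. trace (Ric w ** G w ** Ric w ** G w))) z) > 0"
proof -
  \<comment> \<open>\<open>norm11\<close> has the factor sqrt 2 and \<open>norm22\<close> the factor
    2 relative to the component norms, so both terms of the pinching condition acquire the same
    factor 2.\<close>
  have "sqrt 2 * norm11 h z (traceless_ricci h z) = 2 * sqrt (fnorm2 E)"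
    by (simp add: norm11_frame real_sqrt_mult)
  then have "2 * sqrt (fnorm2 E) + 2 * norm4 (bochner_frame Kf rf (of_real R))
      \<le> 2 / (real CARD('m) + 1) * sqrt (2 * (real CARD('m) + 1) * (real CARD('m) + 2) / (2 * (real CARD('m))\<^sup>2 + 4 * real CARD('m) + 3)) * R"
    using pinch by (simp add: norm22_frame bochner_frame_eq)
  then have "Re (trace (rf ** rf ** rf) - sum4 (\<lambda>p q u v. Kf p q u v * (rf $ q $ p * rf $ v $ u))) > 0"
    by (intro zero_order_term_pos[OF hadj_rf refl \<open>E \<noteq> 0\<close>])
  moreover have "trace (Ric z ** G z ** Ric z ** G z ** Ric z ** G z) = trace (rf ** rf ** rf)"
    unfolding trace_frame[of "Ric z ** G z ** Ric z ** G z ** Ric z"]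
    unfolding G_frame rf_def by (simp add: matrix_mul_assoc)
  ultimately have "Re (trace (Ric z ** G z ** Ric z ** G z ** Ric z ** G z)
      - (\<Sum>a\<in>UNIV. \<Sum>b\<in>UNIV. trace (Ric z ** G z ** Kap a b z ** G z) * (G z ** Ric z ** G z) $ b $ a)) > 0"
    unfolding curvature_term by simp
  moreover have "Re (2 * (a - b + c)) > 0" if "Re (a - b) > 0" "Re c \<ge> 0" for a b c
    using that by simp
  ultimately show ?thesis
    by (subst bochner_formula[OF z const_scalar]) (use gradient_nonneg in blast)+
qed

end

section \<open>Second derivatives at a maximum\<close>

text \<open>With \<open>D\<close> positive, the first derivative vanishes at 0 and is positive just
  to the right of it, so the mean value theorem gives a larger value of the function there.\<close>

lemma second_derivative_nonpos_at_max:
  fixes \<phi> \<phi>' :: "real \<Rightarrow> real"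
  assumes "e > 0" and d: "\<And>t. \<bar>t\<bar> < e \<Longrightarrow> DERIV \<phi> t :> \<phi>' t" and d2: "DERIV \<phi>' 0 :> D"
    and max: "\<And>t. \<bar>t\<bar> < e \<Longrightarrow> \<phi> t \<le> \<phi> 0"
  shows "D \<le> 0"
proof (rule ccontr)
  assume "\<not> D \<le> 0"
  then obtain r where r: "r > 0" "\<And>t. 0 < t \<Longrightarrow> t < r \<Longrightarrow> \<phi>' 0 < \<phi>' t"
    using DERIV_pos_inc_right[OF d2] by auto
  have "\<phi>' 0 = 0"
    using d[of 0] max \<open>e > 0\<close> by (intro DERIV_local_max[of \<phi> "\<phi>' 0" 0 e]) auto
  define s where "s = min e r / 2"
  have s: "0 < s" "s < e" "s < r" using \<open>e > 0\<close> r(1) by (auto simp: s_def)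
  obtain t where t: "0 < t" "t < s" "\<phi> s - \<phi> 0 = (s - 0) * \<phi>' t"
    using MVT2[OF s(1), of \<phi> \<phi>'] d s by auto
  then have "\<phi> s - \<phi> 0 > 0" using r(2)[of t] s \<open>\<phi>' 0 = 0\<close> by simp
  then show False using max[of s] s by simp
qed

text \<open>A real-linear map is the sum of its complex linear and its antilinear part, whose
  coefficients are the two kinds of Wirtinger derivative. Replacing \<open>v\<close> by i
  \<open>v\<close> multiplies them by i and by -i.\<close>

lemma wirt_expand:
  fixes L :: "complex ^ 'm::finite \<Rightarrow> complex" and v :: "complex ^ 'm"
  assumes "linear L"
  shows "L v = (\<Sum>c\<in>UNIV. v $ c * wirt (Inl c) L) + (\<Sum>c\<in>UNIV. cnj (v $ c) * wirt (Inr c) L)"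
    and "L (\<i> *s v) = \<i> * (\<Sum>c\<in>UNIV. v $ c * wirt (Inl c) L) - \<i> * (\<Sum>c\<in>UNIV. cnj (v $ c) * wirt (Inr c) L)"
proof -
  have *: "L v = (\<Sum>c\<in>UNIV. v $ c * wirt (Inl c) L) + (\<Sum>c\<in>UNIV. cnj (v $ c) * wirt (Inr c) L)" for v
  proof -
    have "v = (\<Sum>c\<in>UNIV. Re (v $ c) *\<^sub>R axis c 1 + Im (v $ c) *\<^sub>R axis c \<i>)"
    proof (subst vec_eq_iff, intro allI)
      fix i
      have "(\<Sum>c\<in>UNIV. Re (v $ c) *\<^sub>R axis c 1 + Im (v $ c) *\<^sub>R axis c \<i>) $ i =
            (\<Sum>c\<in>UNIV. if c = i then v $ c else 0)"
        unfolding sum_component by (intro sum.cong refl) (auto simp: axis_def complex_eq_iff)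
      then show "v $ i = (\<Sum>c\<in>UNIV. Re (v $ c) *\<^sub>R axis c 1 + Im (v $ c) *\<^sub>R axis c \<i>) $ i" by simp
    qed
    from arg_cong[OF this, of L] have "L v = (\<Sum>c\<in>UNIV. Re (v $ c) *\<^sub>R L (axis c 1) + Im (v $ c) *\<^sub>R L (axis c \<i>))"
      by (simp only: linear_sum[OF assms] linear_add[OF assms] linear_cmul[OF assms])
    also have "\<dots> = (\<Sum>c\<in>UNIV. v $ c * wirt (Inl c) L + cnj (v $ c) * wirt (Inr c) L)"
      by (intro sum.cong refl) (simp add: wirt_def complex_eq_iff field_simps)
    finally show ?thesis by (simp add: sum.distrib)
  qed
  then show "L v = (\<Sum>c\<in>UNIV. v $ c * wirt (Inl c) L) + (\<Sum>c\<in>UNIV. cnj (v $ c) * wirt (Inr c) L)" .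
  show "L (\<i> *s v) = \<i> * (\<Sum>c\<in>UNIV. v $ c * wirt (Inl c) L) - \<i> * (\<Sum>c\<in>UNIV. cnj (v $ c) * wirt (Inr c) L)"
    by (subst *) (simp add: sum_distrib_left sum_negf mult_ac)
qed

lemma wirt_add: "wirt a (\<lambda>v. F v + H v) = wirt a F + wirt a H"
  by (cases a) (simp_all add: wirt_def field_simps)

lemma wirt_cmult: "wirt a (\<lambda>v. k * F v) = k * wirt a F"
  by (cases a) (simp_all add: wirt_def field_simps)

lemma wirt_sum: "wirt a (\<lambda>v. \<Sum>i\<in>I. F i v) = (\<Sum>i\<in>I. wirt a (F i))"
proof (induction I rule: infinite_finite_induct)
  case (insert x I)
  then show ?case by (simp add: wirt_add)
qed (auto simp: wirt_def split: sum.splits)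

text \<open>Adding the real second derivatives along \<open>v\<close> and i \<open>v\<close> cancels
  the parts of type (2,0) and (0,2), which change sign, and doubles the two equal mixed parts; hence
  the factor 4.\<close>

lemma complex_hessian:
  fixes f :: "complex ^ 'm::finite \<Rightarrow> complex" and v :: "complex ^ 'm"
  assumes "open S" "smooth_on S f" "z \<in> S"
  defines "Q \<equiv> \<lambda>u w. frechet_derivative (\<lambda>y. frechet_derivative f (at y) u) (at z) w"
  shows "4 * (\<Sum>c\<in>UNIV. \<Sum>d\<in>UNIV. v $ c * cnj (v $ d) * pd (Inl c) (pd (Inr d) f) z) = Q v v + Q (\<i> *s v) (\<i> *s v)"
proof -
  have sym: "Q u w = Q w u" for u w
    unfolding Q_def by (rule frechet_derivative_commute_complex[OF assms(1-3)])
  have lin2: "linear (\<lambda>w. Q u w)" for u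
    unfolding Q_def
    by (intro has_derivative_linear[OF smooth_on_imp_has_derivative[OF smooth_on_frechet_derivative[OF assms(2)] assms(3)]])
  have lin1: "linear (\<lambda>u. Q u w)" for w
    using lin2[of w] by (simp add: sym[of _ w])
  define P where "P L = (\<Sum>c\<in>UNIV. v $ c * wirt (Inl c) L)" for L
  define B where "B L = (\<Sum>c\<in>UNIV. cnj (v $ c) * wirt (Inr c) L)" for L
  note ex = wirt_expand[where v = v, folded P_def B_def]
  have PB_lin: "P (\<lambda>w. F w + H w) = P F + P H" "B (\<lambda>w. F w + H w) = B F + B H"
    "P (\<lambda>w. k * F w) = k * P F" "B (\<lambda>w. k * F w) = k * B F"
    "P (\<lambda>w. F w - H w) = P F - P H" "B (\<lambda>w. F w - H w) = B F - B H" for F H k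
    using wirt_add[of _ F "\<lambda>w. -1 * H w"] wirt_cmult[of _ "-1" H]
    by (simp_all add: P_def B_def wirt_add wirt_cmult distrib_left sum.distrib sum_distrib_left mult_ac right_diff_distrib sum_subtractf)
  have 1: "Q v v = P (\<lambda>w. P (\<lambda>u. Q u w)) + P (\<lambda>w. B (\<lambda>u. Q u w)) + B (\<lambda>w. P (\<lambda>u. Q u w)) + B (\<lambda>w. B (\<lambda>u. Q u w))"
  proof -
    have e: "(\<lambda>w. Q v w) = (\<lambda>w. P (\<lambda>u. Q u w) + B (\<lambda>u. Q u w))"
      by (intro ext ex(1)[OF lin1])
    have "Q v v = P (\<lambda>w. Q v w) + B (\<lambda>w. Q v w)" by (rule ex(1)[OF lin2])
    then show ?thesis by (simp only: arg_cong[OF e, of P] arg_cong[OF e, of B] PB_lin add.assoc)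
  qed
  have 2: "Q (\<i> *s v) (\<i> *s v) = - P (\<lambda>w. P (\<lambda>u. Q u w)) + P (\<lambda>w. B (\<lambda>u. Q u w)) + B (\<lambda>w. P (\<lambda>u. Q u w)) - B (\<lambda>w. B (\<lambda>u. Q u w))"
  proof -
    have e: "(\<lambda>w. Q (\<i> *s v) w) = (\<lambda>w. \<i> * P (\<lambda>u. Q u w) - \<i> * B (\<lambda>u. Q u w))"
      by (intro ext ex(2)[OF lin1])
    have "Q (\<i> *s v) (\<i> *s v) = \<i> * P (\<lambda>w. Q (\<i> *s v) w) - \<i> * B (\<lambda>w. Q (\<i> *s v) w)" by (rule ex(2)[OF lin2])
    also have "\<dots> = \<i> * (\<i> * P (\<lambda>w. P (\<lambda>u. Q u w)) - \<i> * P (\<lambda>w. B (\<lambda>u. Q u w)))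
        - \<i> * (\<i> * B (\<lambda>w. P (\<lambda>u. Q u w)) - \<i> * B (\<lambda>w. B (\<lambda>u. Q u w)))"
      by (simp only: arg_cong[OF e, of P] arg_cong[OF e, of B] PB_lin)
    finally show ?thesis by (simp add: algebra_simps)
  qed
  have 3: "P (\<lambda>w. B (\<lambda>u. Q u w)) = (\<Sum>c\<in>UNIV. \<Sum>d\<in>UNIV. v $ c * cnj (v $ d) * pd (Inl c) (pd (Inr d) f) z)"
    unfolding P_def B_def pd_pd_eq_wirt[OF assms(1-3)] Q_def wirt_sum wirt_cmult by (simp add: sum_distrib_left mult_ac)
  have "B (\<lambda>w. P (\<lambda>u. Q u w)) = (\<Sum>d\<in>UNIV. \<Sum>c\<in>UNIV. v $ c * cnj (v $ d) * pd (Inr d) (pd (Inl c) f) z)"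
    unfolding P_def B_def pd_pd_eq_wirt[OF assms(1-3)] Q_def wirt_sum wirt_cmult by (simp add: sum_distrib_left mult_ac)
  also have "\<dots> = (\<Sum>c\<in>UNIV. \<Sum>d\<in>UNIV. v $ c * cnj (v $ d) * pd (Inl c) (pd (Inr d) f) z)"
    by (subst sum.swap) (simp add: pd_commute[OF assms(1-3), of "Inl _"])
  finally show ?thesis unfolding 1 2 3 by simp
qed

text \<open>The coefficient matrix is a sum of squares over the rows of \<open>V\<close>, so the
  Laplacian is a quarter of a sum of real second derivatives along lines, and each of these is
  nonpositive at a maximum.\<close>

lemma laplacian_nonpos_at_max:
  fixes f :: "complex ^ 'm::finite \<Rightarrow> complex" and V :: "complex ^ 'm ^ 'm"
  assumes S: "open S" "smooth_on S f" "z \<in> S" and max: "\<And>w. w \<in> S \<Longrightarrow> Re (f w) \<le> Re (f z)"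
  shows "Re (\<Sum>c\<in>UNIV. \<Sum>d\<in>UNIV. (\<Sum>p\<in>UNIV. V $ p $ c * cnj (V $ p $ d)) * pd (Inl c) (pd (Inr d) f) z) \<le> 0"
proof -
  let ?Q = "\<lambda>u w. frechet_derivative (\<lambda>y. frechet_derivative f (at y) u) (at z) w"
  have Q: "Re (?Q v v) \<le> 0" for v
  proof -
    obtain r where r: "r > 0" "ball z r \<subseteq> S" using S open_contains_ball by blast
    define e where "e = r / (norm v + 1)"
    have nv: "norm v + 1 > 0" by (smt (verit) norm_ge_zero)
    have "e > 0" using r nv by (simp add: e_def)
    have in_S: "z + t *\<^sub>R v \<in> S" if "\<bar>t\<bar> < e" for t
    proof -
      have "norm (t *\<^sub>R v) \<le> \<bar>t\<bar> * (norm v + 1)" by (simp add: distrib_left)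
      also have "\<dots> < r" using that nv by (simp add: e_def pos_less_divide_eq)
      finally show ?thesis using r(2) by (auto simp: dist_norm subset_iff)
    qed
    have l: "linear (frechet_derivative g (at y))" if "smooth_on S g" "y \<in> S" for g :: "complex ^ 'm \<Rightarrow> complex" and y
      using has_derivative_linear[OF smooth_on_imp_has_derivative[OF that]] .
    have line: "DERIV (\<lambda>t. Re (g (z + t *\<^sub>R v))) t :> Re (frechet_derivative g (at (z + t *\<^sub>R v)) v)"
      if "smooth_on S g" "\<bar>t\<bar> < e" for g t
    proof -
      have "((\<lambda>t. g (z + t *\<^sub>R v)) has_derivative (\<lambda>s. frechet_derivative g (at (z + t *\<^sub>R v)) (s *\<^sub>R v))) (at t)"
        by (rule has_derivative_compose[of "\<lambda>t. z + t *\<^sub>R v" _ _ _ g, OF _ smooth_on_imp_has_derivative[OF that(1) in_S[OF that(2)]]])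
          (auto intro!: derivative_eq_intros)
      from has_derivative_Re[OF this] show ?thesis
        unfolding has_field_derivative_def
        by (simp add: linear_cmul[OF l[OF that(1) in_S[OF that(2)]]] mult_commute_abs)
    qed
    show ?thesis
    proof (rule second_derivative_nonpos_at_max[OF \<open>e > 0\<close>])
      show "DERIV (\<lambda>t. Re (f (z + t *\<^sub>R v))) t :> Re (frechet_derivative f (at (z + t *\<^sub>R v)) v)" if "\<bar>t\<bar> < e" for t
        by (rule line[OF S(2) that])
      show "DERIV (\<lambda>t. Re (frechet_derivative f (at (z + t *\<^sub>R v)) v)) 0 :> Re (?Q v v)"
        using line[OF smooth_on_frechet_derivative[OF S(2)], of 0 v] \<open>e > 0\<close> by simp
      show "Re (f (z + t *\<^sub>R v)) \<le> Re (f (z + 0 *\<^sub>R v))" if "\<bar>t\<bar> < e" for t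
        using max[OF in_S[OF that]] by simp
    qed
  qed
  have "(\<Sum>c\<in>UNIV. \<Sum>d\<in>UNIV. (\<Sum>p\<in>UNIV. V $ p $ c * cnj (V $ p $ d)) * pd (Inl c) (pd (Inr d) f) z) =
        (\<Sum>c\<in>UNIV. \<Sum>d\<in>UNIV. \<Sum>p\<in>UNIV. V $ p $ c * cnj (V $ p $ d) * pd (Inl c) (pd (Inr d) f) z)"
    by (simp add: sum_distrib_right)
  also have "\<dots> = (\<Sum>c\<in>UNIV. \<Sum>p\<in>UNIV. \<Sum>d\<in>UNIV. V $ p $ c * cnj (V $ p $ d) * pd (Inl c) (pd (Inr d) f) z)"
    by (intro sum.cong refl sum.swap)
  also have "\<dots> = (\<Sum>p\<in>UNIV. \<Sum>c\<in>UNIV. \<Sum>d\<in>UNIV. V $ p $ c * cnj (V $ p $ d) * pd (Inl c) (pd (Inr d) f) z)"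
    by (rule sum.swap)
  also have "\<dots> = (\<Sum>p\<in>UNIV. (?Q (row p V) (row p V) + ?Q (\<i> *s row p V) (\<i> *s row p V)) / 4)"
    by (intro sum.cong refl) (simp add: complex_hessian[OF S, symmetric] row_def)
  finally show ?thesis
    using Q by (simp add: sum_nonpos add_nonpos_nonpos)
qed

section \<open>Holomorphic functions of several variables\<close>

text \<open>Like \<open>holomorphic_map_on\<close>, this asks only for a complex linear derivative
  at each point, not for its continuity. Smoothness is derived below because the Jacobians of chart
  changes have to be differentiated.\<close>

definition hol_on :: "(complex ^ 'm::finite) set \<Rightarrow> (complex ^ 'm \<Rightarrow> complex) \<Rightarrow> bool" where
  "hol_on S f \<longleftrightarrow> (\<forall>z\<in>S. \<exists>f'. (f has_derivative f') (at z) \<and> (\<forall>c v. f' (c *s v) = c * f' v))"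

lemma hol_on_derivative:
  assumes "hol_on S f" "z \<in> S"
  shows "(f has_derivative frechet_derivative f (at z)) (at z)"
    "frechet_derivative f (at z) (c *s v) = c * frechet_derivative f (at z) v"
proof -
  obtain f' where f': "(f has_derivative f') (at z)" "\<And>c v. f' (c *s v) = c * f' v"
    using assms unfolding hol_on_def by blast
  moreover have "f' = frechet_derivative f (at z)" using frechet_derivative_at[OF f'(1)] .
  ultimately show "(f has_derivative frechet_derivative f (at z)) (at z)"
    "frechet_derivative f (at z) (c *s v) = c * frechet_derivative f (at z) v" by auto
qed

lemma norm_smult: "norm (c *s x) = cmod c * norm x" for x :: "complex ^ 'm::finite"
  by (simp add: norm_vec_def L2_set_def norm_mult power_mult_distrib sum_distrib_left[symmetric] real_sqrt_mult)

lemma has_derivative_smult: "((\<lambda>t. x + t *s w) has_derivative (\<lambda>t. t *s w)) (at t)" for w :: "complex ^ 'm::finite"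
proof -
  have "linear (\<lambda>t. t *s w)" by (auto intro!: linearI simp: vec_eq_iff algebra_simps)
  then have "bounded_linear (\<lambda>t. t *s w)" by (simp add: linear_conv_bounded_linear)
  then show ?thesis by (auto intro!: derivative_eq_intros bounded_linear_imp_has_derivative)
qed

lemma hol_on_line:
  assumes "hol_on S f" "x + t *s w \<in> S"
  shows "((\<lambda>t. f (x + t *s w)) has_field_derivative frechet_derivative f (at (x + t *s w)) w) (at t)"
proof -
  have "((\<lambda>t. f (x + t *s w)) has_derivative (\<lambda>s. frechet_derivative f (at (x + t *s w)) (s *s w))) (at t)"
    by (rule has_derivative_compose[of "\<lambda>t. x + t *s w" _ _ _ f, OF has_derivative_smult hol_on_derivative(1)[OF assms]])
  then show ?thesis
    by (simp add: has_field_derivative_def hol_on_derivative(2)[OF assms] mult_commute_abs)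
qed

text \<open>The one-variable Cauchy inequality on the complex line through \<open>x\<close> in
  direction \<open>w\<close>, on the disc of radius \<open>r / norm w\<close>, which the line maps
  into the ball.\<close>

lemma hol_on_cauchy_estimate:
  assumes f: "hol_on S f" and S: "cball x r \<subseteq> S" and "r > 0" and M: "\<And>y. y \<in> cball x r \<Longrightarrow> cmod (f y) \<le> M"
  shows "cmod (frechet_derivative f (at x) w) \<le> M / r * norm w"
proof (cases "w = 0")
  case True
  then show ?thesis
    using hol_on_derivative(2)[OF f, of x 0 0] S \<open>r > 0\<close> by (auto simp: subset_iff)
next
  case False
  define F where "F t = f (x + t *s w)" for t
  define \<rho> where "\<rho> = r / norm w"
  have "\<rho> > 0" using False \<open>r > 0\<close> by (simp add: \<rho>_def)
  have in_cball: "x + t *s w \<in> cball x r" if "cmod t \<le> \<rho>" for t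
    using that False by (simp add: dist_norm norm_smult \<rho>_def pos_le_divide_eq)
  have der: "(F has_field_derivative frechet_derivative f (at (x + t *s w)) w) (at t)" if "cmod t \<le> \<rho>" for t
    unfolding F_def using in_cball[OF that] S by (intro hol_on_line[OF f]) auto
  have "cmod ((deriv ^^ 1) F 0) \<le> fact 1 * M / \<rho> ^ 1"
  proof (rule Cauchy_inequality)
    show "F holomorphic_on ball 0 \<rho>"
      unfolding holomorphic_on_def field_differentiable_def
    proof (intro ballI exI)
      fix t :: complex assume "t \<in> ball 0 \<rho>"
      then show "(F has_field_derivative frechet_derivative f (at (x + t *s w)) w) (at t within ball 0 \<rho>)"
        by (intro has_field_derivative_at_within[OF der]) simp
    qed
    show "continuous_on (cball 0 \<rho>) F"
      by (rule continuous_at_imp_continuous_on) (auto intro: DERIV_isCont[OF der])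
    show "cmod (F t) \<le> M" if "cmod (0 - t) = \<rho>" for t
      unfolding F_def using that by (intro M in_cball) simp
  qed (use \<open>\<rho> > 0\<close> in auto)
  moreover have "deriv F 0 = frechet_derivative f (at x) w"
    using der[of 0] \<open>\<rho> > 0\<close> by (simp add: DERIV_imp_deriv)
  ultimately show ?thesis by (simp add: \<rho>_def)
qed

text \<open>On the half-radius disc the second derivative is at most 2 M / \<rho>^2 by the Cauchy
  inequality, and Taylor's formula does the rest. The bound depends on \<open>F\<close> only through
  \<open>M\<close>, which makes it uniform in the base point.\<close>

lemma quotient_error:
  assumes F: "F holomorphic_on ball 0 (2 * \<rho>)" and M: "\<And>t. t \<in> ball 0 (2 * \<rho>) \<Longrightarrow> cmod (F t) \<le> M"
    and s: "cmod s < \<rho>"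
  shows "cmod (F s - F 0 - deriv F 0 * s) \<le> 2 * M / \<rho>\<^sup>2 * (cmod s)\<^sup>2"
proof -
  have "\<rho> > 0" using s by (smt (verit) norm_ge_zero)
  have "cmod ((deriv ^^ 2) F t) \<le> 2 * M / \<rho>\<^sup>2" if t: "t \<in> ball 0 \<rho>" for t
  proof -
    have sub: "cball t \<rho> \<subseteq> ball 0 (2 * \<rho>)"
    proof
      fix x assume "x \<in> cball t \<rho>"
      then show "x \<in> ball 0 (2 * \<rho>)"
        using t norm_triangle_ineq2[of x t] by (simp add: dist_norm norm_minus_commute)
    qed
    have "cmod ((deriv ^^ 2) F t) \<le> fact 2 * M / \<rho> ^ 2"
    proof (rule Cauchy_inequality)
      show "F holomorphic_on ball t \<rho>"
        using sub ball_subset_cball by (intro holomorphic_on_subset[OF F]) blast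
      show "continuous_on (cball t \<rho>) F"
        using sub by (intro holomorphic_on_imp_continuous_on holomorphic_on_subset[OF F])
      show "cmod (F x) \<le> M" if "cmod (t - x) = \<rho>" for x
        using sub that by (intro M) (auto simp: subset_iff dist_norm)
    qed (use \<open>\<rho> > 0\<close> in auto)
    then show ?thesis by simp
  qed
  then have B: "cmod ((deriv ^^ Suc 1) F t) \<le> 2 * M / \<rho>\<^sup>2" if "t \<in> ball 0 \<rho>" for t
    using that by (simp add: numeral_2_eq_2)
  have "cmod ((deriv ^^ 0) F s - (\<Sum>i\<le>1. (deriv ^^ i) F 0 * (s - 0) ^ i / fact i)) \<le> 2 * M / \<rho>\<^sup>2 * cmod (s - 0) ^ Suc 1 / fact 1"
  proof (rule complex_Taylor[of "ball 0 \<rho>" 1 "\<lambda>i. (deriv ^^ i) F"])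
    show "((deriv ^^ i) F has_field_derivative (deriv ^^ Suc i) F x) (at x within ball 0 \<rho>)"
      if "x \<in> ball 0 \<rho>" for i x
    proof -
      have "(deriv ^^ i) F holomorphic_on ball 0 (2 * \<rho>)"
        by (rule holomorphic_higher_deriv[OF F open_ball])
      then have "((deriv ^^ i) F has_field_derivative deriv ((deriv ^^ i) F) x) (at x)"
        using that \<open>\<rho> > 0\<close> by (intro holomorphic_derivI[OF _ open_ball]) auto
      then show ?thesis by (simp add: has_field_derivative_at_within)
    qed
  qed (use B s \<open>\<rho> > 0\<close> in auto)
  then show ?thesis by (simp add: power2_eq_square algebra_simps)
qed

text \<open>The difference quotients in direction \<open>v\<close> converge locally uniformly, hence so do their derivatives, by
  the Cauchy estimate.\<close>

lemma hol_on_frechet_derivative: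
  fixes f :: "complex ^ 'm::finite \<Rightarrow> complex"
  assumes "open S" and f: "hol_on S f"
  shows "hol_on S (\<lambda>z. frechet_derivative f (at z) v)"
  unfolding hol_on_def
proof
  fix z0 assume "z0 \<in> S"
  define D where "D x = frechet_derivative f (at x)" for x
  obtain r' where r': "r' > 0" "cball z0 r' \<subseteq> S" using \<open>open S\<close> \<open>z0 \<in> S\<close> open_contains_cball by blast
  \<comment> \<open>Three nested balls: derivatives converge on radius \<open>r\<close>, Cauchy
    estimates use radius \<open>2 * r\<close>, and the shifted arguments of \<open>f\<close> stay
    within \<open>3 * r\<close>.\<close>
  define r where "r = r' / 3"
  have r: "r > 0" "cball z0 (3 * r) \<subseteq> S" using r' by (auto simp: r_def)
  have contf: "continuous_on S f"
    by (rule continuous_at_imp_continuous_on) (use hol_on_derivative(1)[OF f] has_derivative_continuous in blast)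
  have "compact (f ` cball z0 (3 * r))"
    using r(2) by (intro compact_continuous_image continuous_on_subset[OF contf]) auto
  then obtain M where M: "\<And>y. y \<in> cball z0 (3 * r) \<Longrightarrow> cmod (f y) \<le> M"
    using compact_imp_bounded bounded_iff by (metis (no_types, lifting) imageI)
  define \<rho> where "\<rho> = r / (2 * (norm v + 1))"
  have nv: "norm v + 1 > 0" by (smt (verit) norm_ge_zero)
  have "\<rho> > 0" using r nv by (simp add: \<rho>_def)
  have near: "x + t *s v \<in> cball z0 (3 * r)" if x: "x \<in> cball z0 (2 * r)" and t: "cmod t \<le> 2 * \<rho>" for x t
  proof -
    have "norm (t *s v) \<le> 2 * \<rho> * (norm v + 1)"
      unfolding norm_smult using t \<open>\<rho> > 0\<close> by (intro mult_mono) auto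
    also have "\<dots> = r"
    proof -
      have "2 * (r / (2 * q)) * q = r" if "q > 0" for q using that by simp
      then show ?thesis using nv unfolding \<rho>_def by blast
    qed
    finally have "dist (x + t *s v) x \<le> r" by (simp add: dist_norm)
    then show ?thesis using x dist_triangle[of z0 "x + t *s v" x] by (simp add: dist_commute)
  qed
  \<comment> \<open>The summand 2 keeps every step strictly below \<rho>, including
    \<open>s 0\<close>.\<close>
  define s where "s n = \<rho> / (real n + 2)" for n
  have s: "s n > 0" "s n < \<rho>" for n
    using \<open>\<rho> > 0\<close> by (simp_all add: s_def pos_divide_less_eq)
  have s0: "s \<longlonglongrightarrow> 0"
  proof -
    have "(\<lambda>n. \<rho> * inverse (real (n + 2))) \<longlonglongrightarrow> \<rho> * 0"
      by (intro tendsto_mult tendsto_const LIMSEQ_ignore_initial_segment[OF lim_inverse_n])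
    then show ?thesis unfolding s_def[abs_def] by (simp add: divide_inverse add.commute)
  qed
  define g where "g n x = (f (x + of_real (s n) *s v) - f x) / of_real (s n)" for n x
  define K where "K = 2 * M / \<rho>\<^sup>2"
  have err: "cmod (g n x - D x v) \<le> K * s n" if x: "x \<in> cball z0 (2 * r)" for n x
  proof -
    define F where "F t = f (x + t *s v)" for t
    have der: "(F has_field_derivative D (x + t *s v) v) (at t)" if "cmod t \<le> 2 * \<rho>" for t
      unfolding F_def D_def using near[OF x that] r(2) by (intro hol_on_line[OF f]) auto
    have "cmod (F (of_real (s n)) - F 0 - deriv F 0 * of_real (s n)) \<le> 2 * M / \<rho>\<^sup>2 * (cmod (of_real (s n)))\<^sup>2"
    proof (rule quotient_error)
      show "F holomorphic_on ball 0 (2 * \<rho>)"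
        unfolding holomorphic_on_def field_differentiable_def
      proof (intro ballI exI)
        fix t :: complex assume "t \<in> ball 0 (2 * \<rho>)"
        then show "(F has_field_derivative D (x + t *s v) v) (at t within ball 0 (2 * \<rho>))"
          by (intro has_field_derivative_at_within[OF der]) simp
      qed
      show "cmod (F t) \<le> M" if "t \<in> ball 0 (2 * \<rho>)" for t
        unfolding F_def using that by (intro M near[OF x]) simp
    qed (use s[of n] in simp)
    moreover have "deriv F 0 = D x v"
      using der[of 0] \<open>\<rho> > 0\<close> by (simp add: DERIV_imp_deriv)
    ultimately have *: "cmod (f (x + of_real (s n) *s v) - f x - D x v * of_real (s n)) \<le> K * (s n)\<^sup>2"
      using s[of n] by (simp add: F_def K_def)
    have "g n x - D x v = (f (x + of_real (s n) *s v) - f x - D x v * of_real (s n)) / of_real (s n)"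
      using s(1)[of n] by (simp add: g_def diff_divide_distrib)
    then have "cmod (g n x - D x v) = cmod (f (x + of_real (s n) *s v) - f x - D x v * of_real (s n)) / s n"
      using s(1)[of n] by (simp add: norm_divide)
    also have "\<dots> \<le> K * (s n)\<^sup>2 / s n" using * s(1)[of n] by (intro divide_right_mono) auto
    finally show ?thesis using s(1)[of n] by (simp add: power2_eq_square)
  qed
  define g' where "g' n x w = (D (x + of_real (s n) *s v) w - D x w) / of_real (s n)" for n x w
  have in_S: "x \<in> S" "x + of_real (s n) *s v \<in> S" if "x \<in> cball z0 (2 * r)" for x n
    using near[OF that, of 0] near[OF that, of "of_real (s n)"] s[of n] r(2) \<open>\<rho> > 0\<close> by auto
  have dg: "(g n has_derivative g' n x) (at x)" if x: "x \<in> cball z0 (2 * r)" for n x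
  proof -
    have "((\<lambda>x. f (x + of_real (s n) *s v)) has_derivative D (x + of_real (s n) *s v)) (at x)"
      unfolding D_def
      by (rule has_derivative_compose[of "\<lambda>x. x + of_real (s n) *s v" "\<lambda>w. w" _ _ f, OF _ hol_on_derivative(1)[OF f in_S(2)[OF x]]])
        (auto intro!: derivative_eq_intros)
    then show ?thesis
      unfolding g_def[abs_def] g'_def[abs_def] divide_inverse D_def
      by (intro has_derivative_mult_left has_derivative_diff hol_on_derivative(1)[OF f in_S(1)[OF x]])
  qed
  have g'_smult: "g' n x (c *s w) = c * g' n x w" if x: "x \<in> cball z0 (2 * r)" for n x c w
    using hol_on_derivative(2)[OF f in_S(1)[OF x]] hol_on_derivative(2)[OF f in_S(2)[OF x]]
    by (simp add: g'_def D_def right_diff_distrib)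
  \<comment> \<open>Both quotients are close to \<open>D y v\<close> by \<open>err\<close>, so their
    difference is small on a ball of radius \<open>r\<close>; the Cauchy estimate passes this to the
    derivatives.\<close>
  have cau: "cmod (g' n x w - g' k x w) \<le> K * (s n + s k) / r * norm w" if x: "x \<in> ball z0 r" for n k x w
  proof -
    have sub: "cball x r \<subseteq> cball z0 (2 * r)"
    proof
      fix y assume "y \<in> cball x r"
      then show "y \<in> cball z0 (2 * r)" using x dist_triangle[of z0 y x] by simp
    qed
    have d: "((\<lambda>x. g n x - g k x) has_derivative (\<lambda>w. g' n y w - g' k y w)) (at y)" if "y \<in> cball z0 (2 * r)" for y
      by (intro has_derivative_diff dg that)
    then have h: "hol_on (cball z0 (2 * r)) (\<lambda>x. g n x - g k x)"
      unfolding hol_on_def using g'_smult by (fastforce simp: right_diff_distrib)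
    have "cmod (frechet_derivative (\<lambda>x. g n x - g k x) (at x) w) \<le> K * (s n + s k) / r * norm w"
    proof (rule hol_on_cauchy_estimate[OF h sub r(1)])
      fix y assume "y \<in> cball x r"
      then have "y \<in> cball z0 (2 * r)" using sub by blast
      from err[OF this, of n] err[OF this, of k] show "cmod (g n y - g k y) \<le> K * (s n + s k)"
        using norm_triangle_ineq4[of "g n y - D y v" "g k y - D y v"] by (simp add: distrib_left)
    qed
    moreover have "x \<in> cball z0 (2 * r)" using x r(1) by simp
    ultimately show ?thesis using frechet_derivative_at[OF d] by metis
  qed
  have "K \<ge> 0"
    using order_trans[OF norm_ge_zero err[of z0 0]] r(1) s(1)[of 0] by (simp add: zero_le_mult_iff)
  have conv: "convergent (\<lambda>n. g' n x w)" if x: "x \<in> ball z0 r" for x w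
  proof -
    have "Cauchy (\<lambda>n. g' n x w)"
    proof (rule metric_CauchyI)
      fix e :: real assume "e > 0"
      have "(\<lambda>n. K * (s n + s n) / r * norm w) \<longlonglongrightarrow> K * (0 + 0) / r * norm w"
        using r(1) by (intro tendsto_intros s0) auto
      then have "\<forall>\<^sub>F n in sequentially. K * (s n + s n) / r * norm w < e"
        using \<open>e > 0\<close> by (intro order_tendstoD(2)) simp_all
      then obtain N where N: "K * (s N + s N) / r * norm w < e"
        using eventually_happens' sequentially_bot by blast
      have mono: "s n \<le> s N" if "n \<ge> N" for n
        using that \<open>\<rho> > 0\<close> by (simp add: s_def frac_le)
      show "\<exists>N. \<forall>m\<ge>N. \<forall>n\<ge>N. dist (g' m x w) (g' n x w) < e"
      proof (intro exI[of _ N] allI impI)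
        fix m n assume "m \<ge> N" "n \<ge> N"
        then have "K * (s m + s n) / r * norm w \<le> K * (s N + s N) / r * norm w"
          using mono \<open>K \<ge> 0\<close> r(1) by (intro mult_right_mono divide_right_mono mult_left_mono add_mono) auto
        then show "dist (g' m x w) (g' n x w) < e"
          using cau[OF x, of m w n] N by (simp add: dist_norm)
      qed
    qed
    then show ?thesis by (rule Cauchy_convergent)
  qed
  define L where "L x w = lim (\<lambda>n. g' n x w)" for x w
  have L: "(\<lambda>n. g' n x w) \<longlonglongrightarrow> L x w" if "x \<in> ball z0 r" for x w
    unfolding L_def using conv[OF that] by (simp add: convergent_LIMSEQ_iff)
  have le: "cmod (g' n x w - L x w) \<le> K * s n / r * norm w" if x: "x \<in> ball z0 r" for n x w
  proof (rule LIMSEQ_le)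
    show "(\<lambda>k. cmod (g' n x w - g' k x w)) \<longlonglongrightarrow> cmod (g' n x w - L x w)"
      by (intro tendsto_intros L x)
    show "(\<lambda>k. K * (s n + s k) / r * norm w) \<longlonglongrightarrow> K * s n / r * norm w"
      using tendsto_intros(1) r(1) by (auto intro!: tendsto_eq_intros s0)
    show "\<exists>N. \<forall>k\<ge>N. cmod (g' n x w - g' k x w) \<le> K * (s n + s k) / r * norm w"
      using cau[OF x] by blast
  qed
  have sub: "x \<in> cball z0 (2 * r)" if "x \<in> ball z0 r" for x using that r(1) by auto
  \<comment> \<open>Termwise differentiation of a sequence with uniformly converging derivatives.
    The limit \<open>G\<close> is identified with the directional derivative afterwards.\<close>
  have "\<exists>G. \<forall>x\<in>ball z0 r. (\<lambda>n. g n x) \<longlonglongrightarrow> G x \<and> (G has_derivative L x) (at x within ball z0 r)"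
  proof (rule has_derivative_sequence[where f = g and f' = g'])
    show "(g n has_derivative g' n x) (at x within ball z0 r)" if "x \<in> ball z0 r" for n x
      using dg[OF sub[OF that]] by (rule has_derivative_at_withinI)
    show "\<forall>\<^sub>F n in sequentially. \<forall>x\<in>ball z0 r. \<forall>h. cmod (g' n x h - L x h) \<le> e * norm h" if "e > 0" for e
    proof -
      have "(\<lambda>n. K * s n / r) \<longlonglongrightarrow> 0" using r(1) by (auto intro!: tendsto_eq_intros s0)
      then have "\<forall>\<^sub>F n in sequentially. K * s n / r < e" using that by (rule order_tendstoD(2))
      then show ?thesis
      proof eventually_elim
        case (elim n)
        show ?case
        proof (intro ballI allI)
          fix x h assume "x \<in> ball z0 r"
          from le[OF this, of n h] show "cmod (g' n x h - L x h) \<le> e * norm h"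
            using elim by (smt (verit) mult_right_mono norm_ge_zero)
        qed
      qed
    qed
    show "z0 \<in> ball z0 r" using r(1) by simp
  next
    have "(\<lambda>n. g n z0 - D z0 v) \<longlonglongrightarrow> 0"
    proof (rule Lim_null_comparison)
      show "\<forall>\<^sub>F n in sequentially. cmod (g n z0 - D z0 v) \<le> K * s n"
        using err[of z0] r(1) by simp
      show "(\<lambda>n. K * s n) \<longlonglongrightarrow> 0" by (auto intro!: tendsto_eq_intros s0)
    qed
    then show "(\<lambda>n. g n z0) \<longlonglongrightarrow> D z0 v" by (simp add: LIM_zero_iff)
  qed auto
  then obtain G where G: "\<And>x. x \<in> ball z0 r \<Longrightarrow> (\<lambda>n. g n x) \<longlonglongrightarrow> G x"
    "\<And>x. x \<in> ball z0 r \<Longrightarrow> (G has_derivative L x) (at x within ball z0 r)" by blast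
  have GD: "G x = D x v" if x: "x \<in> ball z0 r" for x
  proof -
    have "(\<lambda>n. g n x - D x v) \<longlonglongrightarrow> 0"
    proof (rule Lim_null_comparison)
      show "\<forall>\<^sub>F n in sequentially. cmod (g n x - D x v) \<le> K * s n"
        using err[OF sub[OF x]] by simp
      show "(\<lambda>n. K * s n) \<longlonglongrightarrow> 0" by (auto intro!: tendsto_eq_intros s0)
    qed
    then have "(\<lambda>n. g n x) \<longlonglongrightarrow> D x v" by (simp add: LIM_zero_iff)
    then show ?thesis using G(1)[OF x] LIMSEQ_unique by blast
  qed
  have z0: "z0 \<in> ball z0 r" using r(1) by simp
  have "(G has_derivative L z0) (at z0)"
    using G(2)[OF z0] at_within_open[OF z0 open_ball] by simp
  then have "((\<lambda>x. D x v) has_derivative L z0) (at z0)"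
    by (rule has_derivative_transform_within_open[OF _ open_ball z0]) (simp add: GD)
  moreover have "L z0 (c *s w) = c * L z0 w" for c w
  proof -
    have "(\<lambda>n. c * g' n z0 w) \<longlonglongrightarrow> c * L z0 w" by (intro tendsto_intros L z0)
    then have "(\<lambda>n. g' n z0 (c *s w)) \<longlonglongrightarrow> c * L z0 w" by (simp add: g'_smult[OF sub[OF z0]])
    then show ?thesis using L[OF z0, of "c *s w"] LIMSEQ_unique by blast
  qed
  ultimately show "\<exists>f'. ((\<lambda>z. frechet_derivative f (at z) v) has_derivative f') (at z0) \<and> (\<forall>c v. f' (c *s v) = c * f' v)"
    unfolding D_def by blast
qed

lemma hol_on_imp_smooth_on:
  assumes "open S" "hol_on S f"
  shows "smooth_on S f"
proof -
  have "Ck_on k S f" if "hol_on S f" for k f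
    using that
  proof (induction k arbitrary: f)
    case 0
    have "continuous (at x) f" if "x \<in> S" for x
      using hol_on_derivative(1)[OF 0 that] has_derivative_continuous by blast
    then show ?case by (simp add: continuous_at_imp_continuous_on)
  next
    case (Suc k)
    show ?case
      by (rule Ck_on_SucI[OF \<open>open S\<close> hol_on_derivative(1)[OF Suc.prems]])
        (auto intro!: Suc.IH hol_on_frechet_derivative[OF \<open>open S\<close> Suc.prems])
  qed
  then show ?thesis using assms(2) by (simp add: smooth_on_def)
qed

lemma axis_smult: "c *s axis a 1 = (axis a c :: complex ^ 'm::finite)"
  by (simp add: vec_eq_iff axis_def)

lemma hol_on_pd:
  assumes "hol_on S f" "z \<in> S"
  shows "pd (Inr b) f z = 0" "pd (Inl a) f z = frechet_derivative f (at z) (axis a 1)"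
proof -
  have "frechet_derivative f (at z) (axis c \<i>) = \<i> * frechet_derivative f (at z) (axis c 1)" for c
    using hol_on_derivative(2)[OF assms, of \<i> "axis c 1"] by (simp add: axis_smult)
  then show "pd (Inr b) f z = 0" "pd (Inl a) f z = frechet_derivative f (at z) (axis a 1)"
    by (simp_all add: pd.simps flip: mult.assoc)
qed

lemma hol_on_cong:
  assumes "open S" "\<And>z. z \<in> S \<Longrightarrow> f z = g z" "hol_on S f"
  shows "hol_on S g"
  unfolding hol_on_def
proof
  fix z assume z: "z \<in> S"
  show "\<exists>f'. (g has_derivative f') (at z) \<and> (\<forall>c v. f' (c *s v) = c * f' v)"
    using has_derivative_transform_within_open[OF hol_on_derivative(1)[OF assms(3) z] assms(1) z assms(2)]
      hol_on_derivative(2)[OF assms(3) z] by blast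
qed

lemma hol_on_pd_Inl: "open S \<Longrightarrow> hol_on S f \<Longrightarrow> hol_on S (pd (Inl a) f)"
  by (rule hol_on_cong[OF _ _ hol_on_frechet_derivative]) (auto simp: hol_on_pd)

lemma holomorphic_map_on_component:
  assumes "holomorphic_map_on S F"
  shows "hol_on S (\<lambda>w. F w $ i)"
  unfolding hol_on_def
proof
  fix z assume "z \<in> S"
  then obtain f' where f': "(F has_derivative f') (at z)" "\<And>c v. f' (c *s v) = c *s f' v"
    using assms unfolding holomorphic_map_on_def by blast
  have "((\<lambda>w. F w $ i) has_derivative (\<lambda>v. f' v $ i)) (at z)"
    by (rule bounded_linear.has_derivative[OF bounded_linear_vec_nth f'(1)])
  then show "\<exists>f'. ((\<lambda>w. F w $ i) has_derivative f') (at z) \<and> (\<forall>c v. f' (c *s v) = c * f' v)"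
    using f'(2) by (intro exI[of _ "\<lambda>v. f' v $ i"]) simp
qed

text \<open>The derivative of \<phi> is complex linear, so composing with it preserves the complex
  linear and the antilinear part of \<open>u'\<close> and the chain rule has no mixed terms.\<close>

lemma pd_compose_holomorphic:
  fixes \<phi> :: "complex ^ 'm::finite \<Rightarrow> complex ^ 'n::finite"
  assumes \<phi>: "holomorphic_map_on S \<phi>" and z: "z \<in> S" and u: "u differentiable (at (\<phi> z))"
  shows "(\<lambda>w. u (\<phi> w)) differentiable (at z)"
    and "pd (Inl a) (\<lambda>w. u (\<phi> w)) z = (\<Sum>c\<in>UNIV. pd (Inl a) (\<lambda>w. \<phi> w $ c) z * pd (Inl c) u (\<phi> z))"
    and "pd (Inr a) (\<lambda>w. u (\<phi> w)) z = (\<Sum>c\<in>UNIV. cnj (pd (Inl a) (\<lambda>w. \<phi> w $ c) z) * pd (Inr c) u (\<phi> z))"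
proof -
  obtain f' where f': "(\<phi> has_derivative f') (at z)" "\<And>c v. f' (c *s v) = c *s f' v"
    using \<phi> z unfolding holomorphic_map_on_def by blast
  obtain u' where u': "(u has_derivative u') (at (\<phi> z))" using u by (auto simp: differentiable_def)
  have d: "((\<lambda>w. u (\<phi> w)) has_derivative (\<lambda>v. u' (f' v))) (at z)"
    by (rule has_derivative_compose[OF f'(1) u'])
  then show "(\<lambda>w. u (\<phi> w)) differentiable (at z)" by (auto simp: differentiable_def)
  have comp: "f' (axis a 1) $ c = pd (Inl a) (\<lambda>w. \<phi> w $ c) z" for c
    using frechet_derivative_at[OF bounded_linear.has_derivative[OF bounded_linear_vec_nth f'(1), of c]]
      hol_on_pd(2)[OF holomorphic_map_on_component[OF \<phi>] z, of a c] by metis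
  have ax: "f' (axis a \<i>) = \<i> *s f' (axis a 1)" using f'(2)[of \<i> "axis a 1"] by (simp add: axis_smult)
  note ex = wirt_expand[OF has_derivative_linear[OF u'], of "f' (axis a 1)"]
  have "pd (Inl a) (\<lambda>w. u (\<phi> w)) z = (\<Sum>c\<in>UNIV. f' (axis a 1) $ c * wirt (Inl c) u')"
    unfolding pd_eq_wirt[OF d] by (simp add: wirt_def[of _ "\<lambda>v. u' (f' v)"] ax ex field_simps)
  then show "pd (Inl a) (\<lambda>w. u (\<phi> w)) z = (\<Sum>c\<in>UNIV. pd (Inl a) (\<lambda>w. \<phi> w $ c) z * pd (Inl c) u (\<phi> z))"
    by (simp add: comp pd_eq_wirt[OF u'])
  have "pd (Inr a) (\<lambda>w. u (\<phi> w)) z = (\<Sum>c\<in>UNIV. cnj (f' (axis a 1) $ c) * wirt (Inr c) u')"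
    unfolding pd_eq_wirt[OF d] by (simp add: wirt_def[of _ "\<lambda>v. u' (f' v)"] ax ex field_simps)
  then show "pd (Inr a) (\<lambda>w. u (\<phi> w)) z = (\<Sum>c\<in>UNIV. cnj (pd (Inl a) (\<lambda>w. \<phi> w $ c) z) * pd (Inr c) u (\<phi> z))"
    by (simp add: comp pd_eq_wirt[OF u'])
qed

section \<open>The Ricci tensor under a holomorphic change of coordinates\<close>

text \<open>Two charts with overlap \<open>W\<close> in the coordinates of the first; \<phi> is the
  change to those of the second, and \<open>metric\<close> the tensor transformation law.\<close>

locale kaehler_transition = src: kaehler_domain S h + tgt: kaehler_domain T k
  for S :: "(complex ^ 'm::finite) set" and h :: "'m metric_comp"
    and T :: "(complex ^ 'm) set" and k :: "'m metric_comp" +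
  fixes W :: "(complex ^ 'm) set" and \<phi> :: "complex ^ 'm \<Rightarrow> complex ^ 'm"
  assumes open_W: "open W" and W_S: "W \<subseteq> S" and \<phi>_T: "\<phi> ` W \<subseteq> T"
    and holomorphic: "holomorphic_map_on W \<phi>"
    and metric: "w \<in> W \<Longrightarrow> h w $ \<alpha> $ \<beta> = (\<Sum>\<gamma>\<in>UNIV. \<Sum>\<delta>\<in>UNIV.
       pd (Inl \<alpha>) (\<lambda>w. \<phi> w $ \<gamma>) w * cnj (pd (Inl \<beta>) (\<lambda>w. \<phi> w $ \<delta>) w) * k (\<phi> w) $ \<gamma> $ \<delta>)"
begin

definition J :: "complex ^ 'm \<Rightarrow> complex ^ 'm ^ 'm" where
  "J w = (\<chi> \<alpha> \<gamma>. pd (Inl \<alpha>) (\<lambda>w. \<phi> w $ \<gamma>) w)"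

lemma in_S: "w \<in> W \<Longrightarrow> w \<in> S" and in_T: "w \<in> W \<Longrightarrow> \<phi> w \<in> T"
  using W_S \<phi>_T by auto

lemma hol_J: "hol_on W (\<lambda>w. J w $ a $ b)"
  unfolding J_def vec_lambda_beta
  using hol_on_pd_Inl[OF open_W holomorphic_map_on_component[OF holomorphic]] by (simp add: eta_contract_eq)

lemma smooth_J: "smooth_mat W J"
  unfolding smooth_mat_def using hol_on_imp_smooth_on[OF open_W hol_J] by blast

lemma h_eq: "w \<in> W \<Longrightarrow> h w = J w ** k (\<phi> w) ** hadj (J w)"
  by (simp add: vec_eq_iff frame_entry J_def metric)

lemma invertible_J: "w \<in> W \<Longrightarrow> invertible (J w)"
  using src.invertible_h[OF in_S, of w] h_eq[of w]
  by (metis (no_types, lifting) invertible_right_inverse matrix_mul_assoc)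

definition I :: "complex ^ 'm \<Rightarrow> complex ^ 'm ^ 'm" where
  "I w = matrix_inv (J w)"

lemma J_I: "w \<in> W \<Longrightarrow> J w ** I w = mat 1" and I_J: "w \<in> W \<Longrightarrow> I w ** J w = mat 1"
  using matrix_inv_inverse[OF invertible_J] by (auto simp: I_def)

lemma smooth_I: "smooth_mat W I"
  unfolding smooth_mat_def I_def
  using smooth_J[unfolded smooth_mat_def] invertible_J
  by (intro allI smooth_on_matrix_inv open_W) (auto simp: invertible_det_nz)

lemma hadj_J_I: "w \<in> W \<Longrightarrow> hadj (J w) ** hadj (I w) = mat 1"
  using I_J[of w] hadj_mult[of "I w" "J w"] by simp

lemma G_eq:
  assumes w: "w \<in> W"
  shows "src.G w = hadj (I w) ** tgt.G (\<phi> w) ** I w"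
  unfolding src.G_def
proof (rule matrix_inv_unique)
  have "h w ** (hadj (I w) ** tgt.G (\<phi> w) ** I w) =
      J w ** (k (\<phi> w) ** ((hadj (J w) ** hadj (I w)) ** tgt.G (\<phi> w))) ** I w"
    by (simp add: h_eq w matrix_mul_assoc)
  then show "h w ** (hadj (I w) ** tgt.G (\<phi> w) ** I w) = mat 1"
    by (simp add: hadj_J_I w tgt.h_G in_T J_I)
qed

lemma pdm_bar_J: "w \<in> W \<Longrightarrow> pdm (Inr b) J w = 0"
  by (simp add: pdm_def vec_eq_iff hol_on_pd(1)[OF hol_J])

lemma diff_J: "w \<in> W \<Longrightarrow> diff_mat J w" and diff_I: "w \<in> W \<Longrightarrow> diff_mat I w"
  using smooth_mat_imp_diff_mat smooth_J smooth_I by blast+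

lemma pdm_bar_I:
  assumes w: "w \<in> W"
  shows "pdm (Inr b) I w = 0"
proof -
  have "pdm (Inr b) (\<lambda>w. J w ** I w) w = pdm (Inr b) (\<lambda>w. mat 1) w"
    by (rule pdm_cong_open[OF open_W w J_I])
      (auto intro!: smooth_mat_imp_diff_mat[OF smooth_mat_mult[OF open_W smooth_J smooth_I] w])
  then have "J w ** pdm (Inr b) I w = 0"
    by (simp add: pdm_mult diff_J diff_I w pdm_bar_J pdm_const)
  then have "I w ** (J w ** pdm (Inr b) I w) = 0" by simp
  then show ?thesis by (simp add: matrix_mul_assoc I_J w)
qed

lemma pdm_compose:
  assumes w: "w \<in> W" and M: "smooth_mat T M"
  shows "diff_mat (\<lambda>w. M (\<phi> w)) w"
    and "pdm (Inl a) (\<lambda>w. M (\<phi> w)) w $ i $ j = (\<Sum>c\<in>UNIV. J w $ a $ c * pdm (Inl c) M (\<phi> w) $ i $ j)"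
proof -
  have u: "(\<lambda>v. M v $ i $ j) differentiable (at (\<phi> w))" for i j
    using smooth_mat_imp_diff_mat[OF M in_T[OF w]] by (simp add: diff_mat_def)
  show "diff_mat (\<lambda>w. M (\<phi> w)) w"
    unfolding diff_mat_def using pd_compose_holomorphic(1)[OF holomorphic w u] by blast
  show "pdm (Inl a) (\<lambda>w. M (\<phi> w)) w $ i $ j = (\<Sum>c\<in>UNIV. J w $ a $ c * pdm (Inl c) M (\<phi> w) $ i $ j)"
    using pd_compose_holomorphic(2)[OF holomorphic w u] by (simp add: pdm_def J_def)
qed

text \<open>The logarithmic derivative of det h = det J * det k * cnj (det J). The first summand is
  that of det J, and the antiholomorphic factor contributes nothing.\<close>

lemma trace_Chr:
  assumes w: "w \<in> W"
  shows "trace (src.Chr a w) = trace (pdm (Inl a) J w ** I w) + (\<Sum>c\<in>UNIV. J w $ a $ c * trace (tgt.Chr c (\<phi> w)))"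
proof -
  let ?K = "\<lambda>w. k (\<phi> w)"
  note dK = pdm_compose(1)[OF w tgt.smooth_h]
  have dadj: "diff_mat (\<lambda>w. hadj (J w)) w"
    using diff_J[OF w] by (auto simp: diff_mat_def hadj_def intro: differentiable_cnj)
  have dJK: "diff_mat (\<lambda>w. J w ** ?K w) w"
    using diff_J[OF w] dK unfolding diff_mat_def matrix_matrix_mult_def
    by (auto intro!: differentiable_sum differentiable_mult)
  have dh: "diff_mat (\<lambda>w. J w ** ?K w ** hadj (J w)) w"
    using dJK dadj unfolding diff_mat_def matrix_matrix_mult_def[of _ "hadj _"]
    by (auto intro!: differentiable_sum differentiable_mult)
  have "pdm (Inl a) h w = pdm (Inl a) (\<lambda>w. J w ** ?K w ** hadj (J w)) w"
    using smooth_mat_imp_diff_mat[OF src.smooth_h in_S[OF w]] by (intro pdm_cong_open[OF open_W w h_eq])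
  also have "\<dots> = (pdm (Inl a) J w ** ?K w + J w ** pdm (Inl a) ?K w) ** hadj (J w)"
    using pdm_hadj[OF diff_J[OF w], of "Inl a"]
    by (simp add: pdm_mult dJK dadj diff_J w dK pdm_bar_J) (simp add: hadj_def zero_vec_def[symmetric])
  finally have "trace (src.Chr a w) = trace ((pdm (Inl a) J w ** ?K w + J w ** pdm (Inl a) ?K w) ** hadj (J w) ** (hadj (I w) ** tgt.G (\<phi> w) ** I w))"
    by (simp add: src.Chr_def G_eq w)
  also have "\<dots> = trace ((pdm (Inl a) J w ** ?K w + J w ** pdm (Inl a) ?K w) ** (hadj (J w) ** hadj (I w)) ** tgt.G (\<phi> w) ** I w)"
    by (simp add: matrix_mul_assoc)
  also have "\<dots> = trace (pdm (Inl a) J w ** (?K w ** tgt.G (\<phi> w)) ** I w) + trace (J w ** (pdm (Inl a) ?K w ** tgt.G (\<phi> w)) ** I w)"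
    by (simp add: hadj_J_I w matrix_mult_add_left trace_add matrix_mul_assoc)
  also have "trace (pdm (Inl a) J w ** (?K w ** tgt.G (\<phi> w)) ** I w) = trace (pdm (Inl a) J w ** I w)"
    by (simp add: tgt.h_G in_T w)
  also have "trace (J w ** (pdm (Inl a) ?K w ** tgt.G (\<phi> w)) ** I w) = trace (pdm (Inl a) ?K w ** tgt.G (\<phi> w))"
    using trace_mul_sym[of "J w" "pdm (Inl a) ?K w ** tgt.G (\<phi> w) ** I w"]
    by (simp add: matrix_mul_assoc I_J w flip: matrix_mul_assoc[of _ "I w" "J w"])
  also have "\<dots> = (\<Sum>i\<in>UNIV. \<Sum>j\<in>UNIV. \<Sum>c\<in>UNIV. J w $ a $ c * (pdm (Inl c) k (\<phi> w) $ i $ j * tgt.G (\<phi> w) $ j $ i))"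
    by (simp add: trace_mult_eq pdm_compose(2)[OF w tgt.smooth_h] sum_distrib_right mult.assoc)
  also have "\<dots> = (\<Sum>i\<in>UNIV. \<Sum>c\<in>UNIV. \<Sum>j\<in>UNIV. J w $ a $ c * (pdm (Inl c) k (\<phi> w) $ i $ j * tgt.G (\<phi> w) $ j $ i))"
    by (intro sum.cong refl sum.swap)
  also have "\<dots> = (\<Sum>c\<in>UNIV. \<Sum>i\<in>UNIV. \<Sum>j\<in>UNIV. J w $ a $ c * (pdm (Inl c) k (\<phi> w) $ i $ j * tgt.G (\<phi> w) $ j $ i))"
    by (rule sum.swap)
  also have "\<dots> = (\<Sum>c\<in>UNIV. J w $ a $ c * trace (tgt.Chr c (\<phi> w)))"
    by (simp add: tgt.Chr_def trace_mult_eq sum_distrib_left)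
  finally show ?thesis .
qed

text \<open>The barred derivative of \<open>trace_Chr\<close>: the Jacobian summand is holomorphic
  and drops out, and the remaining sum acquires the conjugate Jacobian from the chain rule.\<close>

lemma Ric_eq:
  assumes w: "w \<in> W"
  shows "src.Ric w = J w ** tgt.Ric (\<phi> w) ** hadj (J w)"
proof -
  have sJ: "smooth_mat W (\<lambda>w. pdm (Inl a) J w ** I w)" for a
    by (intro smooth_mat_mult smooth_mat_pdm open_W smooth_J smooth_I)
  have bar0: "pd (Inr b) (\<lambda>w. trace (pdm (Inl a) J w ** I w)) w = 0" for a b
  proof -
    have dJ: "diff_mat (pdm (Inl a) J) w"
      by (rule smooth_mat_imp_diff_mat[OF smooth_mat_pdm[OF open_W smooth_J] w])
    have hol: "hol_on W (\<lambda>w. pdm (Inl a) J w $ i $ j)" for i j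
      using hol_on_pd_Inl[OF open_W hol_J[of i j], of a] by (simp add: pdm_def eta_contract_eq)
    then have "pdm (Inr b) (pdm (Inl a) J) w = 0"
      by (simp add: pdm_def[of "Inr b"] vec_eq_iff hol_on_pd(1)[OF hol w])
    then show ?thesis
      by (simp add: pd_trace smooth_mat_imp_diff_mat[OF sJ w] pdm_mult dJ diff_I w pdm_bar_I) (simp add: trace_def)
  qed
  have du: "(\<lambda>v. trace (tgt.Chr c v)) differentiable (at (\<phi> w))" for c
    using smooth_on_trace[OF tgt.open_S tgt.smooth_Chr] in_T[OF w] by (rule smooth_on_imp_differentiable)
  note dc = pd_compose_holomorphic[OF holomorphic w du]
  have dJ: "(\<lambda>w. J w $ a $ c) differentiable (at w)" for a c
    using diff_J[OF w] by (simp add: diff_mat_def)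
  have bJ: "pd (Inr b) (\<lambda>w. J w $ a $ c) w = 0" for a b c
    by (rule hol_on_pd(1)[OF hol_J w])
  have "src.Ric w $ a $ b = (J w ** tgt.Ric (\<phi> w) ** hadj (J w)) $ a $ b" for a b
  proof -
    have "pd (Inr b) (\<lambda>w. trace (src.Chr a w)) w =
       pd (Inr b) (\<lambda>w. trace (pdm (Inl a) J w ** I w) + (\<Sum>c\<in>UNIV. J w $ a $ c * trace (tgt.Chr c (\<phi> w)))) w"
      by (rule pd_cong_open[OF open_W w trace_Chr])
        (auto intro!: smooth_on_imp_differentiable[OF smooth_on_trace[OF src.open_S src.smooth_Chr] in_S[OF w]])
    also have "\<dots> = (\<Sum>c\<in>UNIV. J w $ a $ c * pd (Inr b) (\<lambda>w. trace (tgt.Chr c (\<phi> w))) w)"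
      by (subst pd_add) (auto simp: bar0 pd_sum pd_mult dJ dc(1) bJ differentiable_mult
          intro!: differentiable_sum smooth_on_imp_differentiable[OF smooth_on_trace[OF open_W sJ] w])
    also have "\<dots> = - (\<Sum>c\<in>UNIV. \<Sum>d\<in>UNIV. J w $ a $ c * cnj (J w $ b $ d) * tgt.Ric (\<phi> w) $ c $ d)"
      by (simp add: dc(3) tgt.Ric_eq_pd in_T w J_def sum_distrib_left sum_negf mult.assoc)
    finally show ?thesis
      by (simp add: src.Ric_eq_pd in_S w frame_entry)
  qed
  then show ?thesis by (simp add: vec_eq_iff)
qed

text \<open>Ric G is an endomorphism, so a change of coordinates conjugates it by the Jacobian and
  leaves traces of its powers unchanged.\<close>

lemma ricci_norm_eq:
  assumes w: "w \<in> W"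
  shows "trace (src.Ric w ** src.G w ** src.Ric w ** src.G w) =
    trace (tgt.Ric (\<phi> w) ** tgt.G (\<phi> w) ** tgt.Ric (\<phi> w) ** tgt.G (\<phi> w))"
proof -
  let ?A = "tgt.Ric (\<phi> w) ** tgt.G (\<phi> w)"
  have RG: "src.Ric w ** src.G w = J w ** ?A ** I w"
  proof -
    have "src.Ric w ** src.G w = J w ** (tgt.Ric (\<phi> w) ** ((hadj (J w) ** hadj (I w)) ** tgt.G (\<phi> w))) ** I w"
      by (simp add: Ric_eq G_eq w matrix_mul_assoc)
    then show ?thesis by (simp add: hadj_J_I w)
  qed
  have "src.Ric w ** src.G w ** src.Ric w ** src.G w = (J w ** ?A ** I w) ** (J w ** ?A ** I w)"
    unfolding RG[symmetric] by (simp add: matrix_mul_assoc)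
  also have "\<dots> = J w ** (?A ** ((I w ** J w) ** ?A) ** I w)"
    by (simp add: matrix_mul_assoc)
  also have "\<dots> = J w ** (?A ** ?A ** I w)" by (simp add: I_J w)
  finally have "trace (src.Ric w ** src.G w ** src.Ric w ** src.G w) = trace (?A ** ?A ** I w ** J w)"
    by (simp add: trace_mul_sym[of "J w"])
  also have "\<dots> = trace (?A ** ?A ** (I w ** J w))" by (simp add: matrix_mul_assoc)
  finally show ?thesis by (simp add: I_J w matrix_mul_assoc)
qed

end

lemma fnorm2_eq_0: "fnorm2 X = 0 \<longleftrightarrow> X = 0"
  by (simp add: fnorm2_def sum_nonneg_eq_0_iff sum_nonneg vec_eq_iff)

context kaehler_frame
begin

text \<open>Links the function being maximised to \<open>E\<close>: they differ by a constant, the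
  same at all points and in all charts.\<close>

lemma ricci_norm_frame:
  "trace (Ric z ** G z ** Ric z ** G z) = of_real (fnorm2 E + R\<^sup>2 / real CARD('m))"
proof -
  have hE: "hadj E = E"
    by (simp add: E_def hadj_diff hadj_rf) (auto simp: hadj_def mat_def vec_eq_iff)
  have "trace (Ric z ** G z ** Ric z ** G z) = trace (rf ** rf)"
    unfolding trace_frame2 rf_def ..
  also have "rf = E + mat (of_real R / of_nat CARD('m))" by (simp only: E_def diff_add_cancel)
  also have "trace ((E + mat (of_real R / of_nat CARD('m))) ** (E + mat (of_real R / of_nat CARD('m)))) =
      trace (E ** hadj E) + of_real R * of_real R / of_nat CARD('m)"
    unfolding trace_shift(1)[OF trace_E] hE using dim_nonzero by simp
  finally show ?thesis by (simp add: trace_hadj_self power2_eq_square)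
qed

lemma E_eq_0_iff: "E = 0 \<longleftrightarrow> (\<forall>\<alpha> \<beta>. traceless_ricci h z \<alpha> \<beta> = 0)"
proof -
  let ?T = "(\<chi> \<alpha> \<beta>. traceless_ricci h z \<alpha> \<beta>)"
  have "?T = (h z ** G z) ** ?T ** (G z ** h z)" by (simp add: h_G G_h z)
  also have "\<dots> = h z ** hadj V ** (V ** ?T ** hadj V) ** V ** h z"
    unfolding G_frame by (simp add: matrix_mul_assoc)
  finally have "?T = h z ** hadj V ** E ** V ** h z" by (simp only: traceless_frame)
  then have "E = 0 \<longleftrightarrow> ?T = 0"
    using traceless_frame by (metis times0_left times0_right)
  then show ?thesis by (simp add: vec_eq_iff)
qed

end

section \<open>The maximum principle on a compact manifold\<close>

lemma kaehler_domain_chart: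
  assumes "kaehler_manifold X A g" "c \<in> A"
  shows "kaehler_domain (chart_image c) (g c)"
  using assms
  by unfold_locales (auto simp: kaehler_manifold_def complex_manifold_def is_chart_def hermitian_metric_def)

lemma inv_into_chart:
  assumes "is_chart X c" "x \<in> fst c"
  shows "inv_into (fst c) (snd c) (snd c x) = x"
proof -
  have "fst c \<subseteq> topspace X" using assms(1) by (simp add: is_chart_def openin_subset)
  then have "inj_on (snd c) (fst c)"
    using assms(1) homeomorphic_imp_injective_map[of "subtopology X (fst c)" _ "snd c"]
    by (auto simp: is_chart_def Int_absorb1 inf_commute)
  then show ?thesis using assms(2) by simp
qed

lemma open_overlap:
  assumes "is_chart X c" "is_chart X d"
  shows "open (overlap c d)"
proof -
  have "open_map (subtopology X (fst c)) (top_of_set (chart_image c)) (snd c)"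
    using assms(1) homeomorphic_imp_open_map by (auto simp: is_chart_def)
  moreover have "openin (subtopology X (fst c)) (fst c \<inter> fst d)"
    using assms(2) by (auto simp: is_chart_def openin_subtopology)
  ultimately have "openin (top_of_set (chart_image c)) (overlap c d)"
    by (simp add: open_map_def overlap_def)
  then show ?thesis
    using assms(1) by (auto simp: is_chart_def openin_open_eq)
qed

lemma kaehler_transition_charts:
  assumes K: "kaehler_manifold X A g" and c: "c \<in> A" and d: "d \<in> A"
  shows "kaehler_transition (chart_image c) (g c) (chart_image d) (g d) (overlap c d) (transition c d)"
proof (rule kaehler_transition.intro[OF kaehler_domain_chart[OF K c] kaehler_domain_chart[OF K d]], unfold_locales)
  have ch: "is_chart X c" "is_chart X d" using K c d by (auto simp: kaehler_manifold_def complex_manifold_def)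
  show "open (overlap c d)" by (rule open_overlap[OF ch])
  show "overlap c d \<subseteq> chart_image c" by (auto simp: overlap_def chart_image_def)
  show "transition c d ` overlap c d \<subseteq> chart_image d"
    by (auto simp: overlap_def chart_image_def transition_def inv_into_chart[OF ch(1)])
  show "holomorphic_map_on (overlap c d) (transition c d)"
    using K c d by (auto simp: kaehler_manifold_def complex_manifold_def)
  show "g c w $ \<alpha> $ \<beta> = (\<Sum>\<gamma>\<in>UNIV. \<Sum>\<delta>\<in>UNIV.
       pd (Inl \<alpha>) (\<lambda>w. transition c d w $ \<gamma>) w * cnj (pd (Inl \<beta>) (\<lambda>w. transition c d w $ \<delta>) w) * g d (transition c d w) $ \<gamma> $ \<delta>)"
    if "w \<in> overlap c d" for w \<alpha> \<beta>
    using K c d that unfolding kaehler_manifold_def hermitian_metric_def by blast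
qed

definition ricci_norm2 :: "'m metric_comp \<Rightarrow> complex ^ 'm::finite \<Rightarrow> real" where
  "ricci_norm2 h z = Re (trace (kaehler_domain.Ric h z ** kaehler_domain.G h z ** kaehler_domain.Ric h z ** kaehler_domain.G h z))"

lemma ricci_norm2_chart_invariant:
  assumes K: "kaehler_manifold X A g" and c: "c \<in> A" and d: "d \<in> A" and x: "x \<in> fst c" "x \<in> fst d"
  shows "ricci_norm2 (g c) (snd c x) = ricci_norm2 (g d) (snd d x)"
proof -
  have "is_chart X c" using K c by (auto simp: kaehler_manifold_def complex_manifold_def)
  then have "transition c d (snd c x) = snd d x"
    by (simp add: transition_def inv_into_chart x)
  moreover have "snd c x \<in> overlap c d" using x by (simp add: overlap_def)
  ultimately show ?thesis
    using kaehler_transition.ricci_norm_eq[OF kaehler_transition_charts[OF K c d], of "snd c x"]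
    by (simp add: ricci_norm2_def)
qed

lemma (in kaehler_domain) smooth_ricci_norm: "smooth_on S (\<lambda>w. trace (Ric w ** G w ** Ric w ** G w))"
  by (intro smooth_on_trace open_S smooths smooth_Ric)

text \<open>Chart invariance glues the local functions to one function on the compact space,
  continuous because preimages of open sets are unions of open sets in the charts.\<close>

lemma ricci_norm2_attains_max:
  assumes K: "kaehler_manifold X A g" and compact: "compact_space X" and ne: "topspace X \<noteq> {}"
  obtains c x where "c \<in> A" "x \<in> fst c"
    "\<And>d y. d \<in> A \<Longrightarrow> y \<in> fst d \<Longrightarrow> ricci_norm2 (g d) (snd d y) \<le> ricci_norm2 (g c) (snd c x)"
proof -
  have cover: "(\<Union>c\<in>A. fst c) = topspace X" and ch: "\<And>c. c \<in> A \<Longrightarrow> is_chart X c"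
    using K by (auto simp: kaehler_manifold_def complex_manifold_def)
  \<comment> \<open>An arbitrary chart is chosen at each point; the fact \<open>F\<close> below
    removes the dependence on the choice.\<close>
  define F where "F x = (let c = (SOME c. c \<in> A \<and> x \<in> fst c) in ricci_norm2 (g c) (snd c x))" for x
  have F: "F x = ricci_norm2 (g c) (snd c x)" if "c \<in> A" "x \<in> fst c" for c x
  proof -
    have "(SOME c. c \<in> A \<and> x \<in> fst c) \<in> A \<and> x \<in> fst (SOME c. c \<in> A \<and> x \<in> fst c)"
      using that by (intro someI[of "\<lambda>c. c \<in> A \<and> x \<in> fst c"]) simp
    then show ?thesis
      unfolding F_def Let_def using that by (intro ricci_norm2_chart_invariant[OF K]) auto
  qed
  have "continuous_map X euclideanreal F"
    unfolding continuous_map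
  proof (intro conjI allI impI)
    fix U :: "real set" assume "openin euclideanreal U"
    then have "open U" by simp
    have "openin X {x \<in> fst c. ricci_norm2 (g c) (snd c x) \<in> U}" if c: "c \<in> A" for c
    proof -
      have o: "open (chart_image c)" "openin X (fst c)" and hm: "homeomorphic_map (subtopology X (fst c)) (top_of_set (chart_image c)) (snd c)"
        using ch[OF c] by (auto simp: is_chart_def)
      have "continuous_on (chart_image c) (ricci_norm2 (g c))"
        unfolding ricci_norm2_def[abs_def]
        using smooth_on_imp_continuous_on[OF kaehler_domain.smooth_ricci_norm[OF kaehler_domain_chart[OF K c]]]
        by (intro continuous_intros)
      then have "openin (top_of_set (chart_image c)) (chart_image c \<inter> ricci_norm2 (g c) -` U)"
        using \<open>open U\<close> by (simp add: continuous_on_open_invariant[of "chart_image c"] continuous_openin_preimage_gen)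
      then have "openin (subtopology X (fst c)) {x \<in> topspace (subtopology X (fst c)). snd c x \<in> chart_image c \<inter> ricci_norm2 (g c) -` U}"
        by (rule openin_continuous_map_preimage[OF homeomorphic_imp_continuous_map[OF hm]])
      moreover have "{x \<in> topspace (subtopology X (fst c)). snd c x \<in> chart_image c \<inter> ricci_norm2 (g c) -` U} =
          {x \<in> fst c. ricci_norm2 (g c) (snd c x) \<in> U}"
        using openin_subset[OF o(2)] by (auto simp: chart_image_def)
      ultimately show ?thesis using o(2) by (metis openin_trans_full)
    qed
    then have "openin X (\<Union>c\<in>A. {x \<in> fst c. ricci_norm2 (g c) (snd c x) \<in> U})" by blast
    also have "(\<Union>c\<in>A. {x \<in> fst c. ricci_norm2 (g c) (snd c x) \<in> U}) = {x \<in> topspace X. F x \<in> U}"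
      unfolding cover[symmetric] using F by auto
    finally show "openin X {x \<in> topspace X. F x \<in> U}" .
  qed auto
  then have "compactin euclideanreal (F ` topspace X)"
    using compact image_compactin unfolding compact_space_def by blast
  then have "compact (F ` topspace X)" by simp
  then obtain x where x: "x \<in> topspace X" "\<And>y. y \<in> topspace X \<Longrightarrow> F y \<le> F x"
    using compact_attains_sup[of "F ` topspace X"] ne by auto
  obtain c where c: "c \<in> A" "x \<in> fst c" using x(1) cover by blast
  show ?thesis
  proof (rule that[OF c])
    fix d y assume "d \<in> A" "y \<in> fst d"
    moreover from this have "y \<in> topspace X" using cover by blast
    ultimately show "ricci_norm2 (g d) (snd d y) \<le> ricci_norm2 (g c) (snd c x)"
      using x(2)[of y] F c by simp
  qed
qed

lemma kaehler_frame_exists: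
  fixes A :: "('a, 'm::finite) chart set"
  assumes K: "kaehler_manifold X A g" and c: "c \<in> A" and z: "z \<in> chart_image c"
    and s: "\<And>w. w \<in> chart_image c \<Longrightarrow> scalar_curv (g c) w = complex_of_real R"
  obtains V where "kaehler_frame (chart_image c) (g c) z V R"
proof -
  interpret kaehler_domain "chart_image c" "g c" by (rule kaehler_domain_chart[OF K c])
  obtain V :: "complex ^ 'm ^ 'm" where V: "V ** g c z ** hadj V = mat 1" using unitary_frame_exists[OF pos_def[OF z]] .
  have "kaehler_frame (chart_image c) (g c) z V R"
    using V s by unfold_locales (auto simp: z scalar_curv_eq)
  then show ?thesis by (rule that)
qed

theorem theorem3p4:
  fixes X :: "'a topology"
    and A :: "('a, 'm::finite) chart set"
    and g :: "('a, 'm) chart \<Rightarrow> 'm metric_comp"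
    and m :: nat
    and R :: real
  assumes m_def: "m = CARD('m)" and m_ge_2: "m \<ge> 2"
    and kaehler: "kaehler_manifold X A g"
    and compact: "compact_space X"
    and const_scalar: "\<And>c z. c \<in> A \<Longrightarrow> z \<in> chart_image c \<Longrightarrow> scalar_curv (g c) z = complex_of_real R"
    and pos_scalar: "R > 0"
    and pinching: "\<And>c z. c \<in> A \<Longrightarrow> z \<in> chart_image c \<Longrightarrow>
      sqrt 2 * norm11 (g c) z (traceless_ricci (g c) z) + norm22 (g c) z (bochner (g c) z)
        \<le> 2 / (real m + 1)
            * sqrt (2 * (real m + 1) * (real m + 2) / (2 * (real m)\<^sup>2 + 4 * real m + 3)) * R"
  shows "kaehler_einstein X A g"
proof (rule ccontr)
  assume "\<not> kaehler_einstein X A g"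
  then obtain c0 z0 \<alpha> \<beta> where c0: "c0 \<in> A" "z0 \<in> chart_image c0" "traceless_ricci (g c0) z0 \<alpha> \<beta> \<noteq> 0"
    using kaehler by (auto simp: kaehler_einstein_def)
  obtain x0 where x0: "x0 \<in> fst c0" "z0 = snd c0 x0" using c0(2) by (auto simp: chart_image_def)
  have "x0 \<in> topspace X"
    using kaehler c0(1) x0(1) by (auto simp: kaehler_manifold_def complex_manifold_def)
  then obtain c x where c: "c \<in> A" "x \<in> fst c"
    and max: "\<And>d y. d \<in> A \<Longrightarrow> y \<in> fst d \<Longrightarrow> ricci_norm2 (g d) (snd d y) \<le> ricci_norm2 (g c) (snd c x)"
    using ricci_norm2_attains_max[OF kaehler compact] by blast
  define z where "z = snd c x"
  have z: "z \<in> chart_image c" using c(2) by (simp add: z_def chart_image_def)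
  obtain V where V: "kaehler_frame (chart_image c) (g c) z V R"
    using kaehler_frame_exists[OF kaehler c(1) z const_scalar[OF c(1)]] .
  obtain V0 where V0: "kaehler_frame (chart_image c0) (g c0) z0 V0 R"
    using kaehler_frame_exists[OF kaehler c0(1,2) const_scalar[OF c0(1)]] .
  interpret kaehler_frame "chart_image c" "g c" z V R by (rule V)
  interpret P: kaehler_frame "chart_image c0" "g c0" z0 V0 R by (rule V0)
  have "P.E \<noteq> 0" using P.E_eq_0_iff c0(3) by blast
  then have "fnorm2 P.E > 0" using fnorm2_nonneg[of P.E] fnorm2_eq_0[of P.E] by linarith
  \<comment> \<open>The constant R^2/m cancels, so the norm of the traceless Ricci tensor at the
    maximum is at least that at \<open>z0\<close>. Hence it is nonzero at the maximum, where both
    Laplacian estimates apply.\<close>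
  moreover have "fnorm2 P.E \<le> fnorm2 E"
    using max[OF c0(1) x0(1)] P.ricci_norm_frame ricci_norm_frame
    by (simp add: ricci_norm2_def x0(2)[symmetric] z_def[symmetric])
  ultimately have "E \<noteq> 0" using fnorm2_eq_0[of E] by linarith
  then have "Re (\<Sum>c\<in>UNIV. \<Sum>d\<in>UNIV. G z $ d $ c * pd (Inl c) (pd (Inr d) (\<lambda>w. trace (Ric w ** G w ** Ric w ** G w))) z) > 0"
    using pinching[OF c(1) z] unfolding m_def by (rule laplacian_pos)
  moreover have "Re (\<Sum>c\<in>UNIV. \<Sum>d\<in>UNIV. G z $ d $ c * pd (Inl c) (pd (Inr d) (\<lambda>w. trace (Ric w ** G w ** Ric w ** G w))) z) \<le> 0"
    unfolding G_entry
  proof (rule laplacian_nonpos_at_max[OF open_S smooth_ricci_norm z])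
    fix w assume "w \<in> chart_image c"
    then obtain y where "y \<in> fst c" "w = snd c y" by (auto simp: chart_image_def)
    then show "Re (trace (Ric w ** G w ** Ric w ** G w)) \<le> Re (trace (Ric z ** G z ** Ric z ** G z))"
      using max[OF c(1), of y] by (simp add: ricci_norm2_def z_def)
  qed
  ultimately show False by simp
qed

end
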